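(* Suppose $\alpha\le\beta<1$. The value function of the entry problem is $V_2(p)=\bar g_2(p^\beta)$, where $\bar g_2$ is the smallest concave majorant on $[0,\infty)$ of $$g_2(\theta):=\max\Bigl\{(R+\Psi)^\alpha f\Bigl(\bigl(\tfrac{\gamma}{R+\Psi}\bigr)^\beta\theta\Bigr),\,-kR^\alpha\Bigr\},\qquad f(x):=\frac{\frac{\alpha}{\beta}c^{1-\beta}(c-1)^{\alpha-1}x-k\bigl(\frac{\lambda}{\gamma}x^{1/\beta}+1\bigr)^\beta}{\bigl(\frac{\lambda}{\gamma}x^{1/\beta}+1\bigr)^{\beta-\alpha}}.$$ Write $W(p):=\frac{\alpha}{\beta}c^{1-\beta}(c-1)^{\alpha-1}(\lambda p+\Psi+R)^{\alpha-\beta}(\gamma p)^\beta-k(\lambda p+\Psi+R)^\alpha$. There are three cases. (1) If $\frac{\lambda}{\gamma}\le\bigl[\frac{\alpha}{\beta k}c^{1-\beta}(c-1)^{\alpha-1}\bigr]^{1/\beta}$, there exists $p_1^*\in[0,\infty)$ such that the agent enters the trade when the price is at or above $p_1^*$ (the first time $P_t\in[p_1^*,\infty)$ is optimal for the entry problem), and $$V_2(p)=\begin{cases}W(p),&p\ge p_1^*,\\ \bigl(W(p_1^* )+kR^\alpha\bigr)\frac{p^\beta}{(p_1^* )^\beta}-kR^\alpha,&p<p_1^*.\end{cases}$$ (2) If $\frac{\lambda}{\gamma}>\bigl[\frac{\alpha}{\beta k}c^{1-\beta}(c-1)^{\alpha-1}\bigr]^{1/\beta}$, there exists a constant $C\in(0,\infty)$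 independent of $\Psi$ and $R$ such that: (a) If $\Psi<CR$, there exist $0\le p_1^*<p_2^*<\infty$ such that the agent enters the trade when the price is within $[p_1^*,p_2^*]$ (the first time $P_t\in[p_1^*,p_2^*]$ is optimal for the entry problem), and $$V_2(p)=\begin{cases}W(p_2^* ),&p>p_2^*,\\ W(p),&p_1^*\le p\le p_2^*,\\ \bigl(W(p_1^* )+kR^\alpha\bigr)\frac{p^\beta}{(p_1^* )^\beta}-kR^\alpha,&p<p_1^*.\end{cases}$$ (b) If $\Psi\ge CR$, the agent never enters the trade ($\tau=+\infty$ is optimal for the entry problem), and $V_2(p)=-kR^\alpha$. Moreover, in cases (1) and (2)(a), $p_1^*=\frac{R+\Psi}{\gamma}(x_1^* )^{1/\beta}$ where $x_1^*$ is the smaller solution (i.e. the smallest nonnegative solution) of $$k=\Bigl(1+\frac{\Psi}{R}\Bigr)^\alpha\,\frac{k\bigl(\frac{\lambda}{\gamma}x^{1/\beta}+1\bigr)^\beta\bigl[\frac{\lambda}{\gamma}\bigl(1-\frac{\alpha}{\beta}\bigr)x^{1/\beta}+1\bigr]-\frac{\alpha}{\beta}c^{1-\beta}(c-1)^{\alpha-1}\frac{\lambda}{\gamma}\bigl(1-\frac{\alpha}{\beta}\bigr)x^{1/\beta+1}}{\bigl(\frac{\lambda}{\gamma}x^{1/\beta}+1\bigr)^{\beta-\alpha+1}}.$$ In case (2)(a), $p_2^*=\frac{R+\Psi}{\gamma}(x_2^* )^{1/\beta}$ where $x_2^*$ is the unique solution in $(0,\infty)$ of $$c^{1-\beta}(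c-1)^{\alpha-1}\Bigl(x^{-1/\beta}+\frac{\lambda\alpha}{\gamma\beta}\Bigr)-\frac{k\lambda}{\gamma}\Bigl(x^{-1/\beta}+\frac{\lambda}{\gamma}\Bigr)^\beta=0.$$
   Context: Setting. $(\Omega,\mathcal F,\{\mathcal F_t\},\mathbb P)$ is a filtered probability space satisfying the usual conditions and supporting a Brownian motion $B$. The asset price is a geometric Brownian motion $dP_t=P_t(\mu\,dt+\sigma\,dB_t)$, $P_0=p>0$, with $\mu\ge 0$, $\sigma>0$; $\beta:=1-\frac{2\mu}{\sigma^2}\le 1$. $\mathcal T$ is the set of $\{\mathcal F_t\}$-stopping times valued in $[0,+\infty]$. Parameters: $\lambda\ge 1$, $\gamma\in(0,1]$, $\Psi\ge0$, $R>0$, $\alpha\in(0,1)$, $k>1$. The utility function is $U(x)=x^\alpha$ for $x>0$ and $U(x)=-k|x|^\alpha$ for $x\le 0$. Exit problem: for $H>0$, $V_1(p;H):=\sup_{\nu\in\mathcal T}\mathbb E[U(\gamma P_\nu-H)\mid P_0=p]$. Entry problem: $G_2(p):=\max\{V_1(p;\lambda p+\Psi+R),\,U(-R)\}$ and $V_2(p):=\sup_{\tau\in\mathcal T}\mathbb E[G_2(P_\tau)\mid P_0=p]$. On the event that a stopping time equals $+\infty$ the price is taken to be $P_\infty:=\lim_{t\to\infty}P_t=0$ (which holds a.s. since $\beta>0$), with $V_1(0;H)=U(-H)$. The constant $c>1$ is the solution of $\frac{\alpha}{\beta}c(c-1)^{\alpha-1}-(c-1)^\alpha-k=0$. *)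

theory Defs
  imports "HOL-Probability.Probability"
begin

section \<open>Filtrations, Brownian motion, geometric Brownian motion\<close>

text \<open>
  Filtrations are indexed by \<open>[0, \<infinity>]\<close> so that the library's \<^const>\<open>stopping_time\<close> directly yields
  stopping times with values in \<open>[0, \<infinity>]\<close>.  The extra \<open>\<sigma>\<close>-algebra at \<open>\<infinity>\<close> is immaterial:
  the condition it imposes on a stopping time is that the whole space is measurable.
  Processes are indexed by \<^typ>\<open>real\<close> and only their values at times \<open>t \<ge> 0\<close> matter.
\<close>

definition usual_conditions :: "'a measure \<Rightarrow> (ennreal \<Rightarrow> 'a measure) \<Rightarrow> bool" where
  "usual_conditions M F \<longleftrightarrow>
     filtration (space M) F \<and> (\<forall>t. sets (F t) \<subseteq> sets M) \<and>
     complete_measure M \<and> null_sets M \<subseteq> sets (F 0) \<and>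
     (\<forall>t<\<top>. sets (F t) = (\<Inter>s\<in>{t<..}. sets (F s)))"

definition adapted :: "(ennreal \<Rightarrow> 'a measure) \<Rightarrow> (real \<Rightarrow> 'a \<Rightarrow> real) \<Rightarrow> bool" where
  "adapted F X \<longleftrightarrow> (\<forall>t\<ge>0. X t \<in> borel_measurable (F (ennreal t)))"

definition brownian_motion ::
    "'a measure \<Rightarrow> (ennreal \<Rightarrow> 'a measure) \<Rightarrow> (real \<Rightarrow> 'a \<Rightarrow> real) \<Rightarrow> bool" where
  "brownian_motion M F B \<longleftrightarrow>
     adapted F B \<and>
     (AE \<omega> in M. B 0 \<omega> = 0) \<and>
     (AE \<omega> in M. continuous_on {0..} (\<lambda>t. B t \<omega>)) \<and>
     (\<forall>s t. 0 \<le> s \<and> s < t \<longrightarrow>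
        distributed M lborel (\<lambda>\<omega>. B t \<omega> - B s \<omega>) (normal_density 0 (sqrt (t - s))) \<and>
        prob_space.indep_set M (sets (F (ennreal s)))
          (sets (vimage_algebra (space M) (\<lambda>\<omega>. B t \<omega> - B s \<omega>) borel)))"

definition tendsto_in_probability ::
    "'a measure \<Rightarrow> (nat \<Rightarrow> 'a \<Rightarrow> real) \<Rightarrow> ('a \<Rightarrow> real) \<Rightarrow> bool" where
  "tendsto_in_probability M Y Z \<longleftrightarrow>
     (\<forall>n. Y n \<in> borel_measurable M) \<and> Z \<in> borel_measurable M \<and>
     (\<forall>\<epsilon>>0. (\<lambda>n. measure M {\<omega> \<in> space M. \<epsilon> \<le> \<bar>Y n \<omega> - Z \<omega>\<bar>}) \<longlonglongrightarrow> 0)"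

text \<open>
  \<open>I\<close> is a version of the Ito integral of \<open>X\<close> with respect to \<open>B\<close> over \<open>[0, t]\<close>.  For integrands
  \<open>X\<close> that are adapted with almost surely continuous paths, the only ones used below, the Ito
  integral is the limit in probability of left-endpoint Riemann sums along grids of vanishing mesh, here
  \<open>t i / n\<close> for \<open>i = 0, \<dots>, n\<close>.
\<close>

definition has_ito_integral ::
    "'a measure \<Rightarrow> (real \<Rightarrow> 'a \<Rightarrow> real) \<Rightarrow> (real \<Rightarrow> 'a \<Rightarrow> real) \<Rightarrow> real \<Rightarrow> ('a \<Rightarrow> real) \<Rightarrow> bool" where
  "has_ito_integral M B X t I \<longleftrightarrow>
     tendsto_in_probability M
       (\<lambda>n \<omega>. \<Sum>i<n. X (t * real i / real n) \<omega> *
                 (B (t * real (Suc i) / real n) \<omega> - B (t * real i / real n) \<omega>)) I"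

text \<open>\<open>dX\<^sub>t = X\<^sub>t (\<mu> dt + \<sigma> dB\<^sub>t)\<close>, \<open>X\<^sub>0 = p\<close>, in integrated form.\<close>

definition geometric_brownian_motion ::
    "'a measure \<Rightarrow> (ennreal \<Rightarrow> 'a measure) \<Rightarrow> (real \<Rightarrow> 'a \<Rightarrow> real) \<Rightarrow> real \<Rightarrow> real \<Rightarrow> real \<Rightarrow>
     (real \<Rightarrow> 'a \<Rightarrow> real) \<Rightarrow> bool" where
  "geometric_brownian_motion M F B \<mu> \<sigma> p X \<longleftrightarrow>
     adapted F X \<and>
     (AE \<omega> in M. continuous_on {0..} (\<lambda>t. X t \<omega>)) \<and>
     (AE \<omega> in M. X 0 \<omega> = p) \<and>
     (\<forall>t\<ge>0. \<exists>I. has_ito_integral M B (\<lambda>s \<omega>. \<sigma> * X s \<omega>) t I \<and>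
        (AE \<omega> in M. X t \<omega> = p + integral {0..t} (\<lambda>s. \<mu> * X s \<omega>) + I \<omega>))"


section \<open>Exit and entry problems\<close>

text \<open>The price at a stopping time, with \<open>P\<^sub>\<infinity> = 0\<close>.\<close>

definition price_at :: "(real \<Rightarrow> 'a \<Rightarrow> real) \<Rightarrow> ('a \<Rightarrow> ennreal) \<Rightarrow> 'a \<Rightarrow> real" where
  "price_at X \<tau> \<omega> = (if \<tau> \<omega> = \<top> then 0 else X (enn2real (\<tau> \<omega>)) \<omega>)"

text \<open>The infimum of the empty set is \<open>\<infinity>\<close>.\<close>

definition first_time :: "(real \<Rightarrow> 'a \<Rightarrow> real) \<Rightarrow> real set \<Rightarrow> 'a \<Rightarrow> ennreal" where
  "first_time X A \<omega> = (INF t\<in>{t. 0 \<le> t \<and> X t \<omega> \<in> A}. ennreal t)"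

definition utility :: "real \<Rightarrow> real \<Rightarrow> real \<Rightarrow> real" where
  "utility \<alpha> k x = (if x > 0 then x powr \<alpha> else - k * \<bar>x\<bar> powr \<alpha>)"

text \<open>
  Below, \<open>P p\<close> is the price process started at \<open>p > 0\<close>, so that conditioning on \<open>P\<^sub>0 = p\<close> means
  using the process \<open>P p\<close>.  For \<open>0 < \<alpha> \<le> \<beta>\<close> all payoffs are integrable and all suprema
  are over nonempty sets that are bounded above, because \<open>P\<^sup>\<beta>\<close> is then a nonnegative martingale.
  In the exit value the second branch is the convention at the price \<open>p = 0\<close>; it is also used at
  negative \<open>p\<close>, which are never needed.
\<close>

definition exit_value ::
    "'a measure \<Rightarrow> (ennreal \<Rightarrow> 'a measure) \<Rightarrow> (real \<Rightarrow> real \<Rightarrow> 'a \<Rightarrow> real) \<Rightarrow>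
     real \<Rightarrow> real \<Rightarrow> real \<Rightarrow> real \<Rightarrow> real \<Rightarrow> real" where
  "exit_value M F P \<alpha> k \<gamma> p H =
     (if p > 0
      then (SUP \<nu>\<in>{\<nu>. stopping_time F \<nu>}.
              prob_space.expectation M (\<lambda>\<omega>. utility \<alpha> k (\<gamma> * price_at (P p) \<nu> \<omega> - H)))
      else utility \<alpha> k (- H))"

definition entry_payoff ::
    "'a measure \<Rightarrow> (ennreal \<Rightarrow> 'a measure) \<Rightarrow> (real \<Rightarrow> real \<Rightarrow> 'a \<Rightarrow> real) \<Rightarrow>
     real \<Rightarrow> real \<Rightarrow> real \<Rightarrow> real \<Rightarrow> real \<Rightarrow> real \<Rightarrow> real \<Rightarrow> real" where
  "entry_payoff M F P \<alpha> k \<gamma> lam \<Psi> R p =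
     max (exit_value M F P \<alpha> k \<gamma> p (lam * p + \<Psi> + R)) (utility \<alpha> k (- R))"

definition entry_objective ::
    "'a measure \<Rightarrow> (ennreal \<Rightarrow> 'a measure) \<Rightarrow> (real \<Rightarrow> real \<Rightarrow> 'a \<Rightarrow> real) \<Rightarrow>
     real \<Rightarrow> real \<Rightarrow> real \<Rightarrow> real \<Rightarrow> real \<Rightarrow> real \<Rightarrow> real \<Rightarrow> ('a \<Rightarrow> ennreal) \<Rightarrow> real" where
  "entry_objective M F P \<alpha> k \<gamma> lam \<Psi> R p \<tau> =
     prob_space.expectation M (\<lambda>\<omega>. entry_payoff M F P \<alpha> k \<gamma> lam \<Psi> R (price_at (P p) \<tau> \<omega>))"

definition entry_value ::
    "'a measure \<Rightarrow> (ennreal \<Rightarrow> 'a measure) \<Rightarrow> (real \<Rightarrow> real \<Rightarrow> 'a \<Rightarrow> real) \<Rightarrow>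
     real \<Rightarrow> real \<Rightarrow> real \<Rightarrow> real \<Rightarrow> real \<Rightarrow> real \<Rightarrow> real \<Rightarrow> real" where
  "entry_value M F P \<alpha> k \<gamma> lam \<Psi> R p =
     (SUP \<tau>\<in>{\<tau>. stopping_time F \<tau>}. entry_objective M F P \<alpha> k \<gamma> lam \<Psi> R p \<tau>)"

definition optimal_entry ::
    "'a measure \<Rightarrow> (ennreal \<Rightarrow> 'a measure) \<Rightarrow> (real \<Rightarrow> real \<Rightarrow> 'a \<Rightarrow> real) \<Rightarrow>
     real \<Rightarrow> real \<Rightarrow> real \<Rightarrow> real \<Rightarrow> real \<Rightarrow> real \<Rightarrow> real \<Rightarrow> ('a \<Rightarrow> ennreal) \<Rightarrow> bool" where
  "optimal_entry M F P \<alpha> k \<gamma> lam \<Psi> R p \<tau> \<longleftrightarrow>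
     stopping_time F \<tau> \<and>
     entry_objective M F P \<alpha> k \<gamma> lam \<Psi> R p \<tau> = entry_value M F P \<alpha> k \<gamma> lam \<Psi> R p"


section \<open>Functions and equations describing the solution\<close>

definition smallest_concave_majorant_on ::
    "real set \<Rightarrow> (real \<Rightarrow> real) \<Rightarrow> (real \<Rightarrow> real) \<Rightarrow> bool" where
  "smallest_concave_majorant_on S g h \<longleftrightarrow>
     concave_on S h \<and> (\<forall>x\<in>S. g x \<le> h x) \<and>
     (\<forall>h'. concave_on S h' \<and> (\<forall>x\<in>S. g x \<le> h' x) \<longrightarrow> (\<forall>x\<in>S. h x \<le> h' x))"

definition scaled_payoff_f :: "real \<Rightarrow> real \<Rightarrow> real \<Rightarrow> real \<Rightarrow> real \<Rightarrow> real \<Rightarrow> real \<Rightarrow> real" where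
  "scaled_payoff_f \<alpha> \<beta> k c \<gamma> lam x =
     (\<alpha> / \<beta> * c powr (1 - \<beta>) * (c - 1) powr (\<alpha> - 1) * x
        - k * (lam / \<gamma> * x powr (1 / \<beta>) + 1) powr \<beta>)
     / (lam / \<gamma> * x powr (1 / \<beta>) + 1) powr (\<beta> - \<alpha>)"

definition scaled_payoff_g2 ::
    "real \<Rightarrow> real \<Rightarrow> real \<Rightarrow> real \<Rightarrow> real \<Rightarrow> real \<Rightarrow> real \<Rightarrow> real \<Rightarrow> real \<Rightarrow> real" where
  "scaled_payoff_g2 \<alpha> \<beta> k c \<gamma> lam \<Psi> R \<theta> =
     max ((R + \<Psi>) powr \<alpha> * scaled_payoff_f \<alpha> \<beta> k c \<gamma> lam ((\<gamma> / (R + \<Psi>)) powr \<beta> * \<theta>))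
         (- k * R powr \<alpha>)"

definition entry_curve_W ::
    "real \<Rightarrow> real \<Rightarrow> real \<Rightarrow> real \<Rightarrow> real \<Rightarrow> real \<Rightarrow> real \<Rightarrow> real \<Rightarrow> real \<Rightarrow> real" where
  "entry_curve_W \<alpha> \<beta> k c \<gamma> lam \<Psi> R p =
     \<alpha> / \<beta> * c powr (1 - \<beta>) * (c - 1) powr (\<alpha> - 1)
       * (lam * p + \<Psi> + R) powr (\<alpha> - \<beta>) * (\<gamma> * p) powr \<beta>
     - k * (lam * p + \<Psi> + R) powr \<alpha>"

definition lower_threshold_eq ::
    "real \<Rightarrow> real \<Rightarrow> real \<Rightarrow> real \<Rightarrow> real \<Rightarrow> real \<Rightarrow> real \<Rightarrow> real \<Rightarrow> real \<Rightarrow> bool" where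
  "lower_threshold_eq \<alpha> \<beta> k c \<gamma> lam \<Psi> R x \<longleftrightarrow>
     k = (1 + \<Psi> / R) powr \<alpha> *
         ((k * (lam / \<gamma> * x powr (1 / \<beta>) + 1) powr \<beta>
              * (lam / \<gamma> * (1 - \<alpha> / \<beta>) * x powr (1 / \<beta>) + 1)
            - \<alpha> / \<beta> * c powr (1 - \<beta>) * (c - 1) powr (\<alpha> - 1)
              * (lam / \<gamma>) * (1 - \<alpha> / \<beta>) * x powr (1 / \<beta> + 1))
          / (lam / \<gamma> * x powr (1 / \<beta>) + 1) powr (\<beta> - \<alpha> + 1))"

definition upper_threshold_eq ::
    "real \<Rightarrow> real \<Rightarrow> real \<Rightarrow> real \<Rightarrow> real \<Rightarrow> real \<Rightarrow> real \<Rightarrow> bool" where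
  "upper_threshold_eq \<alpha> \<beta> k c \<gamma> lam x \<longleftrightarrow>
     c powr (1 - \<beta>) * (c - 1) powr (\<alpha> - 1) * (x powr (- 1 / \<beta>) + lam * \<alpha> / (\<gamma> * \<beta>))
     - k * lam / \<gamma> * (x powr (- 1 / \<beta>) + lam / \<gamma>) powr \<beta> = 0"

definition is_lower_threshold ::
    "real \<Rightarrow> real \<Rightarrow> real \<Rightarrow> real \<Rightarrow> real \<Rightarrow> real \<Rightarrow> real \<Rightarrow> real \<Rightarrow> real \<Rightarrow> bool" where
  "is_lower_threshold \<alpha> \<beta> k c \<gamma> lam \<Psi> R p\<^sub>1 \<longleftrightarrow>
     (\<exists>x\<^sub>1\<ge>0. lower_threshold_eq \<alpha> \<beta> k c \<gamma> lam \<Psi> R x\<^sub>1 \<and>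
        (\<forall>y\<ge>0. lower_threshold_eq \<alpha> \<beta> k c \<gamma> lam \<Psi> R y \<longrightarrow> x\<^sub>1 \<le> y) \<and>
        p\<^sub>1 = (R + \<Psi>) / \<gamma> * x\<^sub>1 powr (1 / \<beta>))"

definition is_upper_threshold ::
    "real \<Rightarrow> real \<Rightarrow> real \<Rightarrow> real \<Rightarrow> real \<Rightarrow> real \<Rightarrow> real \<Rightarrow> real \<Rightarrow> real \<Rightarrow> bool" where
  "is_upper_threshold \<alpha> \<beta> k c \<gamma> lam \<Psi> R p\<^sub>2 \<longleftrightarrow>
     (\<exists>x\<^sub>2>0. upper_threshold_eq \<alpha> \<beta> k c \<gamma> lam x\<^sub>2 \<and>
        (\<forall>y>0. upper_threshold_eq \<alpha> \<beta> k c \<gamma> lam y \<longrightarrow> y = x\<^sub>2) \<and>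
        p\<^sub>2 = (R + \<Psi>) / \<gamma> * x\<^sub>2 powr (1 / \<beta>))"

end

theory Submission
  imports Defs
begin

text \<open>
  The price is determined by its equation: with \<open>Y\<^sub>t = exp (- (\<mu> - \<sigma>\<^sup>2 / 2) t - \<sigma> B\<^sub>t)\<close>, telescoping
  \<open>P Y\<close> along a coarse grid, whose increments are computed as limits of Riemann sums along refinements,
  gives \<open>P\<^sub>t Y\<^sub>t = p\<close>.  Hence \<open>P\<^sup>\<beta>\<close> is an exponential martingale tending to \<open>0\<close>, so \<open>E P\<^sub>\<tau>\<^sup>\<beta> \<le> p\<^sup>\<beta>\<close> for
  every stopping time, a lower level is hit almost surely and an upper level \<open>b\<close> with probability at
  least \<open>(p / b)\<^sup>\<beta>\<close>.

  A payoff \<open>G\<close> with \<open>G x \<le> V + d (x\<^sup>\<beta> - p\<^sup>\<beta>)\<close>, \<open>d \<ge> 0\<close>, therefore has value at most \<open>V\<close>, and tangents of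
  the concave majorant in the variable \<open>\<theta> = p\<^sup>\<beta>\<close> supply such bounds, which hitting times attain.
  This solves the exit problem, whose value on the relevant prices is linear in \<open>\<theta>\<close>, and then the entry problem.
  There the rescaled payoff \<open>f\<close> is strictly concave as long as it increases, and the sign of \<open>f'\<close> is that of
  a convex function of \<open>x\<^bsup>- 1 / \<beta>\<^esup>\<close>; the lower threshold is where the intercept of the
  tangent equals the rescaled loss from not entering, and the upper threshold is the maximiser of \<open>f\<close>.
\<close>


section \<open>Gaussian increments of Brownian motion\<close>

text \<open>The Ito integral is available only as a limit in probability of left-endpoint sums at
  fixed times, and no moments of the price are known. Second moments are therefore taken of
  processes clamped at a level \<open>N\<close>, which agree with the true ones at all grid points
  on an event of probability tending to one. The grids are nested because the error of one Euler
  step over a coarse interval is itself only a limit of sums over fine steps; the fine mesh vanishes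
  before the coarse one.

  In the stopping problems mass can be lost where the stopping time is infinite, so the moment of
  order \<beta> is only bounded above. Hence the slopes \<open>d\<close> must be nonnegative, and
  beyond the maximiser of the payoff the majorant is constant instead of following the payoff down.

  The constant \<open>c\<close> marks where the gain branch of the exit payoff, in the variable
  \<open>x powr \<beta>\<close>, touches the line through the payoff at zero. As
  \<open>\<gamma> \<le> 1 \<le> lam\<close>, the reference point in the entry problem always exceeds
  the current exit proceeds, so the exit value is taken on this line and never beyond the tangency
  point.\<close>

context prob_space begin

lemma integrable_bounded_square:
  fixes f :: "'a \<Rightarrow> real"
  assumes "f \<in> borel_measurable M" "\<And>\<omega>. \<bar>f \<omega>\<bar> \<le> C"
  shows "integrable M (\<lambda>\<omega>. (f \<omega>)\<^sup>2)"
proof (rule integrable_const_bound[of _ "C\<^sup>2"])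
  show "AE \<omega> in M. norm ((f \<omega>)\<^sup>2) \<le> C\<^sup>2"
    using assms(2) by (intro AE_I2) (simp, metis abs_le_square_iff abs_ge_self order_trans)
qed (use assms(1) in auto)

end

locale brownian = prob_space M
  for M :: "'a measure" and F :: "ennreal \<Rightarrow> 'a measure" and B :: "real \<Rightarrow> 'a \<Rightarrow> real" +
  assumes usual: "usual_conditions M F" and bm: "brownian_motion M F B"
begin

lemma space_F [simp]: "space (F t) = space M"
  using usual by (auto simp: usual_conditions_def filtration_def)

lemma sets_F_mono: "s \<le> t \<Longrightarrow> sets (F s) \<subseteq> sets (F t)"
  using usual by (auto simp: usual_conditions_def filtration_def)

lemma sets_F: "sets (F t) \<subseteq> sets M"
  using usual by (auto simp: usual_conditions_def)

lemma measurable_F_mono: "f \<in> measurable (F s) N \<Longrightarrow> s \<le> t \<Longrightarrow> f \<in> measurable (F t) N"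
  using sets_F_mono[of s t] by (auto simp: measurable_def)

lemma measurable_F_M: "f \<in> measurable (F s) N \<Longrightarrow> f \<in> measurable M N"
  using sets_F[of s] by (auto simp: measurable_def)

lemma B_adapted: "0 \<le> s \<Longrightarrow> s \<le> t \<Longrightarrow> B s \<in> borel_measurable (F (ennreal t))"
  using bm measurable_F_mono[of "B s" "ennreal s" borel "ennreal t"]
  by (auto simp: brownian_motion_def adapted_def ennreal_leI)

lemma B_measurable: "0 \<le> s \<Longrightarrow> B s \<in> borel_measurable M"
  using B_adapted[of s s] measurable_F_M by auto

lemma B_0: "AE \<omega> in M. B 0 \<omega> = 0"
  and B_continuous: "AE \<omega> in M. continuous_on {0..} (\<lambda>t. B t \<omega>)"
  using bm by (auto simp: brownian_motion_def)

lemma increment_distributed: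
  "0 \<le> s \<Longrightarrow> s < t \<Longrightarrow>
    distributed M lborel (\<lambda>\<omega>. B t \<omega> - B s \<omega>) (normal_density 0 (sqrt (t - s)))"
  using bm by (auto simp: brownian_motion_def)

lemma increment_indep:
  fixes Z :: "'a \<Rightarrow> real" and g :: "real \<Rightarrow> real"
  assumes st: "0 \<le> s" "s < t" and Z: "Z \<in> borel_measurable (F (ennreal s))"
    and g: "g \<in> borel_measurable borel"
  shows "indep_var borel Z borel (\<lambda>\<omega>. g (B t \<omega> - B s \<omega>))"
proof -
  let ?D = "\<lambda>\<omega>. B t \<omega> - B s \<omega>"
  have Dm: "?D \<in> borel_measurable M"
    using B_measurable[of s] B_measurable[of t] st by auto
  have ind: "indep_set (sets (F (ennreal s))) (sets (vimage_algebra (space M) ?D borel))"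
    using bm st by (auto simp: brownian_motion_def)
  have "indep_var borel Z borel ?D"
    unfolding indep_var_eq
  proof (intro conjI)
    show "random_variable borel Z" using Z measurable_F_M by blast
    show "random_variable borel ?D" by fact
    have sub1: "sigma_sets (space M) {Z -` A \<inter> space M |A. A \<in> sets borel} \<subseteq> sets (F (ennreal s))"
      using measurable_sets[OF Z] sets.sigma_sets_subset[of "{Z -` A \<inter> space M |A. A \<in> sets borel}" "F (ennreal s)"]
      by auto
    have sub2: "sigma_sets (space M) {?D -` A \<inter> space M |A. A \<in> sets borel}
                \<subseteq> sets (vimage_algebra (space M) ?D borel)"
      by (simp add: sets_vimage_algebra sigma_sets_mono')
    show "indep_set (sigma_sets (space M) {Z -` A \<inter> space M |A. A \<in> sets borel})
       (sigma_sets (space M) {?D -` A \<inter> space M |A. A \<in> sets borel})"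
      using ind unfolding indep_set_def
      by (rule indep_sets_mono_sets) (use sub1 sub2 in \<open>auto split: bool.split\<close>)
  qed
  from indep_var_compose[OF this, of "\<lambda>x. x" borel g borel] g
  show ?thesis by (simp add: comp_def)
qed

lemma increment_expectation_mult:
  fixes Z :: "'a \<Rightarrow> real" and g :: "real \<Rightarrow> real"
  assumes st: "0 \<le> s" "s < t" and Z: "Z \<in> borel_measurable (F (ennreal s))" "integrable M Z"
    and g: "g \<in> borel_measurable borel" "integrable M (\<lambda>\<omega>. g (B t \<omega> - B s \<omega>))"
  shows "integrable M (\<lambda>\<omega>. Z \<omega> * g (B t \<omega> - B s \<omega>))"
    and "expectation (\<lambda>\<omega>. Z \<omega> * g (B t \<omega> - B s \<omega>)) = expectation Z * expectation (\<lambda>\<omega>. g (B t \<omega> - B s \<omega>))"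
  using indep_var_lebesgue_integral[OF increment_indep[OF st Z(1) g(1)] Z(2) g(2)]
    indep_var_integrable[OF increment_indep[OF st Z(1) g(1)] Z(2) g(2)] by auto

end

text \<open>Completing the square in the exponent moves the centre to \<open>b * s\<^sup>2\<close>
  and leaves a constant factor.\<close>

lemma normal_density_tilt:
  assumes "0 < s"
  shows "normal_density 0 s x * exp (b * x) = exp (b\<^sup>2 * s\<^sup>2 / 2) * normal_density (b * s\<^sup>2) s x"
proof -
  have "- x\<^sup>2 / (2 * s\<^sup>2) + b * x = b\<^sup>2 * s\<^sup>2 / 2 - (x - b * s\<^sup>2)\<^sup>2 / (2 * s\<^sup>2)"
    using assms by (simp add: field_simps power2_eq_square)
  then show ?thesis
    by (simp add: normal_density_def mult_exp_exp[symmetric] field_simps flip: exp_add)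
qed

text \<open>Exponential tilting turns the centred Gaussian into one with mean \<open>b s\<^sup>2\<close>, whose first two
  moments give these integrals.\<close>
lemma normal_exp_moment:
  fixes s b :: real and c0 c1 c2 :: real
  assumes s: "0 < s"
  shows "has_bochner_integral lborel
    (\<lambda>x. normal_density 0 s x * ((c0 + c1 * x + c2 * x\<^sup>2) * exp (b * x)))
    (exp (b\<^sup>2 * s\<^sup>2 / 2) * (c0 + c1 * (b * s\<^sup>2) + c2 * (s\<^sup>2 + (b * s\<^sup>2)\<^sup>2)))"
proof -
  let ?m = "b * s\<^sup>2" and ?n = "normal_density (b * s\<^sup>2) s"
  have m0: "has_bochner_integral lborel (\<lambda>x. ?n x) 1"
    using integrable_normal_density[OF s] integral_normal_density[OF s] has_bochner_integral_integrable by metis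
  have m1: "has_bochner_integral lborel (\<lambda>x. ?n x * (x - ?m)) 0"
    using normal_moment_odd[OF s, of ?m 0] by simp
  have m2: "has_bochner_integral lborel (\<lambda>x. ?n x * (x - ?m)\<^sup>2) (s\<^sup>2)"
    using normal_moment_even[OF s, of ?m 1] by simp
  have "has_bochner_integral lborel
     (\<lambda>x. exp (b\<^sup>2 * s\<^sup>2 / 2) * ((c0 + c1 * ?m + c2 * ?m\<^sup>2) * ?n x + (c1 + 2 * c2 * ?m) * (?n x * (x - ?m)) + c2 * (?n x * (x - ?m)\<^sup>2)))
     (exp (b\<^sup>2 * s\<^sup>2 / 2) * ((c0 + c1 * ?m + c2 * ?m\<^sup>2) * 1 + (c1 + 2 * c2 * ?m) * 0 + c2 * s\<^sup>2))"
    by (intro has_bochner_integral_add has_bochner_integral_mult_right m0 m1 m2)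
  also have "(\<lambda>x. exp (b\<^sup>2 * s\<^sup>2 / 2) * ((c0 + c1 * ?m + c2 * ?m\<^sup>2) * ?n x + (c1 + 2 * c2 * ?m) * (?n x * (x - ?m)) + c2 * (?n x * (x - ?m)\<^sup>2)))
     = (\<lambda>x. (exp (b\<^sup>2 * s\<^sup>2 / 2) * ?n x) * (c0 + c1 * x + c2 * x\<^sup>2))"
    by (rule ext) (simp add: power2_eq_square, algebra)
  also have "\<dots> = (\<lambda>x. normal_density 0 s x * ((c0 + c1 * x + c2 * x\<^sup>2) * exp (b * x)))"
    unfolding normal_density_tilt[OF s, symmetric] by (rule ext) (simp add: algebra_simps)
  finally show ?thesis by (simp add: algebra_simps)
qed

context brownian begin

text \<open>A quadratic polynomial times an exponential covers every function of a single increment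
  integrated below: increments and their squares with \<open>b = 0\<close>, the exponential
  martingale, and the product of an Euler factor with an exponential together with its
  square.\<close>

lemma increment_moment:
  fixes c0 c1 c2 b :: real
  assumes st: "0 \<le> s" "s < t"
  defines "g \<equiv> \<lambda>x::real. (c0 + c1 * x + c2 * x\<^sup>2) * exp (b * x)"
  shows "integrable M (\<lambda>\<omega>. g (B t \<omega> - B s \<omega>))"
    and "expectation (\<lambda>\<omega>. g (B t \<omega> - B s \<omega>)) =
      exp (b\<^sup>2 * (t - s) / 2) * (c0 + c1 * (b * (t - s)) + c2 * ((t - s) + (b * (t - s))\<^sup>2))"
proof -
  have gm: "g \<in> borel_measurable borel" by (simp add: g_def)
  have hb: "has_bochner_integral lborel (\<lambda>x. normal_density 0 (sqrt (t - s)) x * g x)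
    (exp (b\<^sup>2 * (t - s) / 2) * (c0 + c1 * (b * (t - s)) + c2 * ((t - s) + (b * (t - s))\<^sup>2)))"
    using normal_exp_moment[of "sqrt (t - s)" c0 c1 c2 b] st by (simp add: g_def)
  note D = increment_distributed[OF st]
  show "integrable M (\<lambda>\<omega>. g (B t \<omega> - B s \<omega>))"
    using distributed_integrable[OF D, of g] hb gm
    by (auto simp: has_bochner_integral_iff)
  show "expectation (\<lambda>\<omega>. g (B t \<omega> - B s \<omega>)) =
      exp (b\<^sup>2 * (t - s) / 2) * (c0 + c1 * (b * (t - s)) + c2 * ((t - s) + (b * (t - s))\<^sup>2))"
    using distributed_integral[OF D, of g] hb gm
    by (auto simp: has_bochner_integral_iff)
qed

text \<open>The cross terms vanish because each increment is independent of the past.\<close>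
lemma increment_sum_square:
  fixes g :: "real \<Rightarrow> real" and a :: "nat \<Rightarrow> 'a \<Rightarrow> real"
  assumes h: "0 < h" and g: "g \<in> borel_measurable borel"
    and g1: "\<And>s. 0 \<le> s \<Longrightarrow> integrable M (\<lambda>\<omega>. g (B (s + h) \<omega> - B s \<omega>))"
      "\<And>s. 0 \<le> s \<Longrightarrow> expectation (\<lambda>\<omega>. g (B (s + h) \<omega> - B s \<omega>)) = 0"
    and g2: "\<And>s. 0 \<le> s \<Longrightarrow> integrable M (\<lambda>\<omega>. (g (B (s + h) \<omega> - B s \<omega>))\<^sup>2)"
      "\<And>s. 0 \<le> s \<Longrightarrow> expectation (\<lambda>\<omega>. (g (B (s + h) \<omega> - B s \<omega>))\<^sup>2) = v"
    and a: "\<And>i. i < n \<Longrightarrow> a i \<in> borel_measurable (F (ennreal (real i * h)))"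
      "\<And>i \<omega>. i < n \<Longrightarrow> \<bar>a i \<omega>\<bar> \<le> C"
  defines "S \<equiv> \<lambda>n \<omega>. \<Sum>i<n. a i \<omega> * g (B (real i * h + h) \<omega> - B (real i * h) \<omega>)"
  shows "integrable M (\<lambda>\<omega>. (S n \<omega>)\<^sup>2) \<and>
    expectation (\<lambda>\<omega>. (S n \<omega>)\<^sup>2) = (\<Sum>i<n. expectation (\<lambda>\<omega>. (a i \<omega>)\<^sup>2)) * v"
proof -
  \<comment> \<open>Adaptedness of the partial sum is part of the induction, because it makes the
    sum independent of the next increment.\<close>
  have "l \<le> n \<Longrightarrow> S l \<in> borel_measurable (F (ennreal (real l * h))) \<and> integrable M (\<lambda>\<omega>. (S l \<omega>)\<^sup>2) \<and>
    expectation (\<lambda>\<omega>. (S l \<omega>)\<^sup>2) = (\<Sum>i<l. expectation (\<lambda>\<omega>. (a i \<omega>)\<^sup>2)) * v" for l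
  proof (induction l)
    case 0
    then show ?case by (simp add: S_def)
  next
    case (Suc l)
    let ?s = "real l * h"
    let ?G = "\<lambda>\<omega>. g (B (?s + h) \<omega> - B ?s \<omega>)"
    have l: "l < n" and s: "0 \<le> ?s" "?s < ?s + h" using Suc.prems h by auto
    have Sl: "S l \<in> borel_measurable (F (ennreal ?s))" and Sl2: "integrable M (\<lambda>\<omega>. (S l \<omega>)\<^sup>2)"
      and Sle: "expectation (\<lambda>\<omega>. (S l \<omega>)\<^sup>2) = (\<Sum>i<l. expectation (\<lambda>\<omega>. (a i \<omega>)\<^sup>2)) * v"
      using Suc by auto
    have SM: "S l \<in> borel_measurable M" and aM: "a l \<in> borel_measurable M"
      using measurable_F_M Sl a(1)[OF l] by blast+
    have S_eq: "S (Suc l) = (\<lambda>\<omega>. S l \<omega> + a l \<omega> * ?G \<omega>)"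
      by (simp add: S_def fun_eq_iff)
    have "S l \<in> borel_measurable (F (ennreal (?s + h)))" "a l \<in> borel_measurable (F (ennreal (?s + h)))"
      using measurable_F_mono[OF Sl, of "ennreal (?s+h)"] measurable_F_mono[OF a(1)[OF l], of "ennreal (?s+h)"] s h
      by (auto simp: ennreal_leI)
    moreover have "B (?s + h) \<in> borel_measurable (F (ennreal (?s + h)))" "B ?s \<in> borel_measurable (F (ennreal (?s + h)))"
      by (rule B_adapted; use s h in simp)+
    ultimately have meas: "S (Suc l) \<in> borel_measurable (F (ennreal (?s + h)))"
      unfolding S_eq using g by measurable
    have iS: "integrable M (S l)"
      using Sl2 SM square_integrable_imp_integrable by blast
    have iSa: "integrable M (\<lambda>\<omega>. S l \<omega> * a l \<omega>)"
    proof (rule Bochner_Integration.integrable_bound[OF integrable_mult_right[OF integrable_abs[OF iS], of C]])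
      show "(\<lambda>\<omega>. S l \<omega> * a l \<omega>) \<in> borel_measurable M" using SM aM by auto
      show "AE \<omega> in M. norm (S l \<omega> * a l \<omega>) \<le> norm (C * \<bar>S l \<omega>\<bar>)"
      proof (rule AE_I2)
        fix \<omega>
        have "\<bar>a l \<omega>\<bar> \<le> \<bar>C\<bar>" using a(2)[OF l, of \<omega>] by auto
        then show "norm (S l \<omega> * a l \<omega>) \<le> norm (C * \<bar>S l \<omega>\<bar>)"
          using mult_right_mono[of "\<bar>a l \<omega>\<bar>" "\<bar>C\<bar>" "\<bar>S l \<omega>\<bar>"]
            by (simp add: abs_mult mult.commute)
      qed
    qed
    have ia2: "integrable M (\<lambda>\<omega>. (a l \<omega>)\<^sup>2)"
      by (rule integrable_bounded_square[OF aM a(2)[OF l]])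
    have Sam: "(\<lambda>\<omega>. S l \<omega> * a l \<omega>) \<in> borel_measurable (F (ennreal ?s))"
      using Sl a(1)[OF l] by auto
    have a2m: "(\<lambda>\<omega>. (a l \<omega>)\<^sup>2) \<in> borel_measurable (F (ennreal ?s))"
      using a(1)[OF l] by auto
    have g2m: "(\<lambda>x. (g x)\<^sup>2) \<in> borel_measurable borel" using g by auto
    note c1 = increment_expectation_mult[OF s Sam iSa g g1(1)[OF s(1)]]
    note c2 = increment_expectation_mult[OF s a2m ia2 g2m g2(1)[OF s(1)]]
    have sq: "(\<lambda>\<omega>. (S (Suc l) \<omega>)\<^sup>2) =
        (\<lambda>\<omega>. (S l \<omega>)\<^sup>2 + 2 * (S l \<omega> * a l \<omega> * ?G \<omega>) + (a l \<omega>)\<^sup>2 * (?G \<omega>)\<^sup>2)"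
      unfolding S_eq by (rule ext) (simp add: power2_eq_square algebra_simps)
    have int: "integrable M (\<lambda>\<omega>. (S (Suc l) \<omega>)\<^sup>2)"
      unfolding sq using Sl2 c1(1) c2(1) by auto
    have "expectation (\<lambda>\<omega>. (S (Suc l) \<omega>)\<^sup>2) =
       expectation (\<lambda>\<omega>. (S l \<omega>)\<^sup>2) + 2 * expectation (\<lambda>\<omega>. S l \<omega> * a l \<omega> * ?G \<omega>) + expectation (\<lambda>\<omega>. (a l \<omega>)\<^sup>2 * (?G \<omega>)\<^sup>2)"
      unfolding sq using Sl2 c1(1) c2(1) by simp
    also have "\<dots> = (\<Sum>i<Suc l. expectation (\<lambda>\<omega>. (a i \<omega>)\<^sup>2)) * v"
      using c1(2) c2(2) g1(2)[OF s(1)] g2(2)[OF s(1)] Sle by (simp add: algebra_simps)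
    finally show ?case using meas int by (simp add: algebra_simps)
  qed
  from this[of n] show ?thesis by auto
qed

end


section \<open>Riemann sums and convergence in probability\<close>

context prob_space begin

lemma tendsto_in_probability_D:
  "tendsto_in_probability M Y Z \<Longrightarrow> 0 < e \<Longrightarrow> (\<lambda>n. prob {\<omega> \<in> space M. e \<le> \<bar>Y n \<omega> - Z \<omega>\<bar>}) \<longlonglongrightarrow> 0"
  by (auto simp: tendsto_in_probability_def)

lemma tendsto_in_probability_add:
  assumes "tendsto_in_probability M Y Z" "tendsto_in_probability M Y' Z'"
  shows "tendsto_in_probability M (\<lambda>n \<omega>. Y n \<omega> + Y' n \<omega>) (\<lambda>\<omega>. Z \<omega> + Z' \<omega>)"
proof -
  have [measurable]: "Y n \<in> borel_measurable M" "Z \<in> borel_measurable M"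
    "Y' n \<in> borel_measurable M" "Z' \<in> borel_measurable M" for n
    using assms by (auto simp: tendsto_in_probability_def)
  have "(\<lambda>n. prob {\<omega> \<in> space M. e \<le> \<bar>(Y n \<omega> + Y' n \<omega>) - (Z \<omega> + Z' \<omega>)\<bar>}) \<longlonglongrightarrow> 0" if "0 < e" for e :: real
  proof (rule tendsto_sandwich[OF _ _ tendsto_const])
    show "(\<lambda>n. prob {\<omega> \<in> space M. e/2 \<le> \<bar>Y n \<omega> - Z \<omega>\<bar>} + prob {\<omega> \<in> space M. e/2 \<le> \<bar>Y' n \<omega> - Z' \<omega>\<bar>}) \<longlonglongrightarrow> 0"
      using tendsto_add[OF assms[THEN tendsto_in_probability_D, of "e/2"]] that by simp
    show "\<forall>\<^sub>F n in sequentially. prob {\<omega> \<in> space M. e \<le> \<bar>(Y n \<omega> + Y' n \<omega>) - (Z \<omega> + Z' \<omega>)\<bar>} \<le>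
      prob {\<omega> \<in> space M. e/2 \<le> \<bar>Y n \<omega> - Z \<omega>\<bar>} + prob {\<omega> \<in> space M. e/2 \<le> \<bar>Y' n \<omega> - Z' \<omega>\<bar>}"
    proof (intro always_eventually allI)
      fix n
      have "prob {\<omega> \<in> space M. e \<le> \<bar>(Y n \<omega> + Y' n \<omega>) - (Z \<omega> + Z' \<omega>)\<bar>} \<le>
        prob ({\<omega> \<in> space M. e/2 \<le> \<bar>Y n \<omega> - Z \<omega>\<bar>} \<union> {\<omega> \<in> space M. e/2 \<le> \<bar>Y' n \<omega> - Z' \<omega>\<bar>})"
        by (intro finite_measure_mono) (auto simp: field_simps abs_if split: if_splits)
      also have "\<dots> \<le> prob {\<omega> \<in> space M. e/2 \<le> \<bar>Y n \<omega> - Z \<omega>\<bar>} + prob {\<omega> \<in> space M. e/2 \<le> \<bar>Y' n \<omega> - Z' \<omega>\<bar>}"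
        by (intro measure_Un_le) auto
      finally show "prob {\<omega> \<in> space M. e \<le> \<bar>(Y n \<omega> + Y' n \<omega>) - (Z \<omega> + Z' \<omega>)\<bar>} \<le> \<dots>" .
    qed
  qed auto
  then show ?thesis by (auto simp: tendsto_in_probability_def)
qed

lemma tendsto_in_probability_uminus:
  "tendsto_in_probability M Y Z \<Longrightarrow> tendsto_in_probability M (\<lambda>n \<omega>. - Y n \<omega>) (\<lambda>\<omega>. - Z \<omega>)"
  unfolding tendsto_in_probability_def by (simp add: abs_minus_commute)

lemma tendsto_in_probability_diff:
  assumes "tendsto_in_probability M Y Z" "tendsto_in_probability M Y' Z'"
  shows "tendsto_in_probability M (\<lambda>n \<omega>. Y n \<omega> - Y' n \<omega>) (\<lambda>\<omega>. Z \<omega> - Z' \<omega>)"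
  using tendsto_in_probability_add[OF assms(1) tendsto_in_probability_uminus[OF assms(2)]] by simp

lemma tendsto_in_probability_subseq:
  assumes "tendsto_in_probability M Y Z" "filterlim f at_top sequentially"
  shows "tendsto_in_probability M (\<lambda>n. Y (f n)) Z"
  using assms filterlim_compose[of _ _ sequentially f sequentially]
  unfolding tendsto_in_probability_def by blast

lemma tendsto_in_probability_AE:
  assumes [measurable]: "\<And>n. Y n \<in> borel_measurable M" "Z \<in> borel_measurable M"
    and lim: "AE \<omega> in M. (\<lambda>n. Y n \<omega>) \<longlonglongrightarrow> Z \<omega>"
  shows "tendsto_in_probability M Y Z"
proof -
  have "(\<lambda>n. prob {\<omega> \<in> space M. e \<le> \<bar>Y n \<omega> - Z \<omega>\<bar>}) \<longlonglongrightarrow> 0" if e: "0 < e" for e :: real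
  proof -
    let ?S = "\<lambda>n. {\<omega> \<in> space M. e \<le> \<bar>Y n \<omega> - Z \<omega>\<bar>}"
    have "(\<lambda>n. expectation (indicator (?S n))) \<longlonglongrightarrow> expectation (\<lambda>_. 0::real)"
    proof (rule integral_dominated_convergence[where w="\<lambda>_. 1"])
      show "AE \<omega> in M. (\<lambda>n. indicator (?S n) \<omega> :: real) \<longlonglongrightarrow> 0"
        using lim
      proof eventually_elim
        case (elim \<omega>)
        have "\<forall>\<^sub>F n in sequentially. \<bar>Y n \<omega> - Z \<omega>\<bar> < e"
          using tendstoD[OF elim e] by (simp add: dist_real_def)
        then have "\<forall>\<^sub>F n in sequentially. indicator (?S n) \<omega> = (0::real)"
          by eventually_elim auto
        then show ?case by (rule tendsto_eventually)
      qed
    qed (auto simp: indicator_def)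
    then show ?thesis by simp
  qed
  then show ?thesis by (auto simp: tendsto_in_probability_def)
qed

lemma prob_ge_le_second_moment:
  assumes T: "T \<in> borel_measurable M" "integrable M (\<lambda>\<omega>. (T \<omega>)\<^sup>2)" and e: "0 < e"
  shows "prob {\<omega> \<in> space M. e \<le> \<bar>T \<omega>\<bar>} \<le> expectation (\<lambda>\<omega>. (T \<omega>)\<^sup>2) / e\<^sup>2"
proof -
  have "{\<omega> \<in> space M. e \<le> \<bar>T \<omega>\<bar>} = {\<omega> \<in> space M. e\<^sup>2 \<le> (T \<omega>)\<^sup>2}"
    using e by (auto simp: abs_le_square_iff[symmetric])
  then show ?thesis
    using integral_Markov_inequality_measure[OF T(2), of "{}" "e\<^sup>2"] e by simp
qed

text \<open>Boundedness and path continuity make the mean square distance a continuous function of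
  the pair of times, by dominated convergence. It vanishes on the diagonal, and compactness of the
  square makes the continuity uniform.\<close>

lemma expectation_square_increment_continuous:
  fixes Z :: "real \<Rightarrow> 'a \<Rightarrow> real"
  assumes Z: "\<And>s. s \<in> {0..t} \<Longrightarrow> Z s \<in> borel_measurable M" "\<And>s \<omega>. \<bar>Z s \<omega>\<bar> \<le> N"
    and cont: "AE \<omega> in M. continuous_on {0..t} (\<lambda>s. Z s \<omega>)" and e: "0 < e"
  shows "\<exists>d>0. \<forall>r\<in>{0..t}. \<forall>s\<in>{0..t}. \<bar>r - s\<bar> < d \<longrightarrow> expectation (\<lambda>\<omega>. (Z r \<omega> - Z s \<omega>)\<^sup>2) \<le> e"
proof -
  let ?D = "\<lambda>x. expectation (\<lambda>\<omega>. (Z (fst x) \<omega> - Z (snd x) \<omega>)\<^sup>2)"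
  let ?S = "{0..t} \<times> {0..t}"
  have "continuous_on ?S ?D"
  proof (rule continuous_on_sequentiallyI)
    fix u and a assume u: "\<forall>n. u n \<in> ?S" and a: "a \<in> ?S" and lim: "u \<longlonglongrightarrow> a"
    show "(\<lambda>n. ?D (u n)) \<longlonglongrightarrow> ?D a"
    proof (rule integral_dominated_convergence[where w="\<lambda>_. (2 * N)\<^sup>2"])
      show "(\<lambda>\<omega>. (Z (fst a) \<omega> - Z (snd a) \<omega>)\<^sup>2) \<in> borel_measurable M"
        using Z(1) a by (auto simp: mem_Times_iff)
      show "(\<lambda>\<omega>. (Z (fst (u n)) \<omega> - Z (snd (u n)) \<omega>)\<^sup>2) \<in> borel_measurable M" for n
        using Z(1) u by (auto simp: mem_Times_iff)
      show "AE \<omega> in M. (\<lambda>n. (Z (fst (u n)) \<omega> - Z (snd (u n)) \<omega>)\<^sup>2) \<longlonglongrightarrow> (Z (fst a) \<omega> - Z (snd a) \<omega>)\<^sup>2"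
        using cont
      proof eventually_elim
        case (elim \<omega>)
        have "(\<lambda>n. Z (fst (u n)) \<omega>) \<longlonglongrightarrow> Z (fst a) \<omega>" "(\<lambda>n. Z (snd (u n)) \<omega>) \<longlonglongrightarrow> Z (snd a) \<omega>"
          using u a by (auto intro!: continuous_on_tendsto_compose[OF elim] tendsto_fst tendsto_snd lim
              simp: mem_Times_iff)
        then show ?case by (intro tendsto_intros)
      qed
      show "AE \<omega> in M. norm ((Z (fst (u n)) \<omega> - Z (snd (u n)) \<omega>)\<^sup>2) \<le> (2 * N)\<^sup>2" for n
      proof (rule AE_I2)
        fix \<omega>
        have "\<bar>Z (fst (u n)) \<omega> - Z (snd (u n)) \<omega>\<bar> \<le> \<bar>2 * N\<bar>"
          using Z(2)[of "fst (u n)" \<omega>] Z(2)[of "snd (u n)" \<omega>] by linarith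
        then show "norm ((Z (fst (u n)) \<omega> - Z (snd (u n)) \<omega>)\<^sup>2) \<le> (2 * N)\<^sup>2"
          by (simp add: abs_le_square_iff)
      qed
    qed auto
  qed
  moreover have "compact ?S" by (intro compact_Times compact_Icc)
  ultimately have "uniformly_continuous_on ?S ?D"
    by (rule compact_uniformly_continuous)
  then obtain d where d: "0 < d" "\<And>x x'. x \<in> ?S \<Longrightarrow> x' \<in> ?S \<Longrightarrow> dist x' x < d \<Longrightarrow> dist (?D x') (?D x) < e"
    unfolding uniformly_continuous_on_def using e by meson
  have "?D (r, s) \<le> e" if "r \<in> {0..t}" "s \<in> {0..t}" "\<bar>r - s\<bar> < d" for r s
    using d(2)[of "(s, s)" "(r, s)"] that by (auto simp: dist_Pair_Pair dist_real_def)
  then show ?thesis using d(1) by auto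
qed

end

lemma left_riemann_sums_tendsto:
  fixes f :: "real \<Rightarrow> real"
  assumes t: "0 \<le> t" and f: "continuous_on {0..t} f"
  shows "(\<lambda>m. \<Sum>j<m. f (t * real j / real m) * (t / real m)) \<longlonglongrightarrow> integral {0..t} f"
proof (rule LIMSEQ_I)
  fix e :: real assume e: "0 < e"
  \<comment> \<open>Adding one keeps the quotient meaningful and \<open>e' * t < e\<close> valid
    also for \<open>t = 0\<close>.\<close>
  define e' where "e' = e / (t + 1)"
  have e': "0 < e'" "e' * t < e" using e t by (auto simp: e'_def field_simps)
  obtain d where d: "0 < d" "\<And>x x'. x \<in> {0..t} \<Longrightarrow> x' \<in> {0..t} \<Longrightarrow> dist x' x < d \<Longrightarrow> dist (f x') (f x) < e'"
    using compact_uniformly_continuous[OF f compact_Icc] e'(1)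
    unfolding uniformly_continuous_on_def by meson
  obtain m0 :: nat where m0: "t / d < real m0" using reals_Archimedean2 by blast
  have "norm ((\<Sum>j<m. f (t * real j / real m) * (t / real m)) - integral {0..t} f) < e" if m: "m \<ge> Suc m0" for m
  proof -
    have mpos: "0 < real m" using m by simp
    have "t / d < real m" using m0 m by linarith
    then have small: "t / real m < d" using mpos d(1) by (simp add: field_simps)
    have int: "f integrable_on {a..b}" if "0 \<le> a" "b \<le> t" for a b
      using integrable_continuous_interval continuous_on_subset[OF f] that by (metis atLeastatMost_subset_iff)
    let ?x = "\<lambda>j. t * real j / real m"
    have xm: "?x i \<le> ?x j" if "i \<le> j" for i j using that t by (simp add: divide_right_mono mult_left_mono)
    have x_le: "?x j \<le> t" if "j \<le> m" for j using xm[OF that] mpos by simp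
    have x_ge: "0 \<le> ?x j" for j using t by simp
    \<comment> \<open>The error up to the \<open>l\<close>-th point is at most \<open>e'\<close>
      times the length covered so far, so the errors of the cells add up to at most
      \<open>e' * t\<close>.\<close>
    have "l \<le> m \<Longrightarrow> \<bar>(\<Sum>j<l. f (?x j) * (t / real m)) - integral {0..?x l} f\<bar> \<le> e' * ?x l" for l
    proof (induction l)
      case 0
      then show ?case by simp
    next
      case (Suc l)
      have w: "?x (Suc l) - ?x l = t / real m" by (simp add: distrib_left add_divide_distrib)
      have "integral {0..?x l} f + integral {?x l..?x (Suc l)} f = integral {0..?x (Suc l)} f"
        by (rule Henstock_Kurzweil_Integration.integral_combine)
          (use x_ge xm[of l "Suc l"] int[of 0 "?x (Suc l)"] x_le[OF Suc.prems] in auto)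
      moreover have "\<bar>integral {?x l..?x (Suc l)} (\<lambda>s. f s - f (?x l))\<bar> \<le> e' * (?x (Suc l) - ?x l)"
        unfolding real_norm_def[symmetric]
      proof (rule integral_bound)
        show "?x l \<le> ?x (Suc l)" by (rule xm) simp
        show "continuous_on {?x l..?x (Suc l)} (\<lambda>s. f s - f (?x l))"
          by (intro continuous_intros continuous_on_subset[OF f]) (use x_ge[of l] x_le[OF Suc.prems] in auto)
        fix s assume s: "s \<in> {?x l..?x (Suc l)}"
        have "dist s (?x l) < d" using s small w by (auto simp: dist_real_def)
        then have "dist (f s) (f (?x l)) < e'"
          by (intro d(2)) (use s x_ge[of l] x_le[OF Suc.prems] x_le[of l] Suc.prems in auto)
        then show "norm (f s - f (?x l)) \<le> e'" by (simp add: dist_real_def)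
      qed
      moreover have "integral {?x l..?x (Suc l)} (\<lambda>s. f s - f (?x l)) =
          integral {?x l..?x (Suc l)} f - f (?x l) * (t / real m)"
      proof -
        have i1: "f integrable_on {?x l..?x (Suc l)}"
          using int[of "?x l" "?x (Suc l)"] x_ge[of l] x_le[OF Suc.prems] by blast
        show ?thesis
          using Henstock_Kurzweil_Integration.integral_diff[OF i1 integrable_const_ivl[of "f (?x l)"]] w xm[of l "Suc l"]
          by (simp add: mult.commute)
      qed
      moreover have "e' * ?x (Suc l) = e' * ?x l + e' * (?x (Suc l) - ?x l)" by (simp add: algebra_simps)
      moreover have "\<bar>(\<Sum>j<l. f (?x j) * (t / real m)) - integral {0..?x l} f\<bar> \<le> e' * ?x l"
        using Suc by simp
      moreover have "(\<Sum>j<Suc l. f (?x j) * (t / real m)) = (\<Sum>j<l. f (?x j) * (t / real m)) + f (?x l) * (t / real m)"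
        by simp
      ultimately show ?case by linarith
    qed
    from this[of m] show ?thesis using e'(2) mpos by simp
  qed
  then show "\<exists>no. \<forall>m\<ge>no. norm ((\<Sum>j<m. f (t * real j / real m) * (t / real m)) - integral {0..t} f) < e" by blast
qed

context brownian begin

lemma increment_square_moments:
  assumes "0 \<le> s" "0 < h"
  shows "integrable M (\<lambda>\<omega>. B (s + h) \<omega> - B s \<omega>)" "expectation (\<lambda>\<omega>. B (s + h) \<omega> - B s \<omega>) = 0"
    "integrable M (\<lambda>\<omega>. (B (s + h) \<omega> - B s \<omega>)\<^sup>2)" "expectation (\<lambda>\<omega>. (B (s + h) \<omega> - B s \<omega>)\<^sup>2) = h"
  using increment_moment[of s "s + h" 0 1 0 0] increment_moment[of s "s + h" 0 0 1 0] assms by auto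

text \<open>The sum splits into a drift part, bounded by the Cauchy-Schwarz inequality at the cost
  of a factor \<open>L\<close>, and a Brownian part whose terms are orthogonal. When
  \<open>L * d\<close> is fixed, both parts enter with a weight of order \<open>d\<close>.\<close>

lemma euler_sum_square:
  fixes c :: "nat \<Rightarrow> 'a \<Rightarrow> real" and \<mu> \<sigma> :: real
  assumes d: "0 < d"
    and c: "\<And>j. j < L \<Longrightarrow> c j \<in> borel_measurable (F (ennreal (real j * d)))"
      "\<And>j \<omega>. j < L \<Longrightarrow> \<bar>c j \<omega>\<bar> \<le> C"
  defines "S \<equiv> \<lambda>\<omega>. \<Sum>j<L. c j \<omega> * (\<mu> * d + \<sigma> * (B (real j * d + d) \<omega> - B (real j * d) \<omega>))"
  shows "S \<in> borel_measurable M" "integrable M (\<lambda>\<omega>. (S \<omega>)\<^sup>2)"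
    "expectation (\<lambda>\<omega>. (S \<omega>)\<^sup>2) \<le> 2 * (\<mu>\<^sup>2 * d\<^sup>2 * real L + \<sigma>\<^sup>2 * d) * (\<Sum>j<L. expectation (\<lambda>\<omega>. (c j \<omega>)\<^sup>2))"
proof -
  define S1 where "S1 = (\<lambda>\<omega>. \<Sum>j<L. c j \<omega> * (B (real j * d + d) \<omega> - B (real j * d) \<omega>))"
  have cM: "c j \<in> borel_measurable M" if "j < L" for j using c(1)[OF that] measurable_F_M by blast
  have BM: "B (real j * d) \<in> borel_measurable M" "B (real j * d + d) \<in> borel_measurable M" for j
    using B_measurable d by auto
  show SM: "S \<in> borel_measurable M" unfolding S_def
    by (intro borel_measurable_sum borel_measurable_times borel_measurable_add borel_measurable_diff
        borel_measurable_const BM cM) auto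
  have ic2: "integrable M (\<lambda>\<omega>. (c j \<omega>)\<^sup>2)" if "j < L" for j
    by (rule integrable_bounded_square[OF cM[OF that] c(2)[OF that]])
  have s1: "integrable M (\<lambda>\<omega>. (S1 \<omega>)\<^sup>2)" "expectation (\<lambda>\<omega>. (S1 \<omega>)\<^sup>2) = (\<Sum>j<L. expectation (\<lambda>\<omega>. (c j \<omega>)\<^sup>2)) * d"
    using increment_sum_square[OF d, where g="\<lambda>x. x" and v=d and n=L and a=c and C=C] increment_square_moments[OF _ d] c
    by (auto simp: S1_def)
  have S_eq: "S \<omega> = \<mu> * d * (\<Sum>j<L. c j \<omega>) + \<sigma> * S1 \<omega>" for \<omega>
    unfolding S_def S1_def sum_distrib_left sum.distrib[symmetric]
    by (rule sum.cong) (simp_all add: algebra_simps)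
  let ?U = "\<lambda>\<omega>. 2 * (\<mu>\<^sup>2 * d\<^sup>2 * real L) * (\<Sum>j<L. (c j \<omega>)\<^sup>2) + 2 * \<sigma>\<^sup>2 * (S1 \<omega>)\<^sup>2"
  have iU: "integrable M ?U"
    by (intro Bochner_Integration.integrable_add integrable_mult_right Bochner_Integration.integrable_sum ic2 s1(1)) auto
  have le: "(S \<omega>)\<^sup>2 \<le> ?U \<omega>" for \<omega>
  proof -
    have "(S \<omega>)\<^sup>2 \<le> 2 * (\<mu> * d * (\<Sum>j<L. c j \<omega>))\<^sup>2 + 2 * (\<sigma> * S1 \<omega>)\<^sup>2"
      unfolding S_eq using sum_squares_bound[of "\<mu> * d * (\<Sum>j<L. c j \<omega>)" "\<sigma> * S1 \<omega>"]
      by (simp add: power2_sum)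
    also have "\<dots> \<le> ?U \<omega>"
      using mult_left_mono[OF sum_squared_le_sum_of_squares[of "\<lambda>j. c j \<omega>" "{..<L}"], of "2 * (\<mu>\<^sup>2 * d\<^sup>2)"]
      by (simp add: power_mult_distrib mult_ac)
    finally show ?thesis .
  qed
  show iS: "integrable M (\<lambda>\<omega>. (S \<omega>)\<^sup>2)"
    by (rule Bochner_Integration.integrable_bound[OF iU]) (use SM le in \<open>auto intro!: AE_I2 order_trans[OF le] abs_ge_self\<close>)
  have "expectation (\<lambda>\<omega>. (S \<omega>)\<^sup>2) \<le> expectation ?U"
    by (intro integral_mono iS iU le)
  also have "\<dots> = 2 * (\<mu>\<^sup>2 * d\<^sup>2 * real L) * (\<Sum>j<L. expectation (\<lambda>\<omega>. (c j \<omega>)\<^sup>2)) + 2 * \<sigma>\<^sup>2 * expectation (\<lambda>\<omega>. (S1 \<omega>)\<^sup>2)"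
    by (subst Bochner_Integration.integral_add)
      (use ic2 s1(1) in \<open>auto simp: Bochner_Integration.integral_sum intro!: Bochner_Integration.integrable_sum integrable_mult_right\<close>)
  finally show "expectation (\<lambda>\<omega>. (S \<omega>)\<^sup>2) \<le> 2 * (\<mu>\<^sup>2 * d\<^sup>2 * real L + \<sigma>\<^sup>2 * d) * (\<Sum>j<L. expectation (\<lambda>\<omega>. (c j \<omega>)\<^sup>2))"
    unfolding s1(2) by (simp add: algebra_simps)
qed

end

section \<open>Euler sums of the price process\<close>

locale gbm = brownian +
  fixes \<mu> \<sigma> p :: real and X :: "real \<Rightarrow> 'a \<Rightarrow> real"
  assumes sde: "geometric_brownian_motion M F B \<mu> \<sigma> p X"
begin

lemma X_adapted: "0 \<le> s \<Longrightarrow> s \<le> t \<Longrightarrow> X s \<in> borel_measurable (F (ennreal t))"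
  using sde measurable_F_mono[of "X s" "ennreal s" borel "ennreal t"]
  by (auto simp: geometric_brownian_motion_def adapted_def ennreal_leI)

lemma X_measurable: "0 \<le> s \<Longrightarrow> X s \<in> borel_measurable M"
  using X_adapted[of s s] measurable_F_M by auto

lemma X_0: "AE \<omega> in M. X 0 \<omega> = p"
  and X_continuous: "AE \<omega> in M. continuous_on {0..} (\<lambda>t. X t \<omega>)"
  using sde by (auto simp: geometric_brownian_motion_def)

text \<open>The drift sums converge along almost every path by continuity, and the Brownian sums
  converge by the definition of the Ito integral; the equation identifies the limit.\<close>

lemma euler_sums_tendsto:
  assumes t: "0 \<le> t"
  shows "tendsto_in_probability M
    (\<lambda>m \<omega>. \<Sum>j<m. X (t * real j / real m) \<omega> *
       (\<mu> * (t / real m) + \<sigma> * (B (t * real (Suc j) / real m) \<omega> - B (t * real j / real m) \<omega>)))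
    (\<lambda>\<omega>. X t \<omega> - p)"
proof -
  obtain I where I: "has_ito_integral M B (\<lambda>s \<omega>. \<sigma> * X s \<omega>) t I"
    and X_eq: "AE \<omega> in M. X t \<omega> = p + integral {0..t} (\<lambda>s. \<mu> * X s \<omega>) + I \<omega>"
    using sde t by (auto simp: geometric_brownian_motion_def)
  have IM: "I \<in> borel_measurable M"
    using I by (auto simp: has_ito_integral_def tendsto_in_probability_def)
  have "tendsto_in_probability M (\<lambda>m \<omega>. \<Sum>j<m. (\<mu> * X (t * real j / real m) \<omega>) * (t / real m))
     (\<lambda>\<omega>. X t \<omega> - p - I \<omega>)"
  proof (rule tendsto_in_probability_AE)
    show "(\<lambda>\<omega>. \<Sum>j<m. (\<mu> * X (t * real j / real m) \<omega>) * (t / real m)) \<in> borel_measurable M" for m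
      by (intro borel_measurable_sum borel_measurable_times borel_measurable_const X_measurable) (use t in auto)
    show "(\<lambda>\<omega>. X t \<omega> - p - I \<omega>) \<in> borel_measurable M"
      using X_measurable[OF t] IM by auto
    show "AE \<omega> in M. (\<lambda>m. \<Sum>j<m. (\<mu> * X (t * real j / real m) \<omega>) * (t / real m)) \<longlonglongrightarrow> X t \<omega> - p - I \<omega>"
      using X_eq X_continuous
    proof eventually_elim
      case (elim \<omega>)
      have "continuous_on {0..t} (\<lambda>s. \<mu> * X s \<omega>)"
        by (intro continuous_intros continuous_on_subset[OF elim(2)]) auto
      from left_riemann_sums_tendsto[OF t this] elim(1) show ?case by simp
    qed
  qed
  from tendsto_in_probability_add[OF this I[unfolded has_ito_integral_def]]
  show ?thesis
    by (simp add: algebra_simps flip: sum.distrib)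
qed

end


section \<open>The stochastic differential equation determines the price process\<close>

text \<open>Lets the sum over one coarse block be written over the whole fine grid with weight zero
  off the block, the form to which the estimates for adapted coefficients apply.\<close>

lemma sum_blocks:
  fixes f :: "nat \<Rightarrow> real"
  assumes "i < n" "0 < m"
  shows "(\<Sum>j<n * m. if j div m = i then f j else 0) = (\<Sum>j<Suc i * m. f j) - (\<Sum>j<i * m. f j)"
proof -
  have "(\<Sum>j<n * m. if j div m = i then f j else 0) = sum f {j \<in> {..<n * m}. j div m = i}"
    by (simp only: sum.inter_filter finite_lessThan)
  also have "{j \<in> {..<n * m}. j div m = i} = {i * m..<Suc i * m}"
  proof -
    have "j < n * m" if "j < Suc i * m" for j
      using that assms mult_le_mono1[of "Suc i" n m] by linarith
    moreover have "j div m = i \<longleftrightarrow> i * m \<le> j \<and> j < Suc i * m" for j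
    proof
      assume "j div m = i"
      then show "i * m \<le> j \<and> j < Suc i * m"
        using div_mult_mod_eq[of j m] mod_less_divisor[OF assms(2), of j] by auto
    next
      assume "i * m \<le> j \<and> j < Suc i * m"
      then show "j div m = i" by (intro div_nat_eqI) (auto simp: mult.commute)
    qed
    ultimately show ?thesis by auto
  qed
  also have "sum f {i * m..<Suc i * m} = (\<Sum>j<Suc i * m. f j) - (\<Sum>j<i * m. f j)"
    using sum_diff_nat_ivl[of 0 "i * m" "Suc i * m" f] by (simp add: atLeast0LessThan)
  finally show ?thesis .
qed

text \<open>Adding \<open>n\<close> copies of the error of a step of length \<open>t / n\<close>
  leaves only the first-order term of the error; an error with zero derivative at the origin
  disappears.\<close>

lemma derivative_zero_sequence:
  fixes f :: "real \<Rightarrow> real"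
  assumes "DERIV f 0 :> D" "f 0 = 0" "0 < t"
  shows "(\<lambda>n. real n * f (t / real n)) \<longlonglongrightarrow> t * D"
proof -
  have "((\<lambda>x. f x / x) \<longlongrightarrow> D) (at 0)"
    using assms(1,2) by (simp add: DERIV_def)
  moreover have "filterlim (\<lambda>n. t / real n) (at 0) sequentially"
    unfolding filterlim_at
  proof
    show "\<forall>\<^sub>F n in sequentially. t / real n \<in> UNIV \<and> t / real n \<noteq> 0"
      using eventually_gt_at_top[of 0] by eventually_elim (use assms(3) in auto)
  qed real_asymp
  ultimately have "(\<lambda>n. f (t / real n) / (t / real n)) \<longlonglongrightarrow> D"
    by (rule filterlim_compose)
  from tendsto_mult_left[OF this, of t] show ?thesis
    by (rule Lim_transform_eventually)
      (use assms(3) in \<open>auto simp: field_simps intro!: eventually_mono[OF eventually_gt_at_top[of 0]]\<close>)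
qed

context gbm begin

definition Y :: "real \<Rightarrow> 'a \<Rightarrow> real" where
  "Y s \<omega> = exp (- (\<mu> - \<sigma>\<^sup>2 / 2) * s - \<sigma> * B s \<omega>)"

text \<open>Clamping supplies the bounds that the second moments require and preserves adaptedness
  and path continuity. As \<open>Y\<close> is positive, \<open>cY\<close> is clamped from above
  only.\<close>

definition cX :: "real \<Rightarrow> real \<Rightarrow> 'a \<Rightarrow> real" where
  "cX N s \<omega> = max (- N) (min N (X s \<omega>))"

definition cY :: "real \<Rightarrow> real \<Rightarrow> 'a \<Rightarrow> real" where
  "cY N s \<omega> = min N (Y s \<omega>)"

text \<open>Only rational fractions of \<open>t\<close> are constrained, which makes the event
  measurable as a countable intersection; all points of the coarse and of the fine grid are such
  fractions.\<close>

definition good :: "real \<Rightarrow> real \<Rightarrow> 'a set" where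
  "good t N = {\<omega> \<in> space M. \<forall>q\<in>\<rat> \<inter> {0..1}. \<bar>X (t * q) \<omega>\<bar> \<le> N \<and> Y (t * q) \<omega> \<le> N}"

lemma Y_adapted: "0 \<le> s \<Longrightarrow> s \<le> t \<Longrightarrow> Y s \<in> borel_measurable (F (ennreal t))"
  unfolding Y_def[abs_def] using B_adapted[of s t] by measurable

lemma Y_measurable: "0 \<le> s \<Longrightarrow> Y s \<in> borel_measurable M"
  using Y_adapted[of s s] measurable_F_M by auto

lemma Y_pos: "0 < Y s \<omega>" by (simp add: Y_def)

lemma clamp_bounds:
  assumes "0 < N"
  shows "\<bar>cX N s \<omega>\<bar> \<le> N" "0 \<le> cY N s \<omega>" "cY N s \<omega> \<le> N"
  using assms Y_pos[of s \<omega>] by (auto simp: cX_def cY_def)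

lemma clamp_adapted:
  assumes "0 \<le> s" "s \<le> t"
  shows "cX N s \<in> borel_measurable (F (ennreal t))" "cY N s \<in> borel_measurable (F (ennreal t))"
  unfolding cX_def[abs_def] cY_def[abs_def] using X_adapted[OF assms] Y_adapted[OF assms] by measurable

lemma good_measurable: "0 \<le> t \<Longrightarrow> good t N \<in> sets M"
proof -
  assume t: "0 \<le> t"
  have "Measurable.pred M (\<lambda>\<omega>. \<bar>X (t * q) \<omega>\<bar> \<le> N \<and> Y (t * q) \<omega> \<le> N)" if "q \<in> \<rat> \<inter> {0..1}" for q
  proof -
    have [measurable]: "X (t * q) \<in> borel_measurable M" "Y (t * q) \<in> borel_measurable M"
      using X_measurable[of "t * q"] Y_measurable[of "t * q"] t that by auto
    show ?thesis by measurable
  qed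
  then have "(\<Union>q\<in>\<rat> \<inter> {0..1}. {\<omega> \<in> space M. \<not> (\<bar>X (t * q) \<omega>\<bar> \<le> N \<and> Y (t * q) \<omega> \<le> N)}) \<in> sets M"
    by (intro sets.countable_UN') (auto simp: countable_Int1 countable_rat simp del: de_Morgan_conj)
  moreover have "good t N = space M -
      (\<Union>q\<in>\<rat> \<inter> {0..1}. {\<omega> \<in> space M. \<not> (\<bar>X (t * q) \<omega>\<bar> \<le> N \<and> Y (t * q) \<omega> \<le> N)})"
    unfolding good_def by auto
  ultimately show ?thesis by simp
qed

text \<open>Continuous paths are bounded on \<open>[0, t]\<close>, so these increasing events
  exhaust the space up to a null set.\<close>

lemma good_tendsto:
  assumes t: "0 \<le> t"
  shows "(\<lambda>N. prob (space M - good t (real N))) \<longlonglongrightarrow> 0"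
proof -
  have m: "range (\<lambda>N. good t (real N)) \<subseteq> sets M" using good_measurable[OF t] by auto
  have inc: "incseq (\<lambda>N. good t (real N))"
    by (auto simp: incseq_def good_def intro: order_trans)
  have "AE \<omega> in M. \<omega> \<in> (\<Union>N. good t (real N))"
    using X_continuous B_continuous AE_space
  proof eventually_elim
    case (elim \<omega>)
    have sub: "{0..t} \<subseteq> {0..}" by auto
    have "compact ((\<lambda>s. X s \<omega>) ` {0..t})"
      by (intro compact_continuous_image continuous_on_subset[OF elim(1) sub] compact_Icc)
    then obtain N1 where N1: "\<And>s. s \<in> {0..t} \<Longrightarrow> \<bar>X s \<omega>\<bar> \<le> N1"
      using compact_imp_bounded bounded_iff by (metis image_eqI real_norm_def)
    have "continuous_on {0..t} (\<lambda>s. Y s \<omega>)"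
      unfolding Y_def by (intro continuous_intros continuous_on_subset[OF elim(2) sub])
    then have "compact ((\<lambda>s. Y s \<omega>) ` {0..t})"
      by (intro compact_continuous_image compact_Icc)
    then obtain N2 where N2: "\<And>s. s \<in> {0..t} \<Longrightarrow> \<bar>Y s \<omega>\<bar> \<le> N2"
      using compact_imp_bounded bounded_iff by (metis image_eqI real_norm_def)
    obtain N :: nat where N: "max N1 N2 \<le> real N" using real_arch_simple by blast
    have "t * q \<in> {0..t}" if "q \<in> {0..1}" for q using t that by (auto intro: mult_left_le)
    then have "\<omega> \<in> good t (real N)"
      unfolding good_def using N1 N2 N elim(3) by (fastforce dest: abs_le_D1)
    then show ?case by blast
  qed
  then have "prob (\<Union>N. good t (real N)) = 1"
    using m by (subst prob_eq_1) auto
  with finite_Lim_measure_incseq[OF m inc] have "(\<lambda>N. prob (good t (real N))) \<longlonglongrightarrow> 1" by simp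
  from tendsto_diff[OF tendsto_const[of 1] this] show ?thesis
    using good_measurable[OF t] by (simp add: prob_compl)
qed

text \<open>The first \<open>i * Suc m\<close> cells of the fine grid form a uniform grid of the
  interval up to the \<open>i\<close>-th coarse point, so the sums are a subsequence of the Euler
  sums at that time. For \<open>i = 0\<close> the index does not tend to infinity; the empty sums
  are matched with the initial value instead.\<close>

lemma euler_sums_grid_tendsto:
  assumes t: "0 < t" and n: "0 < n"
  defines "d \<equiv> \<lambda>m. t / (real n * real (Suc m))"
  shows "tendsto_in_probability M
    (\<lambda>m \<omega>. \<Sum>j<i * Suc m. X (real j * d m) \<omega> * (\<mu> * d m + \<sigma> * (B (real j * d m + d m) \<omega> - B (real j * d m) \<omega>)))
    (\<lambda>\<omega>. X (real i * (t / real n)) \<omega> - p)"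
proof (cases "i = 0")
  case True
  show ?thesis
    by (rule tendsto_in_probability_AE) (use True X_0 X_measurable[of 0] in \<open>auto elim!: eventually_mono\<close>)
next
  case False
  let ?s = "real i * (t / real n)"
  have s: "0 \<le> ?s" using t by simp
  have "filterlim (\<lambda>m. i * Suc m) at_top sequentially"
    using False by (intro filterlim_at_top_mono[OF filterlim_ident]) (cases i; auto intro!: always_eventually)
  from tendsto_in_probability_subseq[OF euler_sums_tendsto[OF s] this]
  have *: "tendsto_in_probability M (\<lambda>m \<omega>. \<Sum>j<i * Suc m. X (?s * real j / real (i * Suc m)) \<omega> *
       (\<mu> * (?s / real (i * Suc m)) + \<sigma> * (B (?s * real (Suc j) / real (i * Suc m)) \<omega> - B (?s * real j / real (i * Suc m)) \<omega>)))
    (\<lambda>\<omega>. X ?s \<omega> - p)" .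
  have e1: "?s / real (i * Suc m) = d m" for m
  proof -
    have "?s / (real i * r) = t / (real n * r)" if "0 < r" for r using False n that by (simp add: field_simps)
    from this[of "real (Suc m)"] show ?thesis unfolding d_def of_nat_mult by simp
  qed
  have e2: "?s * x / real (i * Suc m) = x * d m" for m x
    using e1[of m] by (metis mult.commute times_divide_eq_right)
  show ?thesis using * unfolding e1 e2 by (simp add: algebra_simps)
qed

text \<open>The difference of the Euler sums at two consecutive coarse points tends to the increment
  of the price. Freezing the coefficient at the left end of the block produces a telescoping sum;
  subtracting it leaves the error of one explicit Euler step as the limit.\<close>

lemma block_sums_tendsto:
  assumes t: "0 < t" and i: "i < n"
  defines "d \<equiv> \<lambda>m. t / (real n * real (Suc m))" and "h \<equiv> t / real n"
  shows "tendsto_in_probability M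
    (\<lambda>m \<omega>. \<Sum>j<n * Suc m. if j div Suc m = i then (X (real j * d m) \<omega> - X (real i * h) \<omega>)
        * (\<mu> * d m + \<sigma> * (B (real j * d m + d m) \<omega> - B (real j * d m) \<omega>)) else 0)
    (\<lambda>\<omega>. X (real i * h + h) \<omega> - X (real i * h) \<omega>
       - X (real i * h) \<omega> * (\<mu> * h + \<sigma> * (B (real i * h + h) \<omega> - B (real i * h) \<omega>)))"
proof -
  have n: "0 < n" using i by simp
  have dh: "real (k * Suc m) * d m = real k * h" for k m
    using n by (simp only: d_def h_def of_nat_mult) (simp add: field_simps del: of_nat_Suc)
  have h0: "0 < h" using t n by (simp add: h_def)
  let ?G = "\<lambda>m j \<omega>. \<mu> * d m + \<sigma> * (B (real j * d m + d m) \<omega> - B (real j * d m) \<omega>)"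
  let ?R = "\<lambda>i m \<omega>. \<Sum>j<i * Suc m. X (real j * d m) \<omega> * ?G m j \<omega>"
  have G_sum: "(\<Sum>j<k. ?G m j \<omega>) = \<mu> * (real k * d m) + \<sigma> * (B (real k * d m) \<omega> - B 0 \<omega>)" for k m \<omega>
    by (induction k) (simp_all add: algebra_simps)
  have eq: "(\<Sum>j<n * Suc m. if j div Suc m = i then (X (real j * d m) \<omega> - X (real i * h) \<omega>) * ?G m j \<omega> else 0)
     = ?R (Suc i) m \<omega> - ?R i m \<omega> -
         X (real i * h) \<omega> * (\<mu> * h + \<sigma> * (B (real i * h + h) \<omega> - B (real i * h) \<omega>))" for m \<omega>
  proof -
    have "(\<Sum>j<n * Suc m. if j div Suc m = i then (X (real j * d m) \<omega> - X (real i * h) \<omega>) * ?G m j \<omega> else 0)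
      = (\<Sum>j<Suc i * Suc m. (X (real j * d m) \<omega> - X (real i * h) \<omega>) * ?G m j \<omega>)
        - (\<Sum>j<i * Suc m. (X (real j * d m) \<omega> - X (real i * h) \<omega>) * ?G m j \<omega>)"
      using sum_blocks[OF i, of "Suc m" "\<lambda>j. (X (real j * d m) \<omega> - X (real i * h) \<omega>) * ?G m j \<omega>"] by simp
    also have "\<dots> = ?R (Suc i) m \<omega> - ?R i m \<omega> -
        X (real i * h) \<omega> * ((\<Sum>j<Suc i * Suc m. ?G m j \<omega>) - (\<Sum>j<i * Suc m. ?G m j \<omega>))"
      unfolding left_diff_distrib sum_subtractf sum_distrib_left[symmetric] by (simp add: right_diff_distrib)
    also have "(\<Sum>j<Suc i * Suc m. ?G m j \<omega>) - (\<Sum>j<i * Suc m. ?G m j \<omega>)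
       = \<mu> * h + \<sigma> * (B (real i * h + h) \<omega> - B (real i * h) \<omega>)"
      unfolding G_sum dh by (simp add: algebra_simps)
    finally show ?thesis .
  qed
  let ?C = "\<lambda>\<omega>. X (real i * h) \<omega> * (\<mu> * h + \<sigma> * (B (real i * h + h) \<omega> - B (real i * h) \<omega>))"
  have "X (real i * h) \<in> borel_measurable M" "B (real i * h) \<in> borel_measurable M" "B (real i * h + h) \<in> borel_measurable M"
    using X_measurable B_measurable h0 by auto
  then have "?C \<in> borel_measurable M" by measurable
  then have C: "tendsto_in_probability M (\<lambda>_. ?C) ?C"
    by (intro tendsto_in_probability_AE) auto
  have R: "tendsto_in_probability M (?R k) (\<lambda>\<omega>. X (real k * h) \<omega> - p)" for k
    using euler_sums_grid_tendsto[OF t n, of k] by (simp add: d_def h_def)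
  have "tendsto_in_probability M (\<lambda>m \<omega>. ?R (Suc i) m \<omega> - ?R i m \<omega> - ?C \<omega>)
      (\<lambda>\<omega>. (X (real (Suc i) * h) \<omega> - p) - (X (real i * h) \<omega> - p) - ?C \<omega>)"
    by (intro tendsto_in_probability_diff R C)
  then show ?thesis unfolding eq by (simp add: algebra_simps)
qed

text \<open>This and the next two closed forms are moments of one step of length \<open>h\<close>:
  the mean and the second moment of the relative change of \<open>X * Y\<close> when
  \<open>X\<close> makes an explicit Euler step, and the second moment of the relative change of
  \<open>Y\<close> alone.\<close>

definition drift_error :: "real \<Rightarrow> real" where
  "drift_error h = exp (- (\<mu> - \<sigma>\<^sup>2 / 2) * h) * (exp (\<sigma>\<^sup>2 * h / 2) * (1 + \<mu> * h - \<sigma>\<^sup>2 * h)) - 1"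

definition square_error :: "real \<Rightarrow> real" where
  "square_error h = (exp (- (\<mu> - \<sigma>\<^sup>2 / 2) * h))\<^sup>2 * (exp (2 * \<sigma>\<^sup>2 * h) *
      ((1 + \<mu> * h)\<^sup>2 - 4 * \<sigma>\<^sup>2 * h * (1 + \<mu> * h) + \<sigma>\<^sup>2 * (h + 4 * \<sigma>\<^sup>2 * h\<^sup>2)))
    - 2 * (drift_error h + 1) + 1"

definition factor_variance :: "real \<Rightarrow> real" where
  "factor_variance h = (exp (- (\<mu> - \<sigma>\<^sup>2 / 2) * h))\<^sup>2 * exp (2 * \<sigma>\<^sup>2 * h)
     - 2 * exp (- (\<mu> - \<sigma>\<^sup>2 / 2) * h) * exp (\<sigma>\<^sup>2 * h / 2) + 1"

text \<open>The correction \<open>\<sigma>\<^sup>2 / 2\<close> in the exponent of \<open>Y\<close>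
  cancels the first-order term of the mean. The second moment has none because the Brownian terms of
  the Euler factor and of the exponential are opposite. The exponential alone keeps a quadratic
  variation of total size \<open>t * \<sigma>\<^sup>2\<close>.\<close>

lemma error_limits:
  assumes "0 < t"
  shows "(\<lambda>n. real n * drift_error (t / real n)) \<longlonglongrightarrow> 0"
    "(\<lambda>n. real n * square_error (t / real n)) \<longlonglongrightarrow> 0"
    "(\<lambda>n. real n * factor_variance (t / real n)) \<longlonglongrightarrow> t * \<sigma>\<^sup>2"
proof -
  have "DERIV drift_error 0 :> 0" unfolding drift_error_def[abs_def]
    by (auto intro!: derivative_eq_intros)
  from derivative_zero_sequence[OF this _ assms]
  show "(\<lambda>n. real n * drift_error (t / real n)) \<longlonglongrightarrow> 0" by (simp add: drift_error_def)
  have "DERIV square_error 0 :> 0" unfolding square_error_def[abs_def] drift_error_def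
    by (auto intro!: derivative_eq_intros)
  from derivative_zero_sequence[OF this _ assms]
  show "(\<lambda>n. real n * square_error (t / real n)) \<longlonglongrightarrow> 0" by (simp add: square_error_def drift_error_def)
  have "DERIV factor_variance 0 :> \<sigma>\<^sup>2" unfolding factor_variance_def[abs_def]
    by (auto intro!: derivative_eq_intros)
  from derivative_zero_sequence[OF this _ assms]
  show "(\<lambda>n. real n * factor_variance (t / real n)) \<longlonglongrightarrow> t * \<sigma>\<^sup>2" by (simp add: factor_variance_def)
qed

text \<open>Squaring doubles the exponent, so all expectations are linear combinations of Gaussian
  moments with \<open>b = - \<sigma>\<close> and \<open>b = - 2 * \<sigma>\<close>.\<close>

lemma factor_moments:
  fixes h s :: real
  assumes h: "0 < h" and s: "0 \<le> s"
  defines "g \<equiv> \<lambda>x. (1 + \<mu> * h + \<sigma> * x) * exp (- (\<mu> - \<sigma>\<^sup>2 / 2) * h - \<sigma> * x) - 1"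
    and "e \<equiv> \<lambda>x. exp (- (\<mu> - \<sigma>\<^sup>2 / 2) * h - \<sigma> * x) - 1"
    and "D \<equiv> \<lambda>\<omega>. B (s + h) \<omega> - B s \<omega>"
  shows "integrable M (\<lambda>\<omega>. g (D \<omega>))" "expectation (\<lambda>\<omega>. g (D \<omega>)) = drift_error h"
    "integrable M (\<lambda>\<omega>. (g (D \<omega>))\<^sup>2)" "expectation (\<lambda>\<omega>. (g (D \<omega>))\<^sup>2) = square_error h"
    "integrable M (\<lambda>\<omega>. (e (D \<omega>))\<^sup>2)" "expectation (\<lambda>\<omega>. (e (D \<omega>))\<^sup>2) = factor_variance h"
proof -
  let ?E = "exp (- (\<mu> - \<sigma>\<^sup>2 / 2) * h)"
  let ?u = "1 + \<mu> * h"
  have sh: "s < s + h" using h by simp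
  have D_app: "D \<omega> = B (s + h) \<omega> - B s \<omega>" for \<omega> by (simp add: D_def)
  note mom = increment_moment[OF s sh, folded D_app]
  let ?g1 = "\<lambda>x. (?u + \<sigma> * x + 0 * x\<^sup>2) * exp (- \<sigma> * x)"
  let ?g2 = "\<lambda>x. (?u\<^sup>2 + 2 * ?u * \<sigma> * x + \<sigma>\<^sup>2 * x\<^sup>2) * exp (- 2 * \<sigma> * x)"
  let ?e1 = "\<lambda>x. (1 + 0 * x + 0 * x\<^sup>2) * exp (- \<sigma> * x)"
  let ?e2 = "\<lambda>x. (1 + 0 * x + 0 * x\<^sup>2) * exp (- 2 * \<sigma> * x)"
  note g1 = mom[of ?u \<sigma> 0 "- \<sigma>"] and g2 = mom[of "?u\<^sup>2" "2 * ?u * \<sigma>" "\<sigma>\<^sup>2" "- 2 * \<sigma>"]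
    and e1 = mom[of 1 0 0 "- \<sigma>"] and e2 = mom[of 1 0 0 "- 2 * \<sigma>"]
  have split: "exp (- (\<mu> - \<sigma>\<^sup>2 / 2) * h - \<sigma> * x) = ?E * exp (- \<sigma> * x)" for x
    by (simp flip: exp_add)
  have sq: "(exp (- \<sigma> * x))\<^sup>2 = exp (- 2 * \<sigma> * x)" for x
    by (simp add: power2_eq_square flip: exp_add)
  have g_eq: "g x = ?E * ?g1 x - 1" for x
    unfolding g_def split by simp
  have g2_eq: "(g x)\<^sup>2 = ?E\<^sup>2 * ?g2 x - 2 * ?E * ?g1 x + 1" for x
    unfolding g_def split sq[symmetric] by (simp add: power2_eq_square algebra_simps)
  have e2_eq: "(e x)\<^sup>2 = ?E\<^sup>2 * ?e2 x - 2 * ?E * ?e1 x + 1" for x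
    unfolding e_def split sq[symmetric] by (simp add: power2_eq_square algebra_simps)
  have x1: "exp ((- \<sigma>)\<^sup>2 * h / 2) = exp (\<sigma>\<^sup>2 * h / 2)"
    and x2: "exp ((- 2 * \<sigma>)\<^sup>2 * h / 2) = exp (2 * \<sigma>\<^sup>2 * h)"
    by (simp_all add: power2_eq_square)
  show "integrable M (\<lambda>\<omega>. g (D \<omega>))" unfolding g_eq
    by (intro Bochner_Integration.integrable_diff integrable_mult_right g1(1)) auto
  show "integrable M (\<lambda>\<omega>. (g (D \<omega>))\<^sup>2)" unfolding g2_eq
    by (intro Bochner_Integration.integrable_diff Bochner_Integration.integrable_add integrable_mult_right g1(1) g2(1)) auto
  show "integrable M (\<lambda>\<omega>. (e (D \<omega>))\<^sup>2)" unfolding e2_eq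
    by (intro Bochner_Integration.integrable_diff Bochner_Integration.integrable_add integrable_mult_right e1(1) e2(1)) auto
  have "expectation (\<lambda>\<omega>. g (D \<omega>)) = ?E * expectation (\<lambda>\<omega>. ?g1 (D \<omega>)) - 1"
    unfolding g_eq
    by (subst Bochner_Integration.integral_diff, rule integrable_mult_right, rule g1(1), simp,
        unfold integral_mult_right_zero, simp add: prob_space)
  then show "expectation (\<lambda>\<omega>. g (D \<omega>)) = drift_error h"
    unfolding g1(2) drift_error_def by (simp add: mult.assoc power2_eq_square)
  have "expectation (\<lambda>\<omega>. (g (D \<omega>))\<^sup>2) = ?E\<^sup>2 * expectation (\<lambda>\<omega>. ?g2 (D \<omega>)) - 2 * ?E * expectation (\<lambda>\<omega>. ?g1 (D \<omega>)) + 1"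
    unfolding g2_eq
    by (subst Bochner_Integration.integral_add, rule Bochner_Integration.integrable_diff,
        rule integrable_mult_right, rule g2(1), rule integrable_mult_right, rule g1(1), simp,
        subst Bochner_Integration.integral_diff, rule integrable_mult_right, rule g2(1), rule integrable_mult_right, rule g1(1),
        unfold integral_mult_right_zero, simp add: prob_space)
  then show "expectation (\<lambda>\<omega>. (g (D \<omega>))\<^sup>2) = square_error h"
    unfolding g1(2) g2(2) square_error_def drift_error_def
    unfolding add_diff_cancel_left' x1 x2 by algebra
  have "expectation (\<lambda>\<omega>. (e (D \<omega>))\<^sup>2) = ?E\<^sup>2 * expectation (\<lambda>\<omega>. ?e2 (D \<omega>)) - 2 * ?E * expectation (\<lambda>\<omega>. ?e1 (D \<omega>)) + 1"
    unfolding e2_eq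
    by (subst Bochner_Integration.integral_add, rule Bochner_Integration.integrable_diff,
        rule integrable_mult_right, rule e2(1), rule integrable_mult_right, rule e1(1), simp,
        subst Bochner_Integration.integral_diff, rule integrable_mult_right, rule e2(1), rule integrable_mult_right, rule e1(1),
        unfold integral_mult_right_zero, simp add: prob_space)
  then show "expectation (\<lambda>\<omega>. (e (D \<omega>))\<^sup>2) = factor_variance h"
    unfolding e1(2) e2(2) factor_variance_def
    unfolding add_diff_cancel_left' x1 x2 by simp
qed

end

section \<open>Probability estimates for the error terms of the clamped processes\<close>

context gbm begin

text \<open>The fine-grid approximation of the Euler error over the \<open>i\<close>-th coarse step,
  built from the deviation of the clamped price from its value at the left end. The sum runs over
  the whole grid so that its coefficients form one adapted sequence.\<close>

definition block :: "real \<Rightarrow> real \<Rightarrow> nat \<Rightarrow> nat \<Rightarrow> nat \<Rightarrow> 'a \<Rightarrow> real" where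
  "block N t n m i \<omega> =
    (let d = t / (real n * real m); h = t / real n in
     \<Sum>j<n * m. (if j div m = i then cX N (real j * d) \<omega> - cX N (real i * h) \<omega> else 0)
        * (\<mu> * d + \<sigma> * (B (real j * d + d) \<omega> - B (real j * d) \<omega>)))"

lemma clamp_measurable:
  assumes "0 \<le> s"
  shows "cX N s \<in> borel_measurable M" "cY N s \<in> borel_measurable M"
  using clamp_adapted[OF assms order_refl] measurable_F_M by blast+

lemma fine_grid:
  fixes n m j :: nat
  assumes t: "0 < t" and j: "j < n * m"
  defines "d \<equiv> t / (real n * real m)" and "h \<equiv> t / real n"
  shows "real (j div m) * h \<le> real j * d" "real j * d \<in> {0..t}" "real (j div m) * h \<in> {0..t}"
    "\<bar>real j * d - real (j div m) * h\<bar> \<le> h" "j div m < n"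
proof -
  have nm: "0 < n" "0 < m" using j by (auto intro: gr0I)
  have d: "0 < d" using nm t by (simp add: d_def)
  have h: "h = real m * d" using nm by (simp add: d_def h_def)
  have split: "real j = real (j div m) * real m + real (j mod m)"
    by (metis div_mult_mod_eq of_nat_add of_nat_mult)
  have eq: "real j * d = real (j div m) * h + real (j mod m) * d"
    unfolding h split by (simp add: algebra_simps)
  have rem: "real (j mod m) * d \<le> h" "0 \<le> real (j mod m) * d"
    unfolding h using nm d by (auto intro!: mult_right_mono simp: less_imp_le)
  show le: "real (j div m) * h \<le> real j * d" using eq rem by simp
  have "real j * d \<le> real (n * m) * d"
    using j d by (intro mult_right_mono of_nat_mono) auto
  also have "\<dots> = t" using nm by (simp add: d_def)
  finally show 1: "real j * d \<in> {0..t}" using d by simp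
  show "real (j div m) * h \<in> {0..t}"
    using le 1 t by (auto simp: h_def simp del: times_divide_eq_right)
  show "\<bar>real j * d - real (j div m) * h\<bar> \<le> h" using eq rem by simp
  show "j div m < n" using j by (simp add: less_mult_imp_div_less)
qed

text \<open>Exchanging the sums turns the weighted sum of blocks into a single sum over the fine
  grid, in which each step keeps the weight of its block.\<close>

lemma weighted_block_sum:
  fixes u :: "nat \<Rightarrow> real" and n m :: nat and t :: real
  defines "d \<equiv> t / (real n * real m)" and "h \<equiv> t / real n"
  shows "(\<Sum>i<n. u i * block N t n m i \<omega>) =
    (\<Sum>j<n * m. (u (j div m) * (cX N (real j * d) \<omega> - cX N (real (j div m) * h) \<omega>))
       * (\<mu> * d + \<sigma> * (B (real j * d + d) \<omega> - B (real j * d) \<omega>)))"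
proof -
  let ?G = "\<lambda>j. \<mu> * d + \<sigma> * (B (real j * d + d) \<omega> - B (real j * d) \<omega>)"
  have "(\<Sum>i<n. u i * block N t n m i \<omega>) = (\<Sum>i<n. \<Sum>j<n * m.
      (if i = j div m then u i * (cX N (real j * d) \<omega> - cX N (real i * h) \<omega>) * ?G j else 0))"
    unfolding block_def Let_def d_def[symmetric] h_def[symmetric] sum_distrib_left
    by (intro sum.cong refl) auto
  also have "\<dots> = (\<Sum>j<n * m. \<Sum>i<n.
      (if i = j div m then u i * (cX N (real j * d) \<omega> - cX N (real i * h) \<omega>) * ?G j else 0))"
    by (rule sum.swap)
  also have "\<dots> = (\<Sum>j<n * m. u (j div m) * (cX N (real j * d) \<omega> - cX N (real (j div m) * h) \<omega>) * ?G j)"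
    by (intro sum.cong refl) (auto simp: less_mult_imp_div_less)
  finally show ?thesis .
qed

text \<open>Each factor is split into its mean and a centred part. The centred parts are orthogonal
  across steps and contribute \<open>n\<close> times their second moment; the means only add up and
  contribute the square of \<open>n\<close> times the mean. The weights are bounded by
  \<open>N\<^sup>2\<close>, whence the fourth powers.\<close>

lemma factor_sum_bound:
  fixes n :: nat and h N e :: real
  assumes h: "0 < h" and N: "0 < N" and e: "0 < e"
  defines "T \<equiv> \<lambda>\<omega>. \<Sum>i<n. cX N (real i * h) \<omega> * cY N (real i * h) \<omega> *
     ((1 + \<mu> * h + \<sigma> * (B (real i * h + h) \<omega> - B (real i * h) \<omega>)) *
      exp (- (\<mu> - \<sigma>\<^sup>2 / 2) * h - \<sigma> * (B (real i * h + h) \<omega> - B (real i * h) \<omega>)) - 1)"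
  shows "T \<in> borel_measurable M"
    and "prob {\<omega> \<in> space M. e \<le> \<bar>T \<omega>\<bar>} \<le>
      (2 * N ^ 4 * (real n * square_error h) + 2 * N ^ 4 * (real n * drift_error h)\<^sup>2) / e\<^sup>2"
proof -
  define g where "g = (\<lambda>x. (1 + \<mu> * h + \<sigma> * x) * exp (- (\<mu> - \<sigma>\<^sup>2 / 2) * h - \<sigma> * x) - 1)"
  define a where "a = (\<lambda>i \<omega>. cX N (real i * h) \<omega> * cY N (real i * h) \<omega>)"
  define D where "D = (\<lambda>i \<omega>. B (real i * h + h) \<omega> - B (real i * h) \<omega>)"
  let ?m = "drift_error h"
  have T_eq: "T \<omega> = (\<Sum>i<n. a i \<omega> * g (D i \<omega>))" for \<omega>
    by (simp add: T_def g_def a_def D_def)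
  have fm: "integrable M (\<lambda>\<omega>. g (B (s + h) \<omega> - B s \<omega>))"
      "expectation (\<lambda>\<omega>. g (B (s + h) \<omega> - B s \<omega>)) = ?m"
      "integrable M (\<lambda>\<omega>. (g (B (s + h) \<omega> - B s \<omega>))\<^sup>2)"
      "expectation (\<lambda>\<omega>. (g (B (s + h) \<omega> - B s \<omega>))\<^sup>2) = square_error h" if "0 \<le> s" for s
    unfolding g_def by (rule factor_moments[OF h that])+
  have gm [measurable]: "g \<in> borel_measurable borel" unfolding g_def by measurable
  have ih: "0 \<le> real i * h" for i using h by simp
  have Dm [measurable]: "D i \<in> borel_measurable M" for i
    unfolding D_def using B_measurable[OF ih[of i]] B_measurable[of "real i * h + h"] ih[of i] h by auto
  have aF: "a i \<in> borel_measurable (F (ennreal (real i * h)))" for i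
    unfolding a_def using clamp_adapted[OF ih order_refl] by measurable
  have aM [measurable]: "a i \<in> borel_measurable M" for i using aF measurable_F_M by blast
  have ab: "\<bar>a i \<omega>\<bar> \<le> N\<^sup>2" for i \<omega>
    unfolding a_def abs_mult power2_eq_square using clamp_bounds[OF N] N by (intro mult_mono) auto
  define S where "S = (\<lambda>\<omega>. \<Sum>i<n. a i \<omega> * (g (D i \<omega>) - ?m))"
  have S: "integrable M (\<lambda>\<omega>. (S \<omega>)\<^sup>2) \<and>
    expectation (\<lambda>\<omega>. (S \<omega>)\<^sup>2) = (\<Sum>i<n. expectation (\<lambda>\<omega>. (a i \<omega>)\<^sup>2)) * (square_error h - ?m\<^sup>2)"
    unfolding S_def D_def
  proof (rule increment_sum_square[OF h, where g="\<lambda>x. g x - ?m" and C="N\<^sup>2"])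
    fix s :: real assume s: "0 \<le> s"
    note f = fm[OF s]
    have sq: "(g x - ?m)\<^sup>2 = (g x)\<^sup>2 - 2 * ?m * g x + ?m\<^sup>2" for x
      by (simp add: power2_eq_square algebra_simps)
    show "integrable M (\<lambda>\<omega>. g (B (s + h) \<omega> - B s \<omega>) - ?m)" using f(1) by simp
    show "expectation (\<lambda>\<omega>. g (B (s + h) \<omega> - B s \<omega>) - ?m) = 0"
      using f(1,2) by (simp add: prob_space)
    show "integrable M (\<lambda>\<omega>. (g (B (s + h) \<omega> - B s \<omega>) - ?m)\<^sup>2)"
      unfolding sq using f(1,3) by simp
    show "expectation (\<lambda>\<omega>. (g (B (s + h) \<omega> - B s \<omega>) - ?m)\<^sup>2) = square_error h - ?m\<^sup>2"
      unfolding sq using f by (simp add: prob_space power2_eq_square)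
  qed (use aF ab in auto)
  let ?U = "\<lambda>\<omega>. 2 * (S \<omega>)\<^sup>2 + 2 * N ^ 4 * (real n * ?m)\<^sup>2"
  have TM: "T \<in> borel_measurable M" unfolding T_eq[abs_def] by measurable
  show "T \<in> borel_measurable M" by (rule TM)
  have le: "(T \<omega>)\<^sup>2 \<le> ?U \<omega>" for \<omega>
  proof -
    have 1: "T \<omega> = S \<omega> + ?m * (\<Sum>i<n. a i \<omega>)"
      unfolding T_eq S_def sum_distrib_left sum.distrib[symmetric]
      by (rule sum.cong) (simp_all add: algebra_simps)
    have "\<bar>\<Sum>i<n. a i \<omega>\<bar> \<le> real n * N\<^sup>2"
      using order_trans[OF sum_abs sum_bounded_above[of "{..<n}" "\<lambda>i. \<bar>a i \<omega>\<bar>" "N\<^sup>2"]] ab by simp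
    then have "\<bar>?m * (\<Sum>i<n. a i \<omega>)\<bar> \<le> \<bar>?m\<bar> * (real n * N\<^sup>2)"
      by (simp add: abs_mult mult_left_mono)
    then have "(?m * (\<Sum>i<n. a i \<omega>))\<^sup>2 \<le> (\<bar>?m\<bar> * (real n * N\<^sup>2))\<^sup>2"
      by (metis abs_ge_zero power2_abs power_mono)
    also have "\<dots> = N ^ 4 * (real n * ?m)\<^sup>2"
      by (simp add: power_mult_distrib flip: power_mult)
    finally show ?thesis
      unfolding 1 using sum_squares_bound[of "S \<omega>" "?m * (\<Sum>i<n. a i \<omega>)"]
      by (simp add: power2_sum)
  qed
  have iU: "integrable M ?U" using S by auto
  have iT: "integrable M (\<lambda>\<omega>. (T \<omega>)\<^sup>2)"
    by (rule Bochner_Integration.integrable_bound[OF iU])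
      (use TM le in \<open>auto intro!: AE_I2 order_trans[OF le] abs_ge_self\<close>)
  have sq0: "0 \<le> square_error h" unfolding fm(4)[OF order_refl, symmetric] by simp
  have "expectation (\<lambda>\<omega>. (a i \<omega>)\<^sup>2) \<le> N ^ 4" for i
  proof -
    have "expectation (\<lambda>\<omega>. (a i \<omega>)\<^sup>2) \<le> expectation (\<lambda>_. (N\<^sup>2)\<^sup>2)"
    proof (rule integral_mono[OF integrable_bounded_square[OF aM ab]])
      show "(a i \<omega>)\<^sup>2 \<le> (N\<^sup>2)\<^sup>2" for \<omega>
        using power_mono[OF ab[of i \<omega>] abs_ge_zero, of 2] by simp
    qed simp
    then show ?thesis by (simp add: prob_space flip: power_mult)
  qed
  then have "(\<Sum>i<n. expectation (\<lambda>\<omega>. (a i \<omega>)\<^sup>2)) \<le> real n * N ^ 4"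
    using sum_bounded_above[of "{..<n}" "\<lambda>i. expectation (\<lambda>\<omega>. (a i \<omega>)\<^sup>2)" "N ^ 4"] by simp
  moreover have "0 \<le> (\<Sum>i<n. expectation (\<lambda>\<omega>. (a i \<omega>)\<^sup>2))" by (intro sum_nonneg) simp
  ultimately have "(\<Sum>i<n. expectation (\<lambda>\<omega>. (a i \<omega>)\<^sup>2)) * (square_error h - ?m\<^sup>2) \<le> real n * N ^ 4 * square_error h"
    using sq0 mult_left_mono[of "square_error h - ?m\<^sup>2" "square_error h" "\<Sum>i<n. expectation (\<lambda>\<omega>. (a i \<omega>)\<^sup>2)"]
      mult_right_mono[of "\<Sum>i<n. expectation (\<lambda>\<omega>. (a i \<omega>)\<^sup>2)" "real n * N ^ 4" "square_error h"]
    by auto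
  then have S2: "expectation (\<lambda>\<omega>. (S \<omega>)\<^sup>2) \<le> real n * N ^ 4 * square_error h"
    using S by simp
  have "expectation (\<lambda>\<omega>. (T \<omega>)\<^sup>2) \<le> expectation ?U" by (intro integral_mono iT iU le)
  also have "\<dots> = 2 * expectation (\<lambda>\<omega>. (S \<omega>)\<^sup>2) + 2 * N ^ 4 * (real n * ?m)\<^sup>2"
    using S by (subst Bochner_Integration.integral_add) (auto simp: prob_space)
  also have "\<dots> \<le> 2 * N ^ 4 * (real n * square_error h) + 2 * N ^ 4 * (real n * ?m)\<^sup>2"
    using S2 by (simp add: mult_ac)
  finally show "prob {\<omega> \<in> space M. e \<le> \<bar>T \<omega>\<bar>} \<le>
      (2 * N ^ 4 * (real n * square_error h) + 2 * N ^ 4 * (real n * ?m)\<^sup>2) / e\<^sup>2"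
    using prob_ge_le_second_moment[OF TM iT e] divide_right_mono[of _ _ "e\<^sup>2"] by (meson order_trans zero_le_power2)
qed

text \<open>In both bounds below, \<open>w\<close> is a modulus of continuity in mean square of the clamped process.\<close>

lemma weighted_block_sum_bound:
  fixes n m :: nat and N w t e :: real
  assumes t: "0 < t" and n: "0 < n" and m: "0 < m" and N: "0 < N" and e: "0 < e"
    and w: "\<And>r s. r \<in> {0..t} \<Longrightarrow> s \<in> {0..t} \<Longrightarrow> \<bar>r - s\<bar> \<le> t / real n \<Longrightarrow>
      expectation (\<lambda>\<omega>. (cX N r \<omega> - cX N s \<omega>)\<^sup>2) \<le> w"
  defines "T \<equiv> \<lambda>\<omega>. \<Sum>i<n. cY N (real i * (t / real n)) \<omega> * block N t n m i \<omega>"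
  shows "T \<in> borel_measurable M"
    and "prob {\<omega> \<in> space M. e \<le> \<bar>T \<omega>\<bar>} \<le> (2 * (\<mu>\<^sup>2 * t\<^sup>2 + \<sigma>\<^sup>2 * t)) * N\<^sup>2 * w / e\<^sup>2"
proof -
  define d where "d = t / (real n * real m)"
  define h where "h = t / real n"
  \<comment> \<open>The coarse weight is known at the left end of its block, hence at every fine
    time inside it, and can be absorbed into the fine coefficient.\<close>
  define c where "c = (\<lambda>j \<omega>. cY N (real (j div m) * h) \<omega> * (cX N (real j * d) \<omega> - cX N (real (j div m) * h) \<omega>))"
  have d: "0 < d" using t n m by (simp add: d_def)
  note grid = fine_grid[OF t, of _ n m, folded d_def h_def]
  have T_eq: "T = (\<lambda>\<omega>. \<Sum>j<n * m. c j \<omega> * (\<mu> * d + \<sigma> * (B (real j * d + d) \<omega> - B (real j * d) \<omega>)))"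
    unfolding T_def c_def d_def h_def by (rule ext) (rule weighted_block_sum)
  have cF: "c j \<in> borel_measurable (F (ennreal (real j * d)))" if j: "j < n * m" for j
  proof -
    note g = grid[OF j]
    have "0 \<le> real (j div m) * h" "0 \<le> real j * d" using g(2,3) by auto
    then show ?thesis unfolding c_def
      using clamp_adapted[of "real (j div m) * h" "real j * d" N] clamp_adapted[of "real j * d" "real j * d" N] g(1)
      by measurable
  qed
  have dX: "\<bar>cX N r \<omega> - cX N s \<omega>\<bar> \<le> 2 * N" for r s \<omega>
    using clamp_bounds(1)[OF N, of r \<omega>] clamp_bounds(1)[OF N, of s \<omega>] by linarith
  have cb: "\<bar>c j \<omega>\<bar> \<le> N * (2 * N)" for j \<omega>
    unfolding c_def abs_mult using clamp_bounds[OF N] dX N by (intro mult_mono) auto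
  note es = euler_sum_square[OF d, of "n * m" c "N * (2 * N)" \<mu> \<sigma>, folded fun_cong[OF T_eq], OF cF cb]
  show "T \<in> borel_measurable M" by (rule es(1))
  have cle: "expectation (\<lambda>\<omega>. (c j \<omega>)\<^sup>2) \<le> N\<^sup>2 * w" if j: "j < n * m" for j
  proof -
    note g = grid[OF j]
    have Xm: "cX N (real j * d) \<in> borel_measurable M" "cX N (real (j div m) * h) \<in> borel_measurable M"
      using clamp_measurable g(2,3) by auto
    have i2: "integrable M (\<lambda>\<omega>. (cX N (real j * d) \<omega> - cX N (real (j div m) * h) \<omega>)\<^sup>2)"
      by (rule integrable_bounded_square[OF _ dX]) (use Xm in measurable)
    have "expectation (\<lambda>\<omega>. (c j \<omega>)\<^sup>2) \<le> expectation (\<lambda>\<omega>. N\<^sup>2 * (cX N (real j * d) \<omega> - cX N (real (j div m) * h) \<omega>)\<^sup>2)"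
    proof (intro integral_mono)
      show "integrable M (\<lambda>\<omega>. (c j \<omega>)\<^sup>2)"
        by (rule integrable_bounded_square[OF _ cb]) (use cF[OF j] measurable_F_M in blast)
      show "(c j \<omega>)\<^sup>2 \<le> N\<^sup>2 * (cX N (real j * d) \<omega> - cX N (real (j div m) * h) \<omega>)\<^sup>2" for \<omega>
        unfolding c_def power_mult_distrib using clamp_bounds[OF N]
        by (intro mult_right_mono power_mono) auto
    qed (use i2 in auto)
    also have "\<dots> \<le> N\<^sup>2 * w"
      using w[OF g(2,3)] g(4) by (simp add: h_def mult_left_mono)
    finally show ?thesis .
  qed
  have "expectation (\<lambda>\<omega>. (T \<omega>)\<^sup>2) \<le> 2 * (\<mu>\<^sup>2 * d\<^sup>2 * real (n * m) + \<sigma>\<^sup>2 * d) * (\<Sum>j<n * m. expectation (\<lambda>\<omega>. (c j \<omega>)\<^sup>2))"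
    by (rule es(3))
  also have "\<dots> \<le> 2 * (\<mu>\<^sup>2 * d\<^sup>2 * real (n * m) + \<sigma>\<^sup>2 * d) * (\<Sum>j<n * m. N\<^sup>2 * w)"
    using d cle by (intro mult_left_mono sum_mono) auto
  also have "\<dots> = 2 * (\<mu>\<^sup>2 * (d * (real n * real m))\<^sup>2 + \<sigma>\<^sup>2 * (d * (real n * real m))) * N\<^sup>2 * w"
    by (simp add: power2_eq_square algebra_simps)
  also have "d * (real n * real m) = t" using n m by (simp add: d_def)
  finally show "prob {\<omega> \<in> space M. e \<le> \<bar>T \<omega>\<bar>} \<le> (2 * (\<mu>\<^sup>2 * t\<^sup>2 + \<sigma>\<^sup>2 * t)) * N\<^sup>2 * w / e\<^sup>2"
    using prob_ge_le_second_moment[OF es(1,2) e] divide_right_mono[of _ _ "e\<^sup>2"] by (meson order_trans zero_le_power2)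
qed

lemma block_second_moment:
  fixes n m :: nat and N w t :: real
  assumes t: "0 < t" and i: "i < n" and m: "0 < m" and N: "0 < N"
    and w: "\<And>r s. r \<in> {0..t} \<Longrightarrow> s \<in> {0..t} \<Longrightarrow> \<bar>r - s\<bar> \<le> t / real n \<Longrightarrow>
      expectation (\<lambda>\<omega>. (cX N r \<omega> - cX N s \<omega>)\<^sup>2) \<le> w"
  shows "block N t n m i \<in> borel_measurable M"
    "integrable M (\<lambda>\<omega>. (block N t n m i \<omega>)\<^sup>2)"
    "expectation (\<lambda>\<omega>. (block N t n m i \<omega>)\<^sup>2) \<le> (2 * (\<mu>\<^sup>2 * t\<^sup>2 + \<sigma>\<^sup>2 * t)) * w / real n"
proof -
  have n: "0 < n" using i by simp
  define d where "d = t / (real n * real m)"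
  define h where "h = t / real n"
  define c where "c = (\<lambda>j \<omega>. if j div m = i then cX N (real j * d) \<omega> - cX N (real i * h) \<omega> else 0)"
  have d: "0 < d" using t n m by (simp add: d_def)
  note grid = fine_grid[OF t, of _ n m, folded d_def h_def]
  have b_eq: "block N t n m i = (\<lambda>\<omega>. \<Sum>j<n * m. c j \<omega> * (\<mu> * d + \<sigma> * (B (real j * d + d) \<omega> - B (real j * d) \<omega>)))"
    by (rule ext) (unfold block_def c_def d_def h_def Let_def, rule refl)
  have cF: "c j \<in> borel_measurable (F (ennreal (real j * d)))" if j: "j < n * m" for j
  proof (cases "j div m = i")
    case True
    note g = grid[OF j]
    have "0 \<le> real i * h" "0 \<le> real j * d" "real i * h \<le> real j * d" using g(1-3) True by auto
    then have "cX N (real i * h) \<in> borel_measurable (F (ennreal (real j * d)))"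
      "cX N (real j * d) \<in> borel_measurable (F (ennreal (real j * d)))"
      using clamp_adapted(1) by auto
    moreover have "c j = (\<lambda>\<omega>. cX N (real j * d) \<omega> - cX N (real i * h) \<omega>)"
      using True by (simp add: c_def)
    ultimately show ?thesis by simp
  qed (simp add: c_def)
  have cb: "\<bar>c j \<omega>\<bar> \<le> 2 * N" for j \<omega>
    unfolding c_def using clamp_bounds(1)[OF N, of "real j * d" \<omega>] clamp_bounds(1)[OF N, of "real i * h" \<omega>] N
    by (auto simp: abs_le_iff)
  note es = euler_sum_square[OF d, of "n * m" c "2 * N" \<mu> \<sigma>, folded fun_cong[OF b_eq], OF cF cb]
  show "block N t n m i \<in> borel_measurable M" by (rule es(1))
  show "integrable M (\<lambda>\<omega>. (block N t n m i \<omega>)\<^sup>2)" by (rule es(2))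
  have cle: "expectation (\<lambda>\<omega>. (c j \<omega>)\<^sup>2) \<le> (if j div m = i then w else 0)" if j: "j < n * m" for j
  proof (cases "j div m = i")
    case True
    then show ?thesis using w[OF grid(2)[OF j] grid(3)[OF j]] grid(4)[OF j] by (simp add: c_def h_def)
  qed (simp add: c_def)
  have "expectation (\<lambda>\<omega>. (block N t n m i \<omega>)\<^sup>2) \<le> 2 * (\<mu>\<^sup>2 * d\<^sup>2 * real (n * m) + \<sigma>\<^sup>2 * d) * (\<Sum>j<n * m. expectation (\<lambda>\<omega>. (c j \<omega>)\<^sup>2))"
    by (rule es(3))
  also have "\<dots> \<le> 2 * (\<mu>\<^sup>2 * d\<^sup>2 * real (n * m) + \<sigma>\<^sup>2 * d) * (\<Sum>j<n * m. (if j div m = i then w else 0))"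
    using d cle by (intro mult_left_mono sum_mono) auto
  \<comment> \<open>Only the \<open>m\<close> fine steps of the block carry a nonzero coefficient;
    this gains the factor \<open>1 / n\<close>.\<close>
  also have "(\<Sum>j<n * m. (if j div m = i then w else 0)) = real m * w"
    using sum_blocks[OF i m, of "\<lambda>_. w"] by (simp add: algebra_simps)
  also have "2 * (\<mu>\<^sup>2 * d\<^sup>2 * real (n * m) + \<sigma>\<^sup>2 * d) * (real m * w)
      = 2 * (\<mu>\<^sup>2 * (d * (real n * real m))\<^sup>2 + \<sigma>\<^sup>2 * (d * (real n * real m))) * w / real n"
    using n by (simp add: field_simps power2_eq_square)
  also have "d * (real n * real m) = t" using n m by (simp add: d_def)
  finally show "expectation (\<lambda>\<omega>. (block N t n m i \<omega>)\<^sup>2) \<le> (2 * (\<mu>\<^sup>2 * t\<^sup>2 + \<sigma>\<^sup>2 * t)) * w / real n" by simp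
qed

text \<open>The change of \<open>Y\<close> and the block depend on the same Brownian increments and
  cannot be separated by independence. Young's inequality with weight \<theta> separates them: the
  expected squares of the changes of \<open>Y\<close> sum to a bounded amount, multiplied by
  \<theta>, and those of the blocks to a multiple of \<open>w\<close>, divided by \<theta>.\<close>

lemma covariation_bound:
  fixes n m :: nat and N w t e \<theta> :: real
  assumes t: "0 < t" and n: "0 < n" and m: "0 < m" and N: "0 < N" and e: "0 < e" and \<theta>: "0 < \<theta>"
    and w: "\<And>r s. r \<in> {0..t} \<Longrightarrow> s \<in> {0..t} \<Longrightarrow> \<bar>r - s\<bar> \<le> t / real n \<Longrightarrow>
      expectation (\<lambda>\<omega>. (cX N r \<omega> - cX N s \<omega>)\<^sup>2) \<le> w"
  defines "h \<equiv> t / real n"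
  defines "T \<equiv> \<lambda>\<omega>. \<Sum>i<n. cY N (real i * h) \<omega> *
    (exp (- (\<mu> - \<sigma>\<^sup>2 / 2) * h - \<sigma> * (B (real i * h + h) \<omega> - B (real i * h) \<omega>)) - 1) * block N t n m i \<omega>"
  shows "T \<in> borel_measurable M"
    and "prob {\<omega> \<in> space M. e \<le> \<bar>T \<omega>\<bar>} \<le>
      N / 2 * (\<theta> * (real n * factor_variance h) + 2 * (\<mu>\<^sup>2 * t\<^sup>2 + \<sigma>\<^sup>2 * t) * w / \<theta>) / e"
proof -
  have h: "0 < h" using t n by (simp add: h_def)
  define E where "E = (\<lambda>i \<omega>. exp (- (\<mu> - \<sigma>\<^sup>2 / 2) * h - \<sigma> * (B (real i * h + h) \<omega> - B (real i * h) \<omega>)) - 1)"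
  have T_eq: "T = (\<lambda>\<omega>. \<Sum>i<n. cY N (real i * h) \<omega> * E i \<omega> * block N t n m i \<omega>)"
    by (simp add: T_def E_def)
  have ih: "0 \<le> real i * h" for i using h by simp
  have Em: "E i \<in> borel_measurable M" for i
  proof -
    have [measurable]: "B (real i * h) \<in> borel_measurable M" "B (real i * h + h) \<in> borel_measurable M"
      using B_measurable[OF ih[of i]] B_measurable[of "real i * h + h"] ih[of i] h by auto
    show ?thesis unfolding E_def by measurable
  qed
  have E2: "integrable M (\<lambda>\<omega>. (E i \<omega>)\<^sup>2)" "expectation (\<lambda>\<omega>. (E i \<omega>)\<^sup>2) = factor_variance h" for i
    unfolding E_def using factor_moments(5,6)[OF h ih[of i]] by auto
  note bs = block_second_moment[OF t _ m N w]
  show TM: "T \<in> borel_measurable M" unfolding T_eq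
    using clamp_measurable(2)[OF ih] Em bs(1) by (intro borel_measurable_sum borel_measurable_times) auto
  let ?V = "\<lambda>\<omega>. \<Sum>i<n. N / 2 * (\<theta> * (E i \<omega>)\<^sup>2 + (block N t n m i \<omega>)\<^sup>2 / \<theta>)"
  have le: "\<bar>T \<omega>\<bar> \<le> ?V \<omega>" for \<omega>
  proof -
    have "\<bar>cY N (real i * h) \<omega> * E i \<omega> * block N t n m i \<omega>\<bar> \<le> N / 2 * (\<theta> * (E i \<omega>)\<^sup>2 + (block N t n m i \<omega>)\<^sup>2 / \<theta>)" for i
    proof -
      let ?x = "\<bar>E i \<omega>\<bar>" and ?y = "\<bar>block N t n m i \<omega>\<bar>"
      have "0 \<le> (\<theta> * ?x - ?y)\<^sup>2 / \<theta>" using \<theta> by simp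
      also have "\<dots> = \<theta> * ?x\<^sup>2 + ?y\<^sup>2 / \<theta> - 2 * (?x * ?y)"
        using \<theta> by (simp add: power2_diff power_mult_distrib diff_divide_distrib add_divide_distrib)
          (simp add: power2_eq_square)
      finally have "?x * ?y \<le> (\<theta> * (E i \<omega>)\<^sup>2 + (block N t n m i \<omega>)\<^sup>2 / \<theta>) / 2" by simp
      then have "N * (?x * ?y) \<le> N * ((\<theta> * (E i \<omega>)\<^sup>2 + (block N t n m i \<omega>)\<^sup>2 / \<theta>) / 2)"
        using N by (intro mult_left_mono) auto
      moreover have "\<bar>cY N (real i * h) \<omega>\<bar> * (?x * ?y) \<le> N * (?x * ?y)"
        using clamp_bounds[OF N] by (intro mult_right_mono) auto
      ultimately show ?thesis by (simp add: abs_mult mult.assoc)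
    qed
    then show ?thesis unfolding T_eq by (intro order_trans[OF sum_abs] sum_mono) auto
  qed
  have iV: "integrable M ?V"
    using E2(1) bs(2) by (intro Bochner_Integration.integrable_sum integrable_mult_right Bochner_Integration.integrable_add integrable_divide) auto
  have EV: "expectation ?V = (\<Sum>i<n. N / 2 * (\<theta> * factor_variance h + expectation (\<lambda>\<omega>. (block N t n m i \<omega>)\<^sup>2) / \<theta>))"
  proof -
    have "expectation ?V = (\<Sum>i<n. expectation (\<lambda>\<omega>. N / 2 * (\<theta> * (E i \<omega>)\<^sup>2 + (block N t n m i \<omega>)\<^sup>2 / \<theta>)))"
      using E2(1) bs(2) by (intro Bochner_Integration.integral_sum integrable_mult_right Bochner_Integration.integrable_add integrable_divide) auto
    also have "\<dots> = (\<Sum>i<n. N / 2 * (\<theta> * factor_variance h + expectation (\<lambda>\<omega>. (block N t n m i \<omega>)\<^sup>2) / \<theta>))"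
    proof (intro sum.cong refl)
      fix i assume "i \<in> {..<n}"
      then have b: "integrable M (\<lambda>\<omega>. (block N t n m i \<omega>)\<^sup>2)" using bs(2) by auto
      show "expectation (\<lambda>\<omega>. N / 2 * (\<theta> * (E i \<omega>)\<^sup>2 + (block N t n m i \<omega>)\<^sup>2 / \<theta>)) =
        N / 2 * (\<theta> * factor_variance h + expectation (\<lambda>\<omega>. (block N t n m i \<omega>)\<^sup>2) / \<theta>)"
        unfolding integral_mult_right_zero
        by (subst Bochner_Integration.integral_add) (use b E2 in auto)
    qed
    finally show ?thesis .
  qed
  also have "\<dots> \<le> (\<Sum>i<n. N / 2 * (\<theta> * factor_variance h + (2 * (\<mu>\<^sup>2 * t\<^sup>2 + \<sigma>\<^sup>2 * t) * w / real n) / \<theta>))"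
    using bs(3) N \<theta> by (intro sum_mono mult_left_mono add_left_mono divide_right_mono) auto
  also have "\<dots> = N / 2 * (\<theta> * (real n * factor_variance h) + 2 * (\<mu>\<^sup>2 * t\<^sup>2 + \<sigma>\<^sup>2 * t) * w / \<theta>)"
    using n \<theta> by (simp add: field_simps)
  finally have EV_le: "expectation ?V \<le> \<dots>" .
  have "prob {\<omega> \<in> space M. e \<le> \<bar>T \<omega>\<bar>} \<le> prob {\<omega> \<in> space M. e \<le> ?V \<omega>}"
  proof (rule finite_measure_mono)
    show "{\<omega> \<in> space M. e \<le> \<bar>T \<omega>\<bar>} \<subseteq> {\<omega> \<in> space M. e \<le> ?V \<omega>}"
      using le order_trans by blast
    show "{\<omega> \<in> space M. e \<le> ?V \<omega>} \<in> sets M"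
      by (rule borel_measurable_le[OF borel_measurable_const borel_measurable_integrable[OF iV]])
  qed
  also have "\<dots> \<le> expectation ?V / e"
    by (intro integral_Markov_inequality_measure[OF iV, of "{}"] AE_I2 e order_trans[OF abs_ge_zero le]) simp
  also have "\<dots> \<le> N / 2 * (\<theta> * (real n * factor_variance h) + 2 * (\<mu>\<^sup>2 * t\<^sup>2 + \<sigma>\<^sup>2 * t) * w / \<theta>) / e"
    using EV_le e by (intro divide_right_mono) auto
  finally show "prob {\<omega> \<in> space M. e \<le> \<bar>T \<omega>\<bar>} \<le>
      N / 2 * (\<theta> * (real n * factor_variance h) + 2 * (\<mu>\<^sup>2 * t\<^sup>2 + \<sigma>\<^sup>2 * t) * w / \<theta>) / e" .
qed

end

section \<open>Telescoping of the product and passage to the limit\<close>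

context gbm begin

text \<open>On the good event clamping changes nothing at grid points. The four terms come from the
  product under one Euler step, from replacing the Euler error \<open>Q\<close> by its fine-grid
  approximation \<open>Qm\<close>, and from splitting the weight of \<open>Qm\<close>, which is
  \<open>Y\<close> at the right end, into \<open>Y\<close> at the left end and the increment over
  the step. Only the left-end weight is known when the block begins.\<close>

lemma telescoping_bound:
  fixes n m :: nat and N t :: real and \<omega> :: 'a
  assumes t: "0 < t" and n: "0 < n" and m: "0 < m" and N: "0 < N"
    and good: "\<omega> \<in> good t N" and start: "X 0 \<omega> * Y 0 \<omega> = p"
  defines "d \<equiv> t / (real n * real m)" and "h \<equiv> t / real n"
  defines "D \<equiv> \<lambda>i. B (real i * h + h) \<omega> - B (real i * h) \<omega>"
  defines "Q \<equiv> \<lambda>i. X (real i * h + h) \<omega> - X (real i * h) \<omega> - X (real i * h) \<omega> * (\<mu> * h + \<sigma> * D i)"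
    and "Qm \<equiv> \<lambda>i. \<Sum>j<n * m. if j div m = i then (X (real j * d) \<omega> - X (real i * h) \<omega>)
        * (\<mu> * d + \<sigma> * (B (real j * d + d) \<omega> - B (real j * d) \<omega>)) else 0"
  shows "\<bar>X t \<omega> * Y t \<omega> - p\<bar> \<le>
    \<bar>\<Sum>i<n. cX N (real i * h) \<omega> * cY N (real i * h) \<omega> *
       ((1 + \<mu> * h + \<sigma> * D i) * exp (- (\<mu> - \<sigma>\<^sup>2 / 2) * h - \<sigma> * D i) - 1)\<bar>
    + N * (\<Sum>i<n. \<bar>Qm i - Q i\<bar>)
    + \<bar>\<Sum>i<n. cY N (real i * h) \<omega> * block N t n m i \<omega>\<bar>
    + \<bar>\<Sum>i<n. cY N (real i * h) \<omega> * (exp (- (\<mu> - \<sigma>\<^sup>2 / 2) * h - \<sigma> * D i) - 1) * block N t n m i \<omega>\<bar>"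
proof -
  have d: "0 < d" using t n m by (simp add: d_def)
  have rat: "\<bar>X s \<omega>\<bar> \<le> N \<and> Y s \<omega> \<le> N" if "s = t * (real a / real b)" "a \<le> b" for s a b
  proof -
    have "real a / real b \<in> \<rat> \<inter> {0..1}" using that(2) by (auto simp: divide_le_eq_1)
    then show ?thesis using good unfolding good_def that(1) by blast
  qed
  have coarse: "\<bar>X (real i * h) \<omega>\<bar> \<le> N \<and> Y (real i * h) \<omega> \<le> N" if "i \<le> n" for i
    using rat[of "real i * h" i n] that by (simp add: h_def)
  have fine: "\<bar>X (real j * d) \<omega>\<bar> \<le> N" if "j < n * m" for j
    using rat[of "real j * d" j "n * m"] that by (simp add: d_def)
  have cX: "cX N s \<omega> = X s \<omega>" if "\<bar>X s \<omega>\<bar> \<le> N" for s using that by (auto simp: cX_def)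
  have cY: "cY N s \<omega> = Y s \<omega>" if "Y s \<omega> \<le> N" for s using that by (auto simp: cY_def)
  have Qb: "block N t n m i \<omega> = Qm i" if "i < n" for i
    unfolding block_def Let_def d_def[symmetric] h_def[symmetric] Qm_def
    by (intro sum.cong refl) (use fine coarse that cX in auto)
  let ?Z = "\<lambda>i. X (real i * h) \<omega> * Y (real i * h) \<omega>"
  let ?e = "\<lambda>i. exp (- (\<mu> - \<sigma>\<^sup>2 / 2) * h - \<sigma> * D i)"
  have Y_step: "Y (real (Suc i) * h) \<omega> = Y (real i * h) \<omega> * ?e i" for i
    unfolding Y_def D_def by (simp add: algebra_simps flip: exp_add)
  have step: "?Z (Suc i) - ?Z i =
      cX N (real i * h) \<omega> * cY N (real i * h) \<omega> * ((1 + \<mu> * h + \<sigma> * D i) * ?e i - 1)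
      + Y (real (Suc i) * h) \<omega> * (Q i - Qm i)
      + cY N (real i * h) \<omega> * block N t n m i \<omega>
      + cY N (real i * h) \<omega> * (?e i - 1) * block N t n m i \<omega>" if i: "i < n" for i
  proof -
    have "X (real (Suc i) * h) \<omega> = X (real i * h) \<omega> * (1 + \<mu> * h + \<sigma> * D i) + Q i"
      unfolding Q_def by (simp add: algebra_simps)
    then show ?thesis
      unfolding Y_step Qb[OF i] using coarse[of i] i by (simp add: cX cY algebra_simps)
  qed
  have hn: "real n * h = t" using n by (simp add: h_def)
  have "X t \<omega> * Y t \<omega> - p = ?Z n - ?Z 0" using start hn by simp
  also have "\<dots> = (\<Sum>i<n. ?Z (Suc i) - ?Z i)" by (rule sum_lessThan_telescope[symmetric])
  also have "\<dots> = (\<Sum>i<n. cX N (real i * h) \<omega> * cY N (real i * h) \<omega> * ((1 + \<mu> * h + \<sigma> * D i) * ?e i - 1))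
     + (\<Sum>i<n. Y (real (Suc i) * h) \<omega> * (Q i - Qm i))
     + (\<Sum>i<n. cY N (real i * h) \<omega> * block N t n m i \<omega>)
     + (\<Sum>i<n. cY N (real i * h) \<omega> * (?e i - 1) * block N t n m i \<omega>)"
    unfolding sum.distrib[symmetric] by (intro sum.cong refl step) auto
  finally have eq: "X t \<omega> * Y t \<omega> - p = \<dots>" .
  have "\<bar>\<Sum>i<n. Y (real (Suc i) * h) \<omega> * (Q i - Qm i)\<bar> \<le> (\<Sum>i<n. N * \<bar>Qm i - Q i\<bar>)"
  proof (intro order_trans[OF sum_abs] sum_mono)
    fix i assume "i \<in> {..<n}"
    then have "0 \<le> Y (real (Suc i) * h) \<omega>" "Y (real (Suc i) * h) \<omega> \<le> N"
      using coarse[of "Suc i"] Y_pos[of "real (Suc i) * h" \<omega>] by auto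
    then show "\<bar>Y (real (Suc i) * h) \<omega> * (Q i - Qm i)\<bar> \<le> N * \<bar>Qm i - Q i\<bar>"
      by (simp add: abs_mult abs_minus_commute mult_right_mono)
  qed
  then show ?thesis unfolding eq sum_distrib_left by linarith
qed

lemma XY_0: "AE \<omega> in M. X 0 \<omega> * Y 0 \<omega> = p"
  using X_0 B_0 by eventually_elim (simp add: Y_def)

text \<open>Each of the four terms of the telescoped product is allowed the size \<open>e\<close>.
  Except for the approximation of the Euler errors, the bounds are uniform in \<open>m\<close>; with
  \<open>n\<close> fixed, that approximation error is removed by letting \<open>m\<close> tend to
  infinity.\<close>

lemma deviation_bound:
  fixes n :: nat and N w t e \<theta> :: real
  assumes t: "0 < t" and n: "0 < n" and N: "0 < N" and e: "0 < e" and \<theta>: "0 < \<theta>"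
    and w: "\<And>r s. r \<in> {0..t} \<Longrightarrow> s \<in> {0..t} \<Longrightarrow> \<bar>r - s\<bar> \<le> t / real n \<Longrightarrow>
      expectation (\<lambda>\<omega>. (cX N r \<omega> - cX N s \<omega>)\<^sup>2) \<le> w"
  defines "h \<equiv> t / real n" and "K \<equiv> 2 * (\<mu>\<^sup>2 * t\<^sup>2 + \<sigma>\<^sup>2 * t)"
  shows "prob {\<omega> \<in> space M. 4 * e \<le> \<bar>X t \<omega> * Y t \<omega> - p\<bar>} \<le>
    prob (space M - good t N)
    + (2 * N ^ 4 * (real n * square_error h) + 2 * N ^ 4 * (real n * drift_error h)\<^sup>2) / e\<^sup>2
    + K * N\<^sup>2 * w / e\<^sup>2
    + N / 2 * (\<theta> * (real n * factor_variance h) + K * w / \<theta>) / e" (is "?L \<le> ?R")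
proof -
  have h: "0 < h" using t n by (simp add: h_def)
  define d where "d = (\<lambda>m. t / (real n * real (Suc m)))"
  define D where "D = (\<lambda>i \<omega>. B (real i * h + h) \<omega> - B (real i * h) \<omega>)"
  define Q where "Q = (\<lambda>i \<omega>. X (real i * h + h) \<omega> - X (real i * h) \<omega> - X (real i * h) \<omega> * (\<mu> * h + \<sigma> * D i \<omega>))"
  define Qm where "Qm = (\<lambda>m i \<omega>. \<Sum>j<n * Suc m. if j div Suc m = i then (X (real j * d m) \<omega> - X (real i * h) \<omega>)
        * (\<mu> * d m + \<sigma> * (B (real j * d m + d m) \<omega> - B (real j * d m) \<omega>)) else 0)"
  define T1 where "T1 = (\<lambda>\<omega>. \<Sum>i<n. cX N (real i * h) \<omega> * cY N (real i * h) \<omega> *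
       ((1 + \<mu> * h + \<sigma> * D i \<omega>) * exp (- (\<mu> - \<sigma>\<^sup>2 / 2) * h - \<sigma> * D i \<omega>) - 1))"
  define T3 where "T3 = (\<lambda>m \<omega>. \<Sum>i<n. cY N (real i * h) \<omega> * block N t n (Suc m) i \<omega>)"
  define T4 where "T4 = (\<lambda>m \<omega>. \<Sum>i<n. cY N (real i * h) \<omega> * (exp (- (\<mu> - \<sigma>\<^sup>2 / 2) * h - \<sigma> * D i \<omega>) - 1) * block N t n (Suc m) i \<omega>)"
  \<comment> \<open>The \<open>n\<close> approximation errors are weighted by at most
    \<open>N\<close>, so this size for each keeps their total below \<open>e\<close>.\<close>
  define e' where "e' = e / (N * real n)"
  have e': "0 < e'" using e N n by (simp add: e'_def)
  have tip: "tendsto_in_probability M (\<lambda>m. Qm m i) (Q i)" if "i < n" for i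
    unfolding Qm_def Q_def D_def d_def h_def by (rule block_sums_tendsto[OF t that])
  have QM: "Qm m i \<in> borel_measurable M" "Q i \<in> borel_measurable M" if "i < n" for m i
    using tip[OF that] by (auto simp: tendsto_in_probability_def)
  have A1m [measurable]: "T1 \<in> borel_measurable M" and
    A1b: "prob {\<omega> \<in> space M. e \<le> \<bar>T1 \<omega>\<bar>} \<le>
      (2 * N ^ 4 * (real n * square_error h) + 2 * N ^ 4 * (real n * drift_error h)\<^sup>2) / e\<^sup>2"
    using factor_sum_bound[OF h N e, of n] by (simp_all add: T1_def D_def)
  have A3m [measurable]: "T3 m \<in> borel_measurable M" and
    A3b: "prob {\<omega> \<in> space M. e \<le> \<bar>T3 m \<omega>\<bar>} \<le> K * N\<^sup>2 * w / e\<^sup>2" for m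
    using weighted_block_sum_bound[OF t n _ N e w, of "Suc m"] unfolding T3_def h_def K_def by simp_all
  have A4m [measurable]: "T4 m \<in> borel_measurable M" and
    A4b: "prob {\<omega> \<in> space M. e \<le> \<bar>T4 m \<omega>\<bar>} \<le> N / 2 * (\<theta> * (real n * factor_variance h) + K * w / \<theta>) / e" for m
    using covariation_bound[OF t n _ N e \<theta> w, of "Suc m"] unfolding T4_def D_def h_def K_def by simp_all
  let ?P2 = "\<lambda>m. \<Sum>i<n. prob {\<omega> \<in> space M. e' \<le> \<bar>Qm m i \<omega> - Q i \<omega>\<bar>}"
  have P2: "?P2 \<longlonglongrightarrow> 0"
    using tip by (intro tendsto_null_sum tendsto_in_probability_D e') auto
  have "?L \<le> ?R + ?P2 m" for m
  proof -
    let ?S0 = "space M - good t N" and ?S1 = "{\<omega> \<in> space M. e \<le> \<bar>T1 \<omega>\<bar>}"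
      and ?S2 = "\<Union>i<n. {\<omega> \<in> space M. e' \<le> \<bar>Qm m i \<omega> - Q i \<omega>\<bar>}"
      and ?S3 = "{\<omega> \<in> space M. e \<le> \<bar>T3 m \<omega>\<bar>}" and ?S4 = "{\<omega> \<in> space M. e \<le> \<bar>T4 m \<omega>\<bar>}"
    have S2i: "{\<omega> \<in> space M. e' \<le> \<bar>Qm m i \<omega> - Q i \<omega>\<bar>} \<in> sets M" if "i < n" for i
    proof -
      have [measurable]: "Qm m i \<in> borel_measurable M" "Q i \<in> borel_measurable M" using QM that by auto
      show ?thesis by measurable
    qed
    have sets: "?S0 \<in> sets M" "?S1 \<in> sets M" "?S2 \<in> sets M" "?S3 \<in> sets M" "?S4 \<in> sets M"
      using good_measurable[of t N] t S2i by auto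
    have "?L \<le> prob (?S0 \<union> ?S1 \<union> ?S2 \<union> ?S3 \<union> ?S4)"
    proof (rule finite_measure_mono_AE)
      show "AE \<omega> in M. \<omega> \<in> {\<omega> \<in> space M. 4 * e \<le> \<bar>X t \<omega> * Y t \<omega> - p\<bar>} \<longrightarrow> \<omega> \<in> ?S0 \<union> ?S1 \<union> ?S2 \<union> ?S3 \<union> ?S4"
        using XY_0
      proof eventually_elim
        case (elim \<omega>)
        show ?case
        proof (rule impI, rule ccontr)
          assume big: "\<omega> \<in> {\<omega> \<in> space M. 4 * e \<le> \<bar>X t \<omega> * Y t \<omega> - p\<bar>}"
            and not: "\<omega> \<notin> ?S0 \<union> ?S1 \<union> ?S2 \<union> ?S3 \<union> ?S4"
          have good: "\<omega> \<in> good t N" using big not by auto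
          have "\<bar>X t \<omega> * Y t \<omega> - p\<bar> \<le> \<bar>T1 \<omega>\<bar> + N * (\<Sum>i<n. \<bar>Qm m i \<omega> - Q i \<omega>\<bar>) + \<bar>T3 m \<omega>\<bar> + \<bar>T4 m \<omega>\<bar>"
            using telescoping_bound[OF t n _ N good elim, of "Suc m"]
            unfolding T1_def T3_def T4_def Qm_def Q_def D_def d_def h_def by simp
          moreover have "\<bar>T1 \<omega>\<bar> < e" "\<bar>T3 m \<omega>\<bar> < e" "\<bar>T4 m \<omega>\<bar> < e" using big not by auto
          moreover have "(\<Sum>i<n. \<bar>Qm m i \<omega> - Q i \<omega>\<bar>) < (\<Sum>i<n. e')"
            using n big not by (intro sum_strict_mono) (auto simp: not_le)
          then have "N * (\<Sum>i<n. \<bar>Qm m i \<omega> - Q i \<omega>\<bar>) < e"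
            using N n by (simp add: e'_def field_simps)
          ultimately show False using big by auto
        qed
      qed
    qed (use sets in auto)
    also have "\<dots> \<le> prob ?S0 + prob ?S1 + prob ?S2 + prob ?S3 + prob ?S4"
      using sets by (intro order_trans[OF measure_Un_le] add_mono order_refl) auto
    also have "prob ?S2 \<le> ?P2 m"
      using S2i by (intro finite_measure_subadditive_finite) auto
    finally show ?thesis using A1b A3b[of m] A4b[of m] by linarith
  qed
  moreover have "(\<lambda>m. ?R + ?P2 m) \<longlonglongrightarrow> ?R + 0" by (intro tendsto_add tendsto_const P2)
  ultimately show ?thesis using LIMSEQ_le_const by fastforce
qed

text \<open>The bound is sent to zero in the order \<open>n \<rightarrow> \<infinity>\<close>, \<open>w = \<theta>\<^sup>2 \<rightarrow> 0\<close>, \<open>N \<rightarrow> \<infinity>\<close>.\<close>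
lemma XY_const:
  assumes t: "0 < t"
  shows "AE \<omega> in M. X t \<omega> * Y t \<omega> = p"
proof -
  have [measurable]: "X t \<in> borel_measurable M" "Y t \<in> borel_measurable M"
    using X_measurable Y_measurable t by auto
  define K where "K = 2 * (\<mu>\<^sup>2 * t\<^sup>2 + \<sigma>\<^sup>2 * t)"
  have zero: "prob {\<omega> \<in> space M. 4 * e \<le> \<bar>X t \<omega> * Y t \<omega> - p\<bar>} \<le> 0" (is "?L \<le> 0") if e: "0 < e" for e
  proof -
    have step1: "?L \<le> prob (space M - good t N) + (2 * N ^ 4 * 0 + 2 * N ^ 4 * 0\<^sup>2) / e\<^sup>2
      + K * N\<^sup>2 * \<theta>\<^sup>2 / e\<^sup>2 + N / 2 * (\<theta> * (t * \<sigma>\<^sup>2) + K * \<theta>\<^sup>2 / \<theta>) / e" if N: "0 < N" and \<theta>: "0 < \<theta>" for N \<theta>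
    proof (rule tendsto_lowerbound[OF _ _ sequentially_bot])
      show "(\<lambda>n. prob (space M - good t N)
        + (2 * N ^ 4 * (real n * square_error (t / real n)) + 2 * N ^ 4 * (real n * drift_error (t / real n))\<^sup>2) / e\<^sup>2
        + K * N\<^sup>2 * \<theta>\<^sup>2 / e\<^sup>2 + N / 2 * (\<theta> * (real n * factor_variance (t / real n)) + K * \<theta>\<^sup>2 / \<theta>) / e)
        \<longlonglongrightarrow> prob (space M - good t N) + (2 * N ^ 4 * 0 + 2 * N ^ 4 * 0\<^sup>2) / e\<^sup>2
      + K * N\<^sup>2 * \<theta>\<^sup>2 / e\<^sup>2 + N / 2 * (\<theta> * (t * \<sigma>\<^sup>2) + K * \<theta>\<^sup>2 / \<theta>) / e"
        using e by (intro tendsto_intros error_limits[OF t]) auto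
      obtain d where d: "0 < d" "\<And>r s. r \<in> {0..t} \<Longrightarrow> s \<in> {0..t} \<Longrightarrow> \<bar>r - s\<bar> < d \<Longrightarrow>
          expectation (\<lambda>\<omega>. (cX N r \<omega> - cX N s \<omega>)\<^sup>2) \<le> \<theta>\<^sup>2"
      proof -
        have "AE \<omega> in M. continuous_on {0..t} (\<lambda>s. cX N s \<omega>)"
          using X_continuous
        proof eventually_elim
          case (elim \<omega>)
          show ?case unfolding cX_def
            by (intro continuous_intros continuous_on_subset[OF elim]) auto
        qed
        from expectation_square_increment_continuous[OF _ clamp_bounds(1)[OF N] this, of "\<theta>\<^sup>2"]
        show ?thesis using clamp_measurable(1) \<theta> that by auto
      qed
      have "(\<lambda>n. t / real n) \<longlonglongrightarrow> 0" by real_asymp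
      then have "\<forall>\<^sub>F n in sequentially. t / real n < d"
        using d(1) by (auto dest!: order_tendstoD(2))
      then show "\<forall>\<^sub>F n in sequentially. ?L \<le> prob (space M - good t N)
        + (2 * N ^ 4 * (real n * square_error (t / real n)) + 2 * N ^ 4 * (real n * drift_error (t / real n))\<^sup>2) / e\<^sup>2
        + K * N\<^sup>2 * \<theta>\<^sup>2 / e\<^sup>2 + N / 2 * (\<theta> * (real n * factor_variance (t / real n)) + K * \<theta>\<^sup>2 / \<theta>) / e"
        using eventually_gt_at_top[of 0]
        by eventually_elim (unfold K_def, rule deviation_bound[OF t _ N e \<theta>], auto intro!: d(2))
    qed
    have step2: "?L \<le> prob (space M - good t N)" if N: "0 < N" for N
    proof (rule tendsto_lowerbound)
      have "((\<lambda>\<theta>. K * N\<^sup>2 * \<theta>\<^sup>2 / e\<^sup>2 + N / 2 * (\<theta> * (t * \<sigma>\<^sup>2) + K * \<theta>) / e) \<longlongrightarrow>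
          K * N\<^sup>2 * 0\<^sup>2 / e\<^sup>2 + N / 2 * (0 * (t * \<sigma>\<^sup>2) + K * 0) / e) (at_right 0)"
        using e by (intro tendsto_intros) auto
      from tendsto_add[OF tendsto_const[of "prob (space M - good t N)"] this]
      show "((\<lambda>\<theta>. prob (space M - good t N) + (K * N\<^sup>2 * \<theta>\<^sup>2 / e\<^sup>2 + N / 2 * (\<theta> * (t * \<sigma>\<^sup>2) + K * \<theta>) / e))
        \<longlongrightarrow> prob (space M - good t N)) (at_right 0)" by simp
      show "\<forall>\<^sub>F \<theta> in at_right 0. ?L \<le> prob (space M - good t N) +
          (K * N\<^sup>2 * \<theta>\<^sup>2 / e\<^sup>2 + N / 2 * (\<theta> * (t * \<sigma>\<^sup>2) + K * \<theta>) / e)"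
        using eventually_at_right_less[of "0::real"]
      proof eventually_elim
        case (elim \<theta>)
        then show ?case using step1[OF N, of \<theta>] by (simp add: power2_eq_square)
      qed
    qed auto
    have "\<forall>\<^sub>F N in sequentially. ?L \<le> prob (space M - good t (real N))"
      using eventually_gt_at_top[of 0] by eventually_elim (rule step2, simp)
    then show ?thesis
      by (rule tendsto_lowerbound[OF good_tendsto[OF less_imp_le[OF t]] _ sequentially_bot])
  qed
  have small: "AE \<omega> in M. \<bar>X t \<omega> * Y t \<omega> - p\<bar> < 4 * (1 / real (Suc k))" for k
  proof -
    have "prob {\<omega> \<in> space M. 4 * (1 / real (Suc k)) \<le> \<bar>X t \<omega> * Y t \<omega> - p\<bar>} = 0"
      using zero[of "1 / real (Suc k)"] by (intro antisym) auto
    then show ?thesis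
      by (subst (asm) prob_eq_0) (auto elim!: eventually_mono AE_mp simp: not_le)
  qed
  then have "AE \<omega> in M. \<forall>k. \<bar>X t \<omega> * Y t \<omega> - p\<bar> < 4 * (1 / real (Suc k))"
    by (simp add: AE_all_countable)
  then show ?thesis
  proof eventually_elim
    case (elim \<omega>)
    have "(\<lambda>k. 4 * (1 / real (Suc k))) \<longlonglongrightarrow> 0" by real_asymp
    then have "\<bar>X t \<omega> * Y t \<omega> - p\<bar> \<le> 0"
      by (rule LIMSEQ_le_const) (use elim less_imp_le in blast)
    then show ?case by simp
  qed
qed

end


section \<open>Optional stopping for the exponential martingale\<close>

text \<open>The preimages differ only inside a null set, all of whose subsets are measurable. This
  is used for stopped values, which are limits of measurable functions only where the path is
  continuous.\<close>

lemma (in complete_measure) measurable_AE_eq: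
  assumes f: "f \<in> measurable M N" and g: "g \<in> space M \<rightarrow> space N" and eq: "AE x in M. f x = g x"
  shows "g \<in> measurable M N"
proof (rule measurableI)
  fix A assume A: "A \<in> sets N"
  obtain S where S: "{x \<in> space M. f x \<noteq> g x} \<subseteq> S" "S \<in> null_sets M"
    using eq by (auto elim!: AE_E simp: null_sets_def)
  have 1: "f -` A \<inter> space M - S \<in> sets M" using measurable_sets[OF f A] S by auto
  have 2: "g -` A \<inter> space M \<inter> S \<in> sets M"
    using S(2) by (intro complete[of _ S]) auto
  have eq: "g -` A \<inter> space M = (f -` A \<inter> space M - S) \<union> (g -` A \<inter> space M \<inter> S)"
    using S(1) by auto
  show "g -` A \<inter> space M \<in> sets M" by (subst eq) (rule sets.Un[OF 1 2])
qed (use g in auto)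

lemma (in complete_measure) borel_measurable_AE_LIMSEQ:
  fixes u :: "nat \<Rightarrow> 'a \<Rightarrow> real"
  assumes u: "\<And>n. u n \<in> borel_measurable M" and lim: "AE x in M. (\<lambda>n. u n x) \<longlonglongrightarrow> v x"
  shows "v \<in> borel_measurable M"
proof (rule measurable_AE_eq)
  show "(\<lambda>x. lim (\<lambda>n. u n x)) \<in> borel_measurable M"
    using u by (rule borel_measurable_lim_metric)
  show "AE x in M. lim (\<lambda>n. u n x) = v x"
    using lim by eventually_elim (rule limI)
qed auto

context brownian begin

text \<open>The exponential martingale of \<open>B\<close>. For
  \<open>b = \<beta> * \<sigma>\<close> it is almost surely the normalised power
  \<open>(X s / p) powr \<beta>\<close> of the price.\<close>

definition expm :: "real \<Rightarrow> real \<Rightarrow> 'a \<Rightarrow> real" where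
  "expm b s \<omega> = exp (b * B s \<omega> - b\<^sup>2 * s / 2)"

lemma complete_M: "complete_measure M"
  using usual by (simp add: usual_conditions_def)

lemma expm_pos: "0 < expm b s \<omega>" by (simp add: expm_def)

lemma expm_adapted: "0 \<le> s \<Longrightarrow> s \<le> t \<Longrightarrow> expm b s \<in> borel_measurable (F (ennreal t))"
  unfolding expm_def[abs_def] using B_adapted[of s t] by measurable

lemma expm_measurable: "0 \<le> s \<Longrightarrow> expm b s \<in> borel_measurable M"
  using expm_adapted[of s s] measurable_F_M by auto

lemma expm_square: "(expm b s \<omega>)\<^sup>2 = expm (2 * b) s \<omega> * exp (b\<^sup>2 * s)"
  unfolding expm_def by (simp add: power2_eq_square field_simps flip: exp_add)

text \<open>The root is the exponential martingale for \<open>b / 2\<close> times a factor decaying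
  in time. Its expectation therefore tends to zero, the quantitative form in which the price dies
  out.\<close>

lemma sqrt_expm: "sqrt (expm b s \<omega>) = expm (b / 2) s \<omega> * exp (- b\<^sup>2 * s / 8)"
proof -
  have "(expm (b / 2) s \<omega> * exp (- b\<^sup>2 * s / 8))\<^sup>2 = expm b s \<omega>"
    unfolding power_mult_distrib expm_square
    by (simp add: expm_def power2_eq_square field_simps flip: exp_add)
  then show ?thesis using expm_pos[of "b/2" s \<omega>] by (intro real_sqrt_unique) auto
qed

text \<open>With an arbitrary past weight \<open>Z\<close> this is the martingale property in
  integrated form; it holds because the next increment is independent of the past and its
  exponential is normalised.\<close>

lemma expm_step:
  assumes st: "0 \<le> s" "s < t" and Z: "Z \<in> borel_measurable (F (ennreal s))"
    and int: "integrable M (\<lambda>\<omega>. Z \<omega> * expm b s \<omega>)"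
  shows "integrable M (\<lambda>\<omega>. Z \<omega> * expm b t \<omega>)"
    "expectation (\<lambda>\<omega>. Z \<omega> * expm b t \<omega>) = expectation (\<lambda>\<omega>. Z \<omega> * expm b s \<omega>)"
proof -
  let ?g = "\<lambda>x. exp (- (b\<^sup>2 * (t - s) / 2)) * exp (b * x)"
  have eq: "Z \<omega> * expm b t \<omega> = (Z \<omega> * expm b s \<omega>) * ?g (B t \<omega> - B s \<omega>)" for \<omega>
    by (simp add: expm_def field_simps flip: exp_add)
  note m = increment_moment[OF st, of 1 0 0 b]
  have m': "integrable M (\<lambda>\<omega>. exp (b * (B t \<omega> - B s \<omega>)))"
      "expectation (\<lambda>\<omega>. exp (b * (B t \<omega> - B s \<omega>))) = exp (b\<^sup>2 * (t - s) / 2)"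
    using m by simp_all
  have g: "integrable M (\<lambda>\<omega>. ?g (B t \<omega> - B s \<omega>))"
    by (intro integrable_mult_right m'(1))
  have g': "expectation (\<lambda>\<omega>. ?g (B t \<omega> - B s \<omega>)) = 1"
    unfolding integral_mult_right_zero m'(2) by (simp flip: exp_add)
  have Zm: "(\<lambda>\<omega>. Z \<omega> * expm b s \<omega>) \<in> borel_measurable (F (ennreal s))"
    using Z expm_adapted[OF st(1) order_refl] by measurable
  have gm: "?g \<in> borel_measurable borel" by measurable
  note r = increment_expectation_mult[OF st Zm int gm g]
  show "integrable M (\<lambda>\<omega>. Z \<omega> * expm b t \<omega>)" unfolding eq by (rule r(1))
  show "expectation (\<lambda>\<omega>. Z \<omega> * expm b t \<omega>) = expectation (\<lambda>\<omega>. Z \<omega> * expm b s \<omega>)"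
    unfolding eq r(2) g' by simp
qed

lemma expm_expectation:
  assumes "0 \<le> t"
  shows "integrable M (expm b t)" "expectation (expm b t) = 1"
proof -
  have ae: "AE \<omega> in M. expm b 0 \<omega> = 1" using B_0 by eventually_elim (simp add: expm_def)
  have 0: "integrable M (expm b 0)"
    using integrable_cong_AE[OF expm_measurable[of 0 b] _ ae] by simp
  have 1: "expectation (expm b 0) = 1"
    using integral_cong_AE[OF expm_measurable[of 0 b] _ ae] by (simp add: prob_space)
  show "integrable M (expm b t)" "expectation (expm b t) = 1"
    using expm_step[of 0 t "\<lambda>_. 1" b] 0 1 assms by (cases "t = 0"; simp)+
qed

text \<open>Rounding up a stopping time to the grid \<open>T i / n\<close>, capped at \<open>T\<close>.\<close>
definition grid_index :: "('a \<Rightarrow> ennreal) \<Rightarrow> real \<Rightarrow> nat \<Rightarrow> 'a \<Rightarrow> nat" where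
  "grid_index \<tau> T n \<omega> = (LEAST i. i = n \<or> \<tau> \<omega> \<le> ennreal (T * real i / real n))"

definition round_up :: "('a \<Rightarrow> ennreal) \<Rightarrow> real \<Rightarrow> nat \<Rightarrow> 'a \<Rightarrow> real" where
  "round_up \<tau> T n \<omega> = T * real (grid_index \<tau> T n \<omega>) / real n"

definition capped :: "('a \<Rightarrow> ennreal) \<Rightarrow> real \<Rightarrow> 'a \<Rightarrow> real" where
  "capped \<tau> T \<omega> = enn2real (min (\<tau> \<omega>) (ennreal T))"

lemma capped_bounds:
  assumes "0 \<le> T" shows "0 \<le> capped \<tau> T \<omega>" "capped \<tau> T \<omega> \<le> T"
    "\<tau> \<omega> < ennreal T \<Longrightarrow> capped \<tau> T \<omega> = enn2real (\<tau> \<omega>)"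
    "ennreal T \<le> \<tau> \<omega> \<Longrightarrow> capped \<tau> T \<omega> = T"
proof -
  show "0 \<le> capped \<tau> T \<omega>" by (simp add: capped_def)
  show "capped \<tau> T \<omega> \<le> T"
    using enn2real_mono[of "min (\<tau> \<omega>) (ennreal T)" "ennreal T"] assms by (simp add: capped_def)
  show "\<tau> \<omega> < ennreal T \<Longrightarrow> capped \<tau> T \<omega> = enn2real (\<tau> \<omega>)" by (simp add: capped_def min_absorb1 less_imp_le)
  show "ennreal T \<le> \<tau> \<omega> \<Longrightarrow> capped \<tau> T \<omega> = T" using assms by (simp add: capped_def min_absorb2)
qed

lemma grid_index_props:
  fixes \<tau> :: "'a \<Rightarrow> ennreal" and T :: real and n :: nat and \<omega> :: 'a
  shows "grid_index \<tau> T n \<omega> \<le> n"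
  "grid_index \<tau> T n \<omega> = n \<or> \<tau> \<omega> \<le> ennreal (T * real (grid_index \<tau> T n \<omega>) / real n)"
  "\<forall>j<grid_index \<tau> T n \<omega>. \<not> \<tau> \<omega> \<le> ennreal (T * real j / real n)"
  unfolding grid_index_def
  by (auto intro: Least_le dest: not_less_Least intro!: LeastI[of "\<lambda>i. i = n \<or> \<tau> \<omega> \<le> ennreal (T * real i / real n)" n])

lemma grid_index_eq_iff:
  assumes "i \<le> n"
  shows "grid_index \<tau> T n \<omega> = i \<longleftrightarrow>
    (i = n \<or> \<tau> \<omega> \<le> ennreal (T * real i / real n)) \<and> (\<forall>j<i. \<not> \<tau> \<omega> \<le> ennreal (T * real j / real n))"
proof
  assume "grid_index \<tau> T n \<omega> = i"
  then show "(i = n \<or> \<tau> \<omega> \<le> ennreal (T * real i / real n)) \<and> (\<forall>j<i. \<not> \<tau> \<omega> \<le> ennreal (T * real j / real n))"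
    using grid_index_props(2,3)[of \<tau> T n \<omega>] by auto
next
  assume *: "(i = n \<or> \<tau> \<omega> \<le> ennreal (T * real i / real n)) \<and> (\<forall>j<i. \<not> \<tau> \<omega> \<le> ennreal (T * real j / real n))"
  show "grid_index \<tau> T n \<omega> = i"
    unfolding grid_index_def
  proof (rule Least_equality)
    fix y assume "y = n \<or> \<tau> \<omega> \<le> ennreal (T * real y / real n)"
    then show "i \<le> y" using * assms by (metis not_le)
  qed (use * in blast)
qed

lemma round_up_close:
  assumes T: "0 < T" and n: "0 < n"
  shows "\<bar>round_up \<tau> T n \<omega> - capped \<tau> T \<omega>\<bar> \<le> T / real n" "0 \<le> round_up \<tau> T n \<omega>" "round_up \<tau> T n \<omega> \<le> T"
proof -
  let ?k = "grid_index \<tau> T n \<omega>"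
  let ?s = "\<lambda>i. T * real i / real n"
  note p = grid_index_props[of \<tau> T n \<omega>]
  show "0 \<le> round_up \<tau> T n \<omega>" using T by (simp add: round_up_def)
  show le: "round_up \<tau> T n \<omega> \<le> T"
    using p(1) T n by (simp add: round_up_def divide_le_eq)
  show "\<bar>round_up \<tau> T n \<omega> - capped \<tau> T \<omega>\<bar> \<le> T / real n"
  proof (cases "\<tau> \<omega> < ennreal T")
    case False
    then have \<tau>: "ennreal T \<le> \<tau> \<omega>" by simp
    have "?k = n"
    proof (rule ccontr)
      assume "?k \<noteq> n"
      then have "?k < n" "\<tau> \<omega> \<le> ennreal (?s ?k)" using p by auto
      moreover have "?s ?k < T" using \<open>?k < n\<close> T n by (simp add: divide_less_eq)
      ultimately show False using \<tau> T by (metis ennreal_lessI not_le order.trans)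
    qed
    then show ?thesis using capped_bounds(4)[of T \<tau> \<omega>] \<tau> n T by (simp add: round_up_def)
  next
    case True
    then obtain u where u: "0 \<le> u" "\<tau> \<omega> = ennreal u"
      by (metis ennreal_cases ennreal_less_top less_asym top.not_eq_extremum)
    have cu: "capped \<tau> T \<omega> = u" using capped_bounds(3)[of T \<tau> \<omega>] True u T by simp
    have uT: "u < T" using True u T by (simp add: ennreal_less_iff)
    have up: "u \<le> ?s ?k"
    proof (cases "?k = n")
      case True then show ?thesis using uT n by simp
    next
      case False
      then show ?thesis using p(2) u T by (simp add: ennreal_le_iff)
    qed
    have low: "?s ?k - T / real n \<le> u"
    proof (cases "?k")
      case 0 then show ?thesis using u T by (simp add: order_trans[of _ 0])
    next
      case (Suc j)
      then have "?s j < u" using p(3)[rule_format, of j] u T by (simp add: ennreal_le_iff not_le)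
      moreover have "?s ?k - T / real n = ?s j" using Suc by (simp add: distrib_left add_divide_distrib)
      ultimately show ?thesis by simp
    qed
    show ?thesis using cu up low by (simp add: round_up_def)
  qed
qed

text \<open>Optional stopping on a finite grid. The event that the grid index equals
  \<open>i\<close> is known at the \<open>i\<close>-th time, so on it the martingale may be replaced
  by its value at \<open>T\<close> without changing the expectation. These events partition the
  space, and the sum is the expectation at \<open>T\<close>.\<close>

lemma expm_round_up:
  assumes \<tau>: "stopping_time F \<tau>" and T: "0 < T" and n: "0 < n"
  shows "integrable M (\<lambda>\<omega>. expm b (round_up \<tau> T n \<omega>) \<omega>)"
    "expectation (\<lambda>\<omega>. expm b (round_up \<tau> T n \<omega>) \<omega>) = 1"
proof -
  let ?s = "\<lambda>i. T * real i / real n"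
  define Z where "Z = (\<lambda>i \<omega>. if grid_index \<tau> T n \<omega> = i then 1 else (0::real))"
  have s: "0 \<le> ?s i" "?s n = T" for i using T n by auto
  have mono: "?s j \<le> ?s i" if "j \<le> i" for i j using that T by (simp add: divide_right_mono)
  have Zm: "Z i \<in> borel_measurable (F (ennreal (?s i)))" if i: "i \<le> n" for i
  proof -
    have pr [measurable]: "Measurable.pred (F (ennreal (?s i))) (\<lambda>\<omega>. \<tau> \<omega> \<le> ennreal (?s j))" if "j \<le> i" for j
      using measurable_F_mono[OF stopping_timeD[OF \<tau>]] mono[OF that] by (simp add: ennreal_leI)
    have "Measurable.pred (F (ennreal (?s i))) (\<lambda>\<omega>. grid_index \<tau> T n \<omega> = i)"
      unfolding grid_index_eq_iff[OF i]
    proof (intro pred_intros_logic)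
      have "Measurable.pred (F (ennreal (?s i))) (\<lambda>\<omega>. \<forall>j\<in>{..<i}. \<not> \<tau> \<omega> \<le> ennreal (?s j))"
        by (intro pred_intros_countable_bounded(3) pred_intros_logic pr) auto
      then show "Measurable.pred (F (ennreal (?s i))) (\<lambda>\<omega>. \<forall>j<i. \<not> \<tau> \<omega> \<le> ennreal (?s j))"
        by (simp add: Ball_def)
    qed (auto intro!: pr)
    then show ?thesis unfolding Z_def by measurable
  qed
  have eq: "expm b (round_up \<tau> T n \<omega>) \<omega> = (\<Sum>i\<le>n. Z i \<omega> * expm b (?s i) \<omega>)" for \<omega>
  proof -
    have "(\<Sum>i\<le>n. Z i \<omega> * expm b (?s i) \<omega>) = (\<Sum>i\<le>n. if i = grid_index \<tau> T n \<omega> then expm b (?s i) \<omega> else 0)"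
      by (intro sum.cong) (auto simp: Z_def)
    also have "\<dots> = expm b (?s (grid_index \<tau> T n \<omega>)) \<omega>"
      using grid_index_props(1)[of \<tau> T n \<omega>] by (subst sum.delta) auto
    finally show ?thesis by (simp add: round_up_def)
  qed
  have int: "integrable M (\<lambda>\<omega>. Z i \<omega> * expm b (?s i) \<omega>)" if i: "i \<le> n" for i
  proof (rule Bochner_Integration.integrable_bound[OF expm_expectation(1)[OF s(1)[of i], of b]])
    show "(\<lambda>\<omega>. Z i \<omega> * expm b (?s i) \<omega>) \<in> borel_measurable M"
      using Zm[OF i] measurable_F_M expm_measurable[OF s(1)[of i]] by (intro borel_measurable_times) blast+
    show "AE \<omega> in M. norm (Z i \<omega> * expm b (?s i) \<omega>) \<le> norm (expm b (?s i) \<omega>)"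
      by (auto simp: Z_def)
  qed
  have eqT: "integrable M (\<lambda>\<omega>. Z i \<omega> * expm b T \<omega>) \<and>
      expectation (\<lambda>\<omega>. Z i \<omega> * expm b T \<omega>) = expectation (\<lambda>\<omega>. Z i \<omega> * expm b (?s i) \<omega>)" if i: "i \<le> n" for i
  proof (cases "i = n")
    case True then show ?thesis using int[OF i] s(2) by simp
  next
    case False
    then have "?s i < T" using i T n by (simp add: divide_less_eq)
    then show ?thesis using expm_step[OF s(1) _ Zm[OF i] int[OF i]] by blast
  qed
  show "integrable M (\<lambda>\<omega>. expm b (round_up \<tau> T n \<omega>) \<omega>)" unfolding eq
    using int by (intro Bochner_Integration.integrable_sum) auto
  have "expectation (\<lambda>\<omega>. expm b (round_up \<tau> T n \<omega>) \<omega>) = (\<Sum>i\<le>n. expectation (\<lambda>\<omega>. Z i \<omega> * expm b (?s i) \<omega>))"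
    unfolding eq using int by (intro Bochner_Integration.integral_sum) auto
  also have "\<dots> = (\<Sum>i\<le>n. expectation (\<lambda>\<omega>. Z i \<omega> * expm b T \<omega>))"
    using eqT by (intro sum.cong) auto
  also have "\<dots> = expectation (\<lambda>\<omega>. \<Sum>i\<le>n. Z i \<omega> * expm b T \<omega>)"
    using eqT by (intro Bochner_Integration.integral_sum[symmetric]) auto
  also have "(\<lambda>\<omega>. \<Sum>i\<le>n. Z i \<omega> * expm b T \<omega>) = expm b T"
  proof
    fix \<omega>
    have "(\<Sum>i\<le>n. Z i \<omega>) = 1"
      unfolding Z_def using grid_index_props(1)[of \<tau> T n \<omega>] by (subst sum.delta') auto
    then show "(\<Sum>i\<le>n. Z i \<omega> * expm b T \<omega>) = expm b T \<omega>" by (simp add: sum_distrib_right[symmetric])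
  qed
  finally show "expectation (\<lambda>\<omega>. expm b (round_up \<tau> T n \<omega>) \<omega>) = 1"
    using expm_expectation(2)[of T b] T by simp
qed

lemma round_up_tendsto:
  fixes f :: "real \<Rightarrow> real"
  assumes T: "0 < T" and f: "continuous_on {0..} f"
  shows "(\<lambda>n. f (round_up \<tau> T (Suc n) \<omega>)) \<longlonglongrightarrow> f (capped \<tau> T \<omega>)"
proof (rule continuous_on_tendsto_compose[OF f])
  show "(\<lambda>n. round_up \<tau> T (Suc n) \<omega>) \<longlonglongrightarrow> capped \<tau> T \<omega>"
  proof (rule LIM_zero_cancel, rule Lim_null_comparison)
    show "\<forall>\<^sub>F n in sequentially. norm (round_up \<tau> T (Suc n) \<omega> - capped \<tau> T \<omega>) \<le> T / real (Suc n)"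
      using round_up_close(1)[OF T] by (intro always_eventually allI) (simp del: of_nat_Suc)
    show "(\<lambda>n. T / real (Suc n)) \<longlonglongrightarrow> 0" by real_asymp
  qed
qed (use round_up_close(2)[OF T] capped_bounds(1) T in \<open>auto intro!: always_eventually\<close>)

lemma expm_continuous: "AE \<omega> in M. continuous_on {0..} (\<lambda>s. expm b s \<omega>)"
  using B_continuous by eventually_elim (auto simp: expm_def intro!: continuous_intros)

lemma expm_capped_tendsto:
  assumes "0 < T"
  shows "AE \<omega> in M. (\<lambda>n. expm b (round_up \<tau> T (Suc n) \<omega>) \<omega>) \<longlonglongrightarrow> expm b (capped \<tau> T \<omega>) \<omega>"
  using expm_continuous[of b] by eventually_elim (rule round_up_tendsto[OF assms])

text \<open>The rounded times converge to the capped time and almost every path is continuous, so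
  Fatou's lemma applies; it yields an inequality only.\<close>

lemma expm_capped:
  assumes \<tau>: "stopping_time F \<tau>" and T: "0 < T"
  shows "(\<lambda>\<omega>. expm b (capped \<tau> T \<omega>) \<omega>) \<in> borel_measurable M"
    "(\<integral>\<^sup>+\<omega>. ennreal (expm b (capped \<tau> T \<omega>) \<omega>) \<partial>M) \<le> 1"
proof -
  interpret complete_measure M by (rule complete_M)
  note r = expm_round_up[OF \<tau> T]
  have m [measurable]: "(\<lambda>\<omega>. expm b (round_up \<tau> T (Suc n) \<omega>) \<omega>) \<in> borel_measurable M" for n
    using r(1)[of "Suc n"] by (intro borel_measurable_integrable) auto
  show "(\<lambda>\<omega>. expm b (capped \<tau> T \<omega>) \<omega>) \<in> borel_measurable M"
    by (rule borel_measurable_AE_LIMSEQ[OF m expm_capped_tendsto[OF T]])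
  have "(\<integral>\<^sup>+\<omega>. ennreal (expm b (capped \<tau> T \<omega>) \<omega>) \<partial>M)
      = (\<integral>\<^sup>+\<omega>. liminf (\<lambda>n. ennreal (expm b (round_up \<tau> T (Suc n) \<omega>) \<omega>)) \<partial>M)"
    using expm_capped_tendsto[OF T, of b \<tau>]
    by (intro nn_integral_cong_AE) (auto elim!: eventually_mono dest!: tendsto_ennrealI lim_imp_Liminf[rotated])
  also have "\<dots> \<le> liminf (\<lambda>n. \<integral>\<^sup>+\<omega>. ennreal (expm b (round_up \<tau> T (Suc n) \<omega>) \<omega>) \<partial>M)"
    by (intro nn_integral_liminf) measurable
  also have "(\<lambda>n. \<integral>\<^sup>+\<omega>. ennreal (expm b (round_up \<tau> T (Suc n) \<omega>) \<omega>) \<partial>M) = (\<lambda>_. 1)"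
    using r[of "Suc _"] expm_pos by (auto simp: nn_integral_eq_integral less_imp_le)
  finally show "(\<integral>\<^sup>+\<omega>. ennreal (expm b (capped \<tau> T \<omega>) \<omega>) \<partial>M) \<le> 1" by (simp add: Liminf_const)
qed

text \<open>The second moment bound makes the rounded variables uniformly integrable, so that no mass
  is lost in the limit.\<close>
lemma expm_capped_bounded:
  assumes \<tau>: "stopping_time F \<tau>" and T: "0 < T"
    and bound: "AE \<omega> in M. expm b (capped \<tau> T \<omega>) \<omega> \<le> L"
  shows "1 \<le> expectation (\<lambda>\<omega>. expm b (capped \<tau> T \<omega>) \<omega>)"
proof -
  let ?r = "\<lambda>b n \<omega>. expm b (round_up \<tau> T (Suc n) \<omega>) \<omega>"
  have r: "integrable M (?r b n)" "expectation (?r b n) = 1" for n b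
    using expm_round_up[OF \<tau> T, of "Suc n"] by auto
  let ?C = "exp (b\<^sup>2 * T)"
  have sq_le: "(?r b n \<omega>)\<^sup>2 \<le> ?C * ?r (2 * b) n \<omega>" for n \<omega>
    unfolding expm_square using round_up_close(3)[OF T, of "Suc n" \<tau> \<omega>] expm_pos[of "2 * b" _ \<omega>]
    by (subst mult.commute) (intro mult_right_mono, simp_all add: mult_left_mono less_imp_le)
  have K: "1 - ?C / K \<le> expectation (\<lambda>\<omega>. expm b (capped \<tau> T \<omega>) \<omega>)" if K: "max L 1 \<le> K" for K :: real
  proof -
    have K0: "0 < K" using K by simp
    \<comment> \<open>For \<open>x \<le> K\<close> the subtracted term only helps, and for
      \<open>x > K\<close> the difference \<open>x - x\<^sup>2 / K\<close> is negative. The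
      truncated variable is thus bounded below by variables whose expectations are known.\<close>
    have min_le: "?r b n \<omega> - ?C / K * ?r (2 * b) n \<omega> \<le> min K (?r b n \<omega>)" for n \<omega>
    proof -
      have "?r b n \<omega> - (?r b n \<omega>)\<^sup>2 / K \<le> min K (?r b n \<omega>)"
      proof (cases "?r b n \<omega> \<le> K")
        case False
        then have "?r b n \<omega> * K \<le> (?r b n \<omega>)\<^sup>2" using expm_pos by (simp add: power2_eq_square less_imp_le mult_left_mono)
        then have "?r b n \<omega> \<le> (?r b n \<omega>)\<^sup>2 / K" using K0 by (simp add: field_simps)
        then show ?thesis using False K0 by simp
      qed (use K0 in simp)
      moreover have "(?r b n \<omega>)\<^sup>2 / K \<le> ?C / K * ?r (2 * b) n \<omega>"
        using divide_right_mono[OF sq_le[of n \<omega>], of K] K0 by simp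
      ultimately show ?thesis by simp
    qed
    have imin: "integrable M (\<lambda>\<omega>. min K (?r b n \<omega>))" for n
      using r(1) by (intro integrable_min) auto
    have lower: "1 - ?C / K \<le> expectation (\<lambda>\<omega>. min K (?r b n \<omega>))" for n
    proof -
      have "1 - ?C / K = expectation (\<lambda>\<omega>. ?r b n \<omega> - ?C / K * ?r (2 * b) n \<omega>)"
        using r[of b n] r[of "2 * b" n] by simp
      also have "\<dots> \<le> expectation (\<lambda>\<omega>. min K (?r b n \<omega>))"
        using r(1) imin min_le by (intro integral_mono) auto
      finally show ?thesis .
    qed
    have m: "(\<lambda>\<omega>. expm b (capped \<tau> T \<omega>) \<omega>) \<in> borel_measurable M" by (rule expm_capped[OF \<tau> T])
    have "(\<lambda>n. expectation (\<lambda>\<omega>. min K (?r b n \<omega>))) \<longlonglongrightarrow> expectation (\<lambda>\<omega>. min K (expm b (capped \<tau> T \<omega>) \<omega>))"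
    proof (rule integral_dominated_convergence[where w="\<lambda>_. K"])
      show "AE \<omega> in M. (\<lambda>n. min K (?r b n \<omega>)) \<longlonglongrightarrow> min K (expm b (capped \<tau> T \<omega>) \<omega>)"
        using expm_capped_tendsto[OF T, of b \<tau>] by eventually_elim (intro tendsto_intros)
      show "AE \<omega> in M. norm (min K (?r b n \<omega>)) \<le> K" for n
        using expm_pos K0 by (auto simp: abs_le_iff less_imp_le min_le_iff_disj minus_le_iff order_trans[of _ 0])
    qed (use m r(1) in \<open>auto intro!: borel_measurable_min borel_measurable_integrable\<close>)
    then have "1 - ?C / K \<le> expectation (\<lambda>\<omega>. min K (expm b (capped \<tau> T \<omega>) \<omega>))"
      by (rule LIMSEQ_le_const) (use lower in blast)
    also have "\<dots> = expectation (\<lambda>\<omega>. expm b (capped \<tau> T \<omega>) \<omega>)"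
      using bound m K by (intro integral_cong_AE) (auto elim!: eventually_mono)
    finally show ?thesis .
  qed
  have "((\<lambda>K. 1 - ?C / K) \<longlongrightarrow> 1 - 0) at_top"
    by (intro tendsto_diff tendsto_const
        tendsto_divide_0[OF tendsto_const filterlim_at_top_imp_at_infinity[OF filterlim_ident]])
  then show ?thesis
    using K by (intro tendsto_upperbound[where f="\<lambda>K. 1 - ?C / K" and F=at_top])
      (auto intro!: eventually_mono[OF eventually_ge_at_top[of "max L 1"]])
qed

lemma expectation_sqrt_expm:
  assumes "0 \<le> T"
  shows "integrable M (\<lambda>\<omega>. sqrt (expm b T \<omega>))" "expectation (\<lambda>\<omega>. sqrt (expm b T \<omega>)) = exp (- b\<^sup>2 * T / 8)"
  unfolding sqrt_expm using expm_expectation[OF assms, of "b / 2"] by auto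

lemma exp_decay: "b \<noteq> 0 \<Longrightarrow> (\<lambda>k. exp (- b\<^sup>2 * real (Suc k) / 8)) \<longlonglongrightarrow> 0"
proof -
  assume "b \<noteq> 0"
  then have "0 < b\<^sup>2" by simp
  then show ?thesis by real_asymp
qed

end


section \<open>Hitting probabilities\<close>

locale gbm_power = gbm +
  fixes \<beta> :: real
  assumes p_pos: "0 < p" and \<sigma>_pos: "0 < \<sigma>" and \<beta>_def: "\<beta> = 1 - 2 * \<mu> / \<sigma>\<^sup>2" and \<beta>_pos: "0 < \<beta>"
begin

definition nice :: "'a \<Rightarrow> bool" where
  "nice \<omega> \<longleftrightarrow> continuous_on {0..} (\<lambda>t. X t \<omega>) \<and> X 0 \<omega> = p \<and>
     (\<forall>t\<ge>0. 0 < X t \<omega> \<and> X t \<omega> powr \<beta> = p powr \<beta> * expm (\<beta> * \<sigma>) t \<omega>)"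

text \<open>The identity for the product holds almost surely at each rational time, hence at all
  rational times at once, and by continuity at all times.\<close>

lemma AE_nice: "AE \<omega> in M. nice \<omega>"
proof -
  have "AE \<omega> in M. X (real a / real b) \<omega> * Y (real a / real b) \<omega> = p" for a b
    proof (cases "real a / real b = 0")
    case True
    show ?thesis using XY_0 unfolding True .
  next
    case False
    then have "0 < real a / real b" by (simp add: zero_less_divide_iff)
    then show ?thesis by (rule XY_const)
  qed
  then have "AE \<omega> in M. \<forall>a b. X (real a / real b) \<omega> * Y (real a / real b) \<omega> = p"
    by (simp add: AE_all_countable)
  with X_continuous B_continuous X_0 show ?thesis
  proof eventually_elim
    case (elim \<omega>)
    have cont: "continuous_on {0..} (\<lambda>s. X s \<omega> * Y s \<omega>)"
      unfolding Y_def by (intro continuous_intros elim(1,2))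
    have XY: "X t \<omega> * Y t \<omega> = p" if t: "0 \<le> t" for t
    proof -
      let ?q = "\<lambda>n. real (nat \<lfloor>t * real (Suc n)\<rfloor>) / real (Suc n)"
      have q_eq: "?q n = of_int \<lfloor>t * real (Suc n)\<rfloor> / real (Suc n)" for n using t by simp
      have "\<bar>?q n - t\<bar> \<le> 1 / real (Suc n)" for n
      proof -
        have "\<bar>of_int \<lfloor>t * real (Suc n)\<rfloor> - t * real (Suc n)\<bar> \<le> 1" by linarith
        then have "\<bar>of_int \<lfloor>t * real (Suc n)\<rfloor> - t * real (Suc n)\<bar> / real (Suc n) \<le> 1 / real (Suc n)"
          by (intro divide_right_mono) auto
        moreover have "?q n - t = (of_int \<lfloor>t * real (Suc n)\<rfloor> - t * real (Suc n)) / real (Suc n)"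
          unfolding q_eq by (simp add: diff_divide_distrib del: of_nat_Suc)
        ultimately show ?thesis by (simp add: abs_divide del: of_nat_Suc)
      qed
      then have ev: "\<forall>\<^sub>F n in sequentially. norm (?q n - t) \<le> 1 / real (Suc n)"
        by (intro always_eventually allI) (simp only: real_norm_def)
      have "(\<lambda>n. 1 / real (Suc n)) \<longlonglongrightarrow> 0" by real_asymp
      from LIM_zero_cancel[OF Lim_null_comparison[OF ev this]] have q: "?q \<longlonglongrightarrow> t" .
      have q0: "0 \<le> ?q n" for n by (rule divide_nonneg_nonneg) auto
      have "(\<lambda>n. X (?q n) \<omega> * Y (?q n) \<omega>) \<longlonglongrightarrow> X t \<omega> * Y t \<omega>"
        by (rule continuous_on_tendsto_compose[OF cont q]) (use t q0 in \<open>auto simp only: atLeast_iff intro!: always_eventually\<close>)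
      moreover have "X (?q n) \<omega> * Y (?q n) \<omega> = p" for n using elim(4) by blast
      ultimately show ?thesis by (simp only: LIMSEQ_const_iff)
    qed
    \<comment> \<open>With this drift, the power \<beta> of the price carries exactly the
      compensating exponent of the exponential martingale for
      \<open>\<beta> * \<sigma>\<close>.\<close>
    have drift: "\<mu> - \<sigma>\<^sup>2 / 2 = - \<beta> * \<sigma>\<^sup>2 / 2"
      using \<sigma>_pos unfolding \<beta>_def by (simp add: field_simps)
    have X_eq: "X t \<omega> = p * exp (\<sigma> * B t \<omega> - \<beta> * \<sigma>\<^sup>2 / 2 * t)" if "0 \<le> t" for t
    proof -
      have "Y t \<omega> * exp (\<sigma> * B t \<omega> - \<beta> * \<sigma>\<^sup>2 / 2 * t) = 1"
        unfolding Y_def drift exp_add[symmetric] by simp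
      then have "X t \<omega> = (X t \<omega> * Y t \<omega>) * exp (\<sigma> * B t \<omega> - \<beta> * \<sigma>\<^sup>2 / 2 * t)"
        by (simp only: mult.assoc mult_1_right)
      then show ?thesis unfolding XY[OF that] .
    qed
    have "X t \<omega> powr \<beta> = p powr \<beta> * expm (\<beta> * \<sigma>) t \<omega>" if "0 \<le> t" for t
    proof -
      have "X t \<omega> powr \<beta> = p powr \<beta> * exp (\<beta> * (\<sigma> * B t \<omega> - \<beta> * \<sigma>\<^sup>2 / 2 * t))"
        unfolding X_eq[OF that] unfolding powr_mult by (simp add: powr_def)
      also have "\<beta> * (\<sigma> * B t \<omega> - \<beta> * \<sigma>\<^sup>2 / 2 * t) = \<beta> * \<sigma> * B t \<omega> - (\<beta> * \<sigma>)\<^sup>2 * t / 2"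
        by (simp add: power2_eq_square algebra_simps)
      finally show ?thesis by (simp add: expm_def)
    qed
    moreover have "0 < X t \<omega>" if "0 \<le> t" for t using X_eq[OF that] p_pos by simp
    ultimately show ?case using elim(1,3) by (simp add: nice_def)
  qed
qed

lemma stopping_time_measurable: "stopping_time F \<tau> \<Longrightarrow> \<tau> \<in> borel_measurable M"
  by (rule measurable_stopping_time[OF _ sets_F space_F])

text \<open>Setting to zero what has not stopped before time \<open>Suc k\<close> agrees with the
  price zero at infinity; on paths that do stop the sequence is eventually constant.\<close>

lemma price_at_power_tendsto:
  assumes "nice \<omega>"
  shows "(\<lambda>k. if \<tau> \<omega> < ennreal (real (Suc k))
      then p powr \<beta> * expm (\<beta> * \<sigma>) (capped \<tau> (real (Suc k)) \<omega>) \<omega> else 0)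
    \<longlonglongrightarrow> price_at X \<tau> \<omega> powr \<beta>" (is "?u \<longlonglongrightarrow> _")
proof (cases "\<tau> \<omega> = \<top>")
  case True
  then show ?thesis by (simp add: price_at_def)
next
  case False
  then obtain r where r: "0 \<le> r" "\<tau> \<omega> = ennreal r" by (cases "\<tau> \<omega>") auto
  obtain k0 :: nat where k0: "r < real k0" using reals_Archimedean2 by blast
  have "?u k = price_at X \<tau> \<omega> powr \<beta>" if "k \<ge> k0" for k
  proof -
    have "r < real (Suc k)" using k0 that by linarith
    then have lt: "\<tau> \<omega> < ennreal (real (Suc k))" using r by (simp add: ennreal_less_iff del: of_nat_Suc)
    then have "capped \<tau> (real (Suc k)) \<omega> = r"
      using capped_bounds(3)[of "real (Suc k)" \<tau> \<omega>] r by simp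
    then show ?thesis using lt False r assms by (simp add: price_at_def nice_def)
  qed
  then have "\<forall>\<^sub>F k in sequentially. ?u k = price_at X \<tau> \<omega> powr \<beta>"
    by (rule eventually_sequentiallyI)
  then show ?thesis by (rule tendsto_eventually)
qed

lemma price_at_nonneg: "nice \<omega> \<Longrightarrow> 0 \<le> price_at X \<tau> \<omega>"
  by (auto simp: price_at_def nice_def less_imp_le)

text \<open>Fatou's lemma once more, along growing caps. The inequality can be strict, since the
  price is set to zero on paths that never stop.\<close>

lemma price_at_moment:
  assumes \<tau>: "stopping_time F \<tau>"
  shows "price_at X \<tau> \<in> borel_measurable M"
    "integrable M (\<lambda>\<omega>. price_at X \<tau> \<omega> powr \<beta>)"
    "expectation (\<lambda>\<omega>. price_at X \<tau> \<omega> powr \<beta>) \<le> p powr \<beta>"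
proof -
  interpret complete_measure M by (rule complete_M)
  let ?u = "\<lambda>k \<omega>. if \<tau> \<omega> < ennreal (real (Suc k))
      then p powr \<beta> * expm (\<beta> * \<sigma>) (capped \<tau> (real (Suc k)) \<omega>) \<omega> else 0"
  have [measurable]: "\<tau> \<in> borel_measurable M" by (rule stopping_time_measurable[OF \<tau>])
  have [measurable]: "(\<lambda>\<omega>. expm (\<beta> * \<sigma>) (capped \<tau> (real (Suc k)) \<omega>) \<omega>) \<in> borel_measurable M" for k
    by (rule expm_capped[OF \<tau>]) simp
  have um [measurable]: "?u k \<in> borel_measurable M" for k by measurable
  have lim: "AE \<omega> in M. (\<lambda>k. ?u k \<omega>) \<longlonglongrightarrow> price_at X \<tau> \<omega> powr \<beta>"
    using AE_nice by eventually_elim (rule price_at_power_tendsto)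
  have Rm [measurable]: "(\<lambda>\<omega>. price_at X \<tau> \<omega> powr \<beta>) \<in> borel_measurable M"
    by (rule borel_measurable_AE_LIMSEQ[OF um lim])
  show "price_at X \<tau> \<in> borel_measurable M"
  \<comment> \<open>The approximation is available for the power \<beta> only; the price is
    recovered as a root of it, almost everywhere.\<close>
  proof (rule measurable_AE_eq)
    show "(\<lambda>\<omega>. (price_at X \<tau> \<omega> powr \<beta>) powr (1 / \<beta>)) \<in> borel_measurable M" by measurable
    show "AE \<omega> in M. (price_at X \<tau> \<omega> powr \<beta>) powr (1 / \<beta>) = price_at X \<tau> \<omega>"
      using AE_nice by eventually_elim (use \<beta>_pos price_at_nonneg in \<open>simp add: powr_powr\<close>)
  qed auto
  have "(\<integral>\<^sup>+\<omega>. ennreal (price_at X \<tau> \<omega> powr \<beta>) \<partial>M) = (\<integral>\<^sup>+\<omega>. liminf (\<lambda>k. ennreal (?u k \<omega>)) \<partial>M)"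
    using lim by (intro nn_integral_cong_AE) (auto elim!: eventually_mono dest!: tendsto_ennrealI lim_imp_Liminf[rotated])
  also have "\<dots> \<le> liminf (\<lambda>k. \<integral>\<^sup>+\<omega>. ennreal (?u k \<omega>) \<partial>M)"
    by (intro nn_integral_liminf) measurable
  also have "\<dots> \<le> liminf (\<lambda>k. ennreal (p powr \<beta>))"
  proof (intro Liminf_mono always_eventually allI)
    fix k
    have "(\<integral>\<^sup>+\<omega>. ennreal (?u k \<omega>) \<partial>M) \<le>
        (\<integral>\<^sup>+\<omega>. ennreal (p powr \<beta>) * ennreal (expm (\<beta> * \<sigma>) (capped \<tau> (real (Suc k)) \<omega>) \<omega>) \<partial>M)"
      by (intro nn_integral_mono) (auto simp: ennreal_mult[symmetric] expm_pos less_imp_le)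
    also have "\<dots> = ennreal (p powr \<beta>) * (\<integral>\<^sup>+\<omega>. ennreal (expm (\<beta> * \<sigma>) (capped \<tau> (real (Suc k)) \<omega>) \<omega>) \<partial>M)"
      by (intro nn_integral_cmult) measurable
    also have "\<dots> \<le> ennreal (p powr \<beta>) * 1"
      by (intro mult_left_mono expm_capped(2)[OF \<tau>]) auto
    finally show "(\<integral>\<^sup>+\<omega>. ennreal (?u k \<omega>) \<partial>M) \<le> ennreal (p powr \<beta>)" by simp
  qed
  finally have nn: "(\<integral>\<^sup>+\<omega>. ennreal (price_at X \<tau> \<omega> powr \<beta>) \<partial>M) \<le> ennreal (p powr \<beta>)"
    by (simp add: Liminf_const)
  show int: "integrable M (\<lambda>\<omega>. price_at X \<tau> \<omega> powr \<beta>)"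
    by (rule integrableI_bounded[OF Rm]) (use nn in \<open>auto simp: le_less_trans[OF _ ennreal_less_top]\<close>)
  show "expectation (\<lambda>\<omega>. price_at X \<tau> \<omega> powr \<beta>) \<le> p powr \<beta>"
    using nn nn_integral_eq_integral[OF int] by (simp add: ennreal_le_iff)
qed

lemma exponent_nonzero: "\<beta> * \<sigma> \<noteq> 0" using \<beta>_pos \<sigma>_pos by simp

text \<open>Up to \<tau> the martingale stays below \<open>L\<close>, so its expectation at the
  capped time is at least one. Where \<tau> is finite the value is at most \<open>L\<close>; where
  \<tau> is infinite the value at \<open>T\<close> is at most \<open>sqrt L\<close> times its own
  root, whose expectation vanishes as \<open>T\<close> grows. Hence \<open>L\<close> times the
  hitting probability is at least one.\<close>

lemma hit_up_probability:
  assumes \<tau>: "stopping_time F \<tau>" and c: "p < c"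
    and below: "AE \<omega> in M. \<forall>t\<ge>0. ennreal t \<le> \<tau> \<omega> \<longrightarrow> X t \<omega> \<le> c"
  shows "(p / c) powr \<beta> \<le> prob {\<omega> \<in> space M. \<tau> \<omega> < \<top>}"
proof -
  let ?b = "\<beta> * \<sigma>"
  define L where "L = (c / p) powr \<beta>"
  have L: "0 < L" using c p_pos by (simp add: L_def)
  have [measurable]: "\<tau> \<in> borel_measurable M" by (rule stopping_time_measurable[OF \<tau>])
  let ?A = "{\<omega> \<in> space M. \<tau> \<omega> < \<top>}"
  have bound: "AE \<omega> in M. \<forall>t\<ge>0. ennreal t \<le> \<tau> \<omega> \<longrightarrow> expm ?b t \<omega> \<le> L"
    using AE_nice below
  proof eventually_elim
    case (elim \<omega>)
    show ?case
    proof (intro allI impI)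
      fix t :: real assume t: "0 \<le> t" "ennreal t \<le> \<tau> \<omega>"
      have "X t \<omega> powr \<beta> \<le> c powr \<beta>"
        using elim t \<beta>_pos by (intro powr_mono2) (auto simp: nice_def less_imp_le)
      then have "p powr \<beta> * expm ?b t \<omega> \<le> c powr \<beta>"
        using elim(1) t by (simp add: nice_def)
      then show "expm ?b t \<omega> \<le> L"
        unfolding L_def using p_pos c by (simp add: powr_divide field_simps)
    qed
  qed
  have capped_le: "ennreal (capped \<tau> T \<omega>) \<le> \<tau> \<omega>" for T \<omega>
    unfolding capped_def ennreal_enn2real_if by simp
  have main: "1 \<le> L * prob ?A + sqrt L * exp (- ?b\<^sup>2 * T / 8)" if T: "0 < T" for T
  proof -
    have T0: "0 \<le> T" using T by simp
    note sq = expectation_sqrt_expm[OF T0, of ?b]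
    have bT: "AE \<omega> in M. expm ?b (capped \<tau> T \<omega>) \<omega> \<le> L"
      using bound by eventually_elim (use capped_le capped_bounds(1)[OF T0] in blast)
    have "1 \<le> expectation (\<lambda>\<omega>. expm ?b (capped \<tau> T \<omega>) \<omega>)"
      by (rule expm_capped_bounded[OF \<tau> T bT])
    also have "\<dots> \<le> expectation (\<lambda>\<omega>. L * indicator ?A \<omega> + sqrt L * sqrt (expm ?b T \<omega>))"
    proof (rule integral_mono_AE)
      show "integrable M (\<lambda>\<omega>. expm ?b (capped \<tau> T \<omega>) \<omega>)"
        using bT expm_pos by (intro integrable_const_bound[of _ L] expm_capped[OF \<tau> T]) (auto elim!: eventually_mono simp: less_imp_le)
      show "integrable M (\<lambda>\<omega>. L * indicator ?A \<omega> + sqrt L * sqrt (expm ?b T \<omega>))"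
        by (intro Bochner_Integration.integrable_add integrable_mult_right sq(1) integrable_real_indicator) (auto simp: less_top[symmetric])
      show "AE \<omega> in M. expm ?b (capped \<tau> T \<omega>) \<omega> \<le> L * indicator ?A \<omega> + sqrt L * sqrt (expm ?b T \<omega>)"
        using bT bound AE_space
      proof eventually_elim
        case (elim \<omega>)
        show ?case
        proof (cases "\<tau> \<omega> < \<top>")
          case True
          then have "expm ?b (capped \<tau> T \<omega>) \<omega> \<le> L * indicator ?A \<omega>" using elim by simp
          moreover have "0 \<le> sqrt L * sqrt (expm ?b T \<omega>)" using L expm_pos by (simp add: less_imp_le)
          ultimately show ?thesis by simp
        next
          case False
          then have top: "\<tau> \<omega> = \<top>" using top.not_eq_extremum by blast
          then have "capped \<tau> T \<omega> = T" using capped_bounds(4)[OF T0] by simp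
          moreover have "expm ?b T \<omega> \<le> L" using elim(2) T0 top by simp
          then have "sqrt (expm ?b T \<omega>) * sqrt (expm ?b T \<omega>) \<le> sqrt L * sqrt (expm ?b T \<omega>)"
            using expm_pos by (intro mult_right_mono) (auto simp: less_imp_le)
          moreover have "sqrt (expm ?b T \<omega>) * sqrt (expm ?b T \<omega>) = expm ?b T \<omega>"
            using expm_pos by (simp add: less_imp_le)
          ultimately show ?thesis using top by simp
        qed
      qed
    qed
    also have "\<dots> = L * prob ?A + sqrt L * exp (- ?b\<^sup>2 * T / 8)"
    proof -
      have "integrable M (indicat_real ?A)"
        by (intro integrable_real_indicator) (auto simp: less_top[symmetric])
      then show ?thesis using sq by (subst Bochner_Integration.integral_add) auto
    qed
    finally show ?thesis .
  qed
  have "(\<lambda>k. L * prob ?A + sqrt L * exp (- ?b\<^sup>2 * real (Suc k) / 8)) \<longlonglongrightarrow> L * prob ?A + sqrt L * 0"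
    by (intro tendsto_intros exp_decay exponent_nonzero)
  then have "1 \<le> L * prob ?A + sqrt L * 0"
    by (rule LIMSEQ_le_const) (use main in \<open>auto simp del: of_nat_Suc\<close>)
  moreover have eq: "(p / c) powr \<beta> = 1 / L"
    unfolding L_def using p_pos c by (simp add: powr_divide)
  ultimately show ?thesis using L unfolding eq by (simp add: pos_divide_le_eq mult.commute)
qed

text \<open>On paths that never stop, the root of the martingale stays above a positive level at all
  times, while its expectation decays exponentially.\<close>

lemma hit_down_almost_surely:
  assumes \<tau>: "stopping_time F \<tau>" and c: "0 < c"
    and above: "AE \<omega> in M. \<tau> \<omega> = \<top> \<longrightarrow> (\<forall>t\<ge>0. c \<le> X t \<omega>)"
  shows "AE \<omega> in M. \<tau> \<omega> < \<top>"
proof -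
  let ?b = "\<beta> * \<sigma>"
  define L where "L = sqrt ((c / p) powr \<beta>)"
  have L: "0 < L" using c p_pos by (simp add: L_def)
  have [measurable]: "\<tau> \<in> borel_measurable M" by (rule stopping_time_measurable[OF \<tau>])
  let ?A = "{\<omega> \<in> space M. \<not> \<tau> \<omega> < \<top>}"
  have A: "?A \<in> sets M" by measurable
  have main: "prob ?A \<le> exp (- ?b\<^sup>2 * T / 8) / L" if T: "0 \<le> T" for T
  proof -
    note sq = expectation_sqrt_expm[OF T, of ?b]
    have "L * prob ?A = expectation (\<lambda>\<omega>. L * indicator ?A \<omega>)" using A by simp
    also have "\<dots> \<le> expectation (\<lambda>\<omega>. sqrt (expm ?b T \<omega>))"
    proof (rule integral_mono_AE)
      show "integrable M (\<lambda>\<omega>. L * indicator ?A \<omega>)"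
        using A by (intro integrable_mult_right integrable_real_indicator) (auto simp: less_top[symmetric])
      show "AE \<omega> in M. L * indicator ?A \<omega> \<le> sqrt (expm ?b T \<omega>)"
        using AE_nice above
      proof eventually_elim
        case (elim \<omega>)
        show ?case
        proof (cases "\<tau> \<omega> < \<top>")
          case True
          then show ?thesis using expm_pos by (simp add: less_imp_le)
        next
          case False
          then have "c \<le> X T \<omega>" using elim(2) T by (auto simp: top.not_eq_extremum)
          then have "c powr \<beta> \<le> X T \<omega> powr \<beta>" using c \<beta>_pos by (intro powr_mono2) auto
          also have "\<dots> = p powr \<beta> * expm ?b T \<omega>" using elim(1) T by (simp add: nice_def)
          finally have "(c / p) powr \<beta> \<le> expm ?b T \<omega>"
            using p_pos c by (simp add: powr_divide field_simps)
          then have "L \<le> sqrt (expm ?b T \<omega>)" by (simp add: L_def)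
          then show ?thesis using expm_pos[of ?b T \<omega>] by (auto simp: indicator_def less_imp_le)
        qed
      qed
    qed (rule sq(1))
    finally show ?thesis unfolding sq(2) using L by (simp add: field_simps)
  qed
  have "(\<lambda>k. exp (- ?b\<^sup>2 * real (Suc k) / 8) / L) \<longlonglongrightarrow> 0 / L"
    using L by (intro tendsto_intros exp_decay exponent_nonzero) auto
  then have "prob ?A \<le> 0 / L"
    by (rule LIMSEQ_le_const) (use main in \<open>auto simp del: of_nat_Suc\<close>)
  then have "prob ?A = 0" by (simp add: antisym)
  then show ?thesis using A by (subst (asm) prob_eq_0) (auto elim!: AE_mp)
qed

end

section \<open>First hitting times of closed sets\<close>

lemma first_time_cases:
  fixes X :: "real \<Rightarrow> 'a \<Rightarrow> real"
  assumes cont: "continuous_on {0..} (\<lambda>t. X t \<omega>)" and A: "closed A"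
  obtains (never) "first_time X A \<omega> = \<top>" "\<And>t. 0 \<le> t \<Longrightarrow> X t \<omega> \<notin> A"
    | (hit) r where "0 \<le> r" "first_time X A \<omega> = ennreal r" "X r \<omega> \<in> A" "\<And>t. 0 \<le> t \<Longrightarrow> t < r \<Longrightarrow> X t \<omega> \<notin> A"
proof (cases "{t. 0 \<le> t \<and> X t \<omega> \<in> A} = {}")
  case True
  then have "first_time X A \<omega> = \<top>" unfolding first_time_def by simp
  then show ?thesis using never True by blast
next
  case False
  let ?H = "{t. 0 \<le> t \<and> X t \<omega> \<in> A}"
  have "closed ({0..} \<inter> (\<lambda>t. X t \<omega>) -` A)"
    by (rule continuous_closed_preimage[OF cont closed_atLeast A])
  then have cl: "closed ?H" by (simp add: vimage_def Int_def)
  have bdd: "bdd_below ?H" by (rule bdd_belowI[of _ 0]) auto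
  have mem: "Inf ?H \<in> ?H" by (rule closed_contains_Inf[OF False bdd cl])
  have "first_time X A \<omega> = ennreal (Inf ?H)"
    unfolding first_time_def
  proof (rule antisym)
    show "(INF t\<in>?H. ennreal t) \<le> ennreal (Inf ?H)" by (rule INF_lower[OF mem])
    show "ennreal (Inf ?H) \<le> (INF t\<in>?H. ennreal t)"
      by (intro INF_greatest ennreal_leI cInf_lower bdd) auto
  qed
  moreover have "X t \<omega> \<notin> A" if "0 \<le> t" "t < Inf ?H" for t
    using cInf_lower[of t ?H] bdd that by auto
  ultimately show ?thesis using hit[of "Inf ?H"] mem by auto
qed

lemma first_time_le_iff:
  fixes X :: "real \<Rightarrow> 'a \<Rightarrow> real"
  assumes cont: "continuous_on {0..} (\<lambda>t. X t \<omega>)" and A: "closed A" and t: "0 \<le> t"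
  shows "first_time X A \<omega> \<le> ennreal t \<longleftrightarrow> (\<exists>s\<in>{0..t}. X s \<omega> \<in> A)"
proof
  assume "\<exists>s\<in>{0..t}. X s \<omega> \<in> A"
  then obtain s where s: "0 \<le> s" "s \<le> t" "X s \<omega> \<in> A" by auto
  have "first_time X A \<omega> \<le> ennreal s"
    unfolding first_time_def by (rule INF_lower) (use s in auto)
  also have "\<dots> \<le> ennreal t" using s by (simp add: ennreal_leI)
  finally show "first_time X A \<omega> \<le> ennreal t" .
next
  assume le: "first_time X A \<omega> \<le> ennreal t"
  show "\<exists>s\<in>{0..t}. X s \<omega> \<in> A"
  proof (cases rule: first_time_cases[where X=X, OF cont A])
    case 1
    then show ?thesis using le by (simp add: top_unique)
  next
    case (2 r)
    then show ?thesis using le t by (auto simp: ennreal_le_iff)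
  qed
qed

text \<open>The distance to \<open>A\<close> is continuous along the path and attains its minimum on
  \<open>[0, t]\<close>; the path meets \<open>A\<close> exactly when this minimum is zero, and
  rational fractions of \<open>t\<close> suffice to approximate it. The right side involves
  countably many times, none later than \<open>t\<close>, which places the event in the past at
  \<open>t\<close>.\<close>

lemma hits_closed_iff_rational:
  fixes f :: "real \<Rightarrow> real"
  assumes f: "continuous_on {0..t} f" and A: "closed A" "A \<noteq> {}" and t: "0 \<le> t"
  shows "(\<exists>s\<in>{0..t}. f s \<in> A) \<longleftrightarrow> (\<forall>k::nat. \<exists>q\<in>\<rat> \<inter> {0..1}. infdist (f (t * q)) A < 1 / real (Suc k))"
proof
  have g: "continuous_on {0..t} (\<lambda>s. infdist (f s) A)" by (intro continuous_intros f)
  {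
    assume "\<exists>s\<in>{0..t}. f s \<in> A"
    then obtain s where s: "s \<in> {0..t}" "f s \<in> A" by auto
    show "\<forall>k::nat. \<exists>q\<in>\<rat> \<inter> {0..1}. infdist (f (t * q)) A < 1 / real (Suc k)"
    proof
      fix k :: nat
      have zero: "infdist (f s) A = 0" using s(2) by simp
      show "\<exists>q\<in>\<rat> \<inter> {0..1}. infdist (f (t * q)) A < 1 / real (Suc k)"
      proof (cases "t = 0")
        case True
        then show ?thesis using zero s(1) by (intro bexI[of _ 0]) auto
      next
        case False
        then have t0: "0 < t" using t by simp
        obtain d where d: "0 < d" "\<And>x. x \<in> {0..t} \<Longrightarrow> dist x s < d \<Longrightarrow> dist (infdist (f x) A) (infdist (f s) A) < 1 / real (Suc k)"
        proof -
          have "0 < 1 / real (Suc k)" by simp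
          then show ?thesis using g s(1) that unfolding continuous_on_iff by blast
        qed
        \<comment> \<open>The rational fraction must stay in the unit interval; at the right end the
          fraction one itself is taken.\<close>
        have "\<exists>q\<in>\<rat>. 0 \<le> q \<and> q \<le> 1 \<and> \<bar>q - s / t\<bar> < d / t"
        proof (cases "s / t < 1")
          case True
          have "s / t < min 1 (s / t + d / t)" using True d(1) t0 by simp
          then obtain q where "q \<in> \<rat>" "s / t < q" "q < min 1 (s / t + d / t)" using Rats_dense_in_real by blast
          then show ?thesis using s(1) t0 by (intro bexI[of _ q]) (auto simp: abs_if intro: order_trans[of 0 "s / t"])
        next
          case False
          then have "s / t = 1" using s(1) t0 by (simp add: field_simps)
          then show ?thesis using d(1) t0 by (intro bexI[of _ 1]) auto
        qed
        then obtain q where q: "q \<in> \<rat>" "0 \<le> q" "q \<le> 1" "\<bar>q - s / t\<bar> < d / t" by blast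
        have "\<bar>t * q - s\<bar> = t * \<bar>q - s / t\<bar>" 
        proof -
          have "t * q - s = t * (q - s / t)" using t0 by (simp add: right_diff_distrib)
          then show ?thesis using t0 by (simp only: abs_mult abs_of_pos)
        qed
        also have "\<dots> < d" using q(4) t0 by (simp add: field_simps)
        finally have "dist (t * q) s < d" by (simp add: dist_real_def)
        moreover have "t * q \<in> {0..t}" using q t0 by (auto intro: mult_left_le)
        ultimately have "dist (infdist (f (t * q)) A) (infdist (f s) A) < 1 / real (Suc k)" by (intro d(2))
        then have "infdist (f (t * q)) A < 1 / real (Suc k)"
          using zero infdist_nonneg[of "f (t * q)" A] by (simp add: dist_real_def del: of_nat_Suc)
        then show ?thesis using q by auto
      qed
    qed
  next
    assume *: "\<forall>k::nat. \<exists>q\<in>\<rat> \<inter> {0..1}. infdist (f (t * q)) A < 1 / real (Suc k)"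
    obtain s where s: "s \<in> {0..t}" "\<And>x. x \<in> {0..t} \<Longrightarrow> infdist (f s) A \<le> infdist (f x) A"
      using continuous_attains_inf[OF compact_Icc _ g] t by auto
    have "infdist (f s) A \<le> 1 / real (Suc k)" for k
    proof -
      obtain q where q: "q \<in> \<rat> \<inter> {0..1}" "infdist (f (t * q)) A < 1 / real (Suc k)" using * by blast
      have "t * q \<in> {0..t}" using q(1) t by (auto intro: mult_left_le)
      from s(2)[OF this] q(2) show ?thesis by simp
    qed
    moreover have "(\<lambda>k. 1 / real (Suc k)) \<longlonglongrightarrow> 0" by real_asymp
    ultimately have "infdist (f s) A \<le> 0" by (intro LIMSEQ_le_const) auto
    then have "f s \<in> A" using in_closed_iff_infdist_zero[OF A] infdist_nonneg[of "f s" A] by simp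
    then show "\<exists>s\<in>{0..t}. f s \<in> A" using s(1) by blast
  }
qed

context brownian begin

text \<open>The usual conditions put all null sets into every sigma-algebra of the filtration, and
  completeness adds their subsets.\<close>

lemma pred_F_AE_eq:
  assumes P: "Measurable.pred (F u) P" and eq: "AE \<omega> in M. P \<omega> \<longleftrightarrow> Q \<omega>"
  shows "Measurable.pred (F u) Q"
proof -
  interpret complete_measure M by (rule complete_M)
  let ?E = "{\<omega> \<in> space M. P \<omega>}" and ?S = "{\<omega> \<in> space M. Q \<omega>}"
  have E: "?E \<in> sets (F u)" using P by (simp add: pred_def)
  obtain N where N1: "{\<omega> \<in> space M. \<not> (P \<omega> \<longleftrightarrow> Q \<omega>)} \<subseteq> N" and N2: "emeasure M N = 0" "N \<in> sets M"
    by (rule AE_E[OF eq])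
  have N: "N \<in> null_sets M" by (rule null_setsI[OF N2])
  have null_F: "N' \<in> sets (F u)" if "N' \<subseteq> N" for N'
  proof -
    have "null_sets M \<subseteq> sets (F 0)" using usual unfolding usual_conditions_def by (elim conjE)
    then show ?thesis using complete2[OF that N] subsetD[OF sets_F_mono[of 0 u]] by (auto dest: subsetD)
  qed
  have "\<omega> \<in> ?S \<longleftrightarrow> \<omega> \<in> (?E - N) \<union> (?S \<inter> N)" for \<omega>
    using N1 by auto
  then have S_eq: "?S = (?E - N) \<union> (?S \<inter> N)" by (rule set_eqI)
  have "(?E - N) \<union> (?S \<inter> N) \<in> sets (F u)"
    by (rule sets.Un[OF sets.Diff[OF E null_F[OF order_refl]] null_F[OF Int_lower2]])
  then have "?S \<in> sets (F u)" by (rule back_subst[OF _ S_eq[symmetric]])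
  then show ?thesis by (simp add: pred_def)
qed

end

context gbm begin

text \<open>The description by countably many times is valid along continuous paths, hence almost
  surely; the exceptional paths form a null set known at time zero.\<close>

lemma first_time_stopping_time:
  assumes A: "closed A" "A \<noteq> {}"
  shows "stopping_time F (first_time X A)"
proof
  fix u :: ennreal
  show "Measurable.pred (F u) (\<lambda>\<omega>. first_time X A \<omega> \<le> u)"
  proof (cases u)
    case top
    then show ?thesis by simp
  next
    case (real t)
    let ?P = "\<lambda>\<omega>. \<forall>k::nat. \<exists>q\<in>\<rat> \<inter> {0..1}. infdist (X (t * q) \<omega>) A < 1 / real (Suc k)"
    let ?E = "{\<omega> \<in> space M. ?P \<omega>}" and ?S = "{\<omega> \<in> space M. first_time X A \<omega> \<le> u}"
    have pt: "{\<omega> \<in> space M. infdist (X (t * q) \<omega>) A < 1 / real (Suc k)} \<in> sets (F u)" if "q \<in> {0..1}" for q k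
    proof -
      have "t * q \<le> t" "0 \<le> t * q" using that real(1) by (auto intro: mult_left_le)
      then have [measurable]: "X (t * q) \<in> borel_measurable (F u)"
        using X_adapted[of "t * q" t] real(2) by simp
      have [measurable]: "(\<lambda>x. infdist x A) \<in> borel_measurable borel"
        by (intro borel_measurable_continuous_onI continuous_intros)
      have "{\<omega> \<in> space (F u). infdist (X (t * q) \<omega>) A < 1 / real (Suc k)} \<in> sets (F u)" by measurable
      then show ?thesis by simp
    qed
    have "(\<Union>q\<in>\<rat> \<inter> {0..1}. {\<omega> \<in> space M. infdist (X (t * q) \<omega>) A < 1 / real (Suc k)}) \<in> sets (F u)" for k
      by (intro sets.countable_UN') (auto simp: countable_Int1 countable_rat simp del: of_nat_Suc intro!: pt)
    then have "(\<Inter>k. \<Union>q\<in>\<rat> \<inter> {0..1}. {\<omega> \<in> space M. infdist (X (t * q) \<omega>) A < 1 / real (Suc k)}) \<in> sets (F u)"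
      by (intro sets.countable_INT) auto
    also have "(\<Inter>k. \<Union>q\<in>\<rat> \<inter> {0..1}. {\<omega> \<in> space M. infdist (X (t * q) \<omega>) A < 1 / real (Suc k)}) = ?E"
      by (auto simp del: of_nat_Suc)
    finally have E: "?E \<in> sets (F u)" .
    have ae: "AE \<omega> in M. ?P \<omega> \<longleftrightarrow> first_time X A \<omega> \<le> u"
      using X_continuous
    proof eventually_elim
      case (elim \<omega>)
      have "continuous_on {0..t} (\<lambda>s. X s \<omega>)" by (rule continuous_on_subset[OF elim]) auto
      from hits_closed_iff_rational[OF this A real(1)] first_time_le_iff[where X=X, OF elim A(1) real(1)] real(2)
      show ?case by (simp only:)
    qed
    show ?thesis by (rule pred_F_AE_eq[OF _ ae]) (use E in \<open>simp add: pred_def\<close>)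
  qed
qed

end

context gbm_power begin

lemma AE_first_time_immediate:
  assumes "p \<in> A"
  shows "AE \<omega> in M. price_at X (first_time X A) \<omega> = p"
  using AE_nice
proof eventually_elim
  case (elim \<omega>)
  have "first_time X A \<omega> \<le> ennreal 0"
    unfolding first_time_def by (rule INF_lower) (use elim assms in \<open>auto simp: nice_def\<close>)
  then show ?case using elim by (simp add: price_at_def nice_def)
qed

text \<open>By the intermediate value theorem a path started below \<open>a\<close> passes through
  \<open>a\<close>, a point of \<open>A\<close>, before it can exceed \<open>a\<close>. So the price
  is at most \<open>a\<close> up to the hitting time and equal to \<open>a\<close> there.\<close>

lemma first_time_from_below:
  assumes A: "closed A" "a \<in> A" "A \<subseteq> {a..}" and pa: "p < a"
  shows "AE \<omega> in M. price_at X (first_time X A) \<omega> = (if first_time X A \<omega> < \<top> then a else 0)"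
    "(p / a) powr \<beta> \<le> prob {\<omega> \<in> space M. first_time X A \<omega> < \<top>}"
proof -
  let ?\<tau> = "first_time X A"
  have \<tau>: "stopping_time F ?\<tau>" using A by (intro first_time_stopping_time) auto
  have below: "X t \<omega> \<le> a" if \<omega>: "nice \<omega>" and t: "0 \<le> t" "ennreal t \<le> ?\<tau> \<omega>" for \<omega> t
  proof (rule ccontr)
    assume "\<not> X t \<omega> \<le> a"
    moreover have c: "continuous_on {0..} (\<lambda>t. X t \<omega>)" and X0: "X 0 \<omega> = p" using \<omega> by (auto simp: nice_def)
    ultimately obtain s where s: "0 \<le> s" "s \<le> t" "X s \<omega> = a"
      using IVT'[of "\<lambda>t. X t \<omega>" 0 a t] t(1) pa continuous_on_subset[OF c, of "{0..t}"] by auto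
    with \<open>\<not> X t \<omega> \<le> a\<close> have "s < t" by (cases "s = t") auto
    have "?\<tau> \<omega> \<le> ennreal s" unfolding first_time_def by (rule INF_lower) (use s A in auto)
    with t(2) have "ennreal t \<le> ennreal s" by simp
    then show False using \<open>s < t\<close> s(1) by (simp add: ennreal_le_iff)
  qed
  show "AE \<omega> in M. price_at X ?\<tau> \<omega> = (if ?\<tau> \<omega> < \<top> then a else 0)"
    using AE_nice
  proof eventually_elim
    case (elim \<omega>)
    then have c: "continuous_on {0..} (\<lambda>t. X t \<omega>)" by (simp add: nice_def)
    show ?case
    proof (cases rule: first_time_cases[where X=X, OF c A(1)])
      case 1
      then show ?thesis by (simp add: price_at_def)
    next
      case (2 r)
      have "X r \<omega> \<le> a" using below[OF elim 2(1)] 2(2) by simp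
      then have "X r \<omega> = a" using 2(3) A(3) by auto
      then show ?thesis using 2(1,2) by (simp add: price_at_def)
    qed
  qed
  show "(p / a) powr \<beta> \<le> prob {\<omega> \<in> space M. ?\<tau> \<omega> < \<top>}"
    by (rule hit_up_probability[OF \<tau> pa]) (use AE_nice below in \<open>auto elim!: eventually_mono\<close>)
qed

text \<open>The mirror image of the approach from below, except that the hitting time is now finite
  almost surely.\<close>

lemma first_time_from_above:
  assumes A: "closed A" "a \<in> A" "A \<subseteq> {..a}" and a: "0 < a" "a < p"
  shows "AE \<omega> in M. price_at X (first_time X A) \<omega> = a"
proof -
  let ?\<tau> = "first_time X A"
  have \<tau>: "stopping_time F ?\<tau>" using A by (intro first_time_stopping_time) auto
  have above: "a \<le> X t \<omega>" if \<omega>: "nice \<omega>" and t: "0 \<le> t" "ennreal t \<le> ?\<tau> \<omega>" for \<omega> t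
  proof (rule ccontr)
    assume "\<not> a \<le> X t \<omega>"
    moreover have c: "continuous_on {0..} (\<lambda>t. X t \<omega>)" and X0: "X 0 \<omega> = p" using \<omega> by (auto simp: nice_def)
    ultimately obtain s where s: "0 \<le> s" "s \<le> t" "X s \<omega> = a"
      using IVT2'[of "\<lambda>t. X t \<omega>" t a 0] t(1) a continuous_on_subset[OF c, of "{0..t}"] by auto
    with \<open>\<not> a \<le> X t \<omega>\<close> have "s < t" by (cases "s = t") auto
    have "?\<tau> \<omega> \<le> ennreal s" unfolding first_time_def by (rule INF_lower) (use s A in auto)
    with t(2) have "ennreal t \<le> ennreal s" by simp
    then show False using \<open>s < t\<close> s(1) by (simp add: ennreal_le_iff)
  qed
  have "AE \<omega> in M. ?\<tau> \<omega> < \<top>"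
    by (rule hit_down_almost_surely[OF \<tau> a(1)]) (use AE_nice above in \<open>auto elim!: eventually_mono\<close>)
  with AE_nice show ?thesis
  proof eventually_elim
    case (elim \<omega>)
    then have c: "continuous_on {0..} (\<lambda>t. X t \<omega>)" by (simp add: nice_def)
    show ?case
    proof (cases rule: first_time_cases[where X=X, OF c A(1)])
      case 1
      then show ?thesis using elim by simp
    next
      case (2 r)
      have "a \<le> X r \<omega>" using above[OF elim(1) 2(1)] 2(2) by simp
      then have "X r \<omega> = a" using 2(3) A(3) by auto
      then show ?thesis using 2(1,2) by (simp add: price_at_def)
    qed
  qed
qed

end


section \<open>The rescaled payoff\<close>

text \<open>Young's inequality for \<open>y / x\<close> and \<open>1\<close>, multiplied by
  \<open>x powr b\<close>.\<close>

lemma powr_tangent: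
  fixes x y b :: real
  assumes "0 < x" "0 < y" "0 < b" "b < 1"
  shows "y powr b \<le> x powr b + b * x powr (b - 1) * (y - x)"
proof -
  have "(y / x) powr b * 1 powr (1 - b) \<le> b * (y / x) + (1 - b) * 1"
    using Youngs_inequality_0[of b "1 - b" "y / x" 1] assms by simp
  then have "x powr b * (y / x) powr b \<le> x powr b * (b * (y / x) + (1 - b))"
    by (intro mult_left_mono) auto
  moreover have "x powr b * (y / x) powr b = y powr b"
    using assms by (simp add: powr_divide)
  moreover have "x powr b * (b * (y / x) + (1 - b)) = x powr b + b * (x powr b / x) * (y - x)"
    using assms by (simp add: field_simps)
  moreover have "x powr b / x = x powr (b - 1)" using assms by (simp add: powr_diff)
  ultimately show ?thesis by simp
qed

locale entry_params =
  fixes \<alpha> \<beta> k c \<gamma> lam :: real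
  assumes \<alpha>: "0 < \<alpha>" "\<alpha> < 1" and \<alpha>\<beta>: "\<alpha> \<le> \<beta>" and \<beta>: "\<beta> < 1" and k: "1 < k" and c: "1 < c"
    and lam: "1 \<le> lam" and \<gamma>: "0 < \<gamma>" "\<gamma> \<le> 1"
    and c_eq: "\<alpha> / \<beta> * c * (c - 1) powr (\<alpha> - 1) - (c - 1) powr \<alpha> - k = 0"
begin

definition "A = lam / \<gamma>"
definition "K' = c powr (1 - \<beta>) * (c - 1) powr (\<alpha> - 1)"
definition "K = \<alpha> / \<beta> * c powr (1 - \<beta>) * (c - 1) powr (\<alpha> - 1)"
definition "a = \<alpha> / \<beta>"
definition "m = \<beta> - \<alpha>"

lemma \<beta>_pos: "0 < \<beta>" using \<alpha> \<alpha>\<beta> by simp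
lemma A_pos: "0 < A" using lam \<gamma> by (simp add: A_def)
lemma K'_pos: "0 < K'" using c by (simp add: K'_def)
lemma a_bounds: "0 < a" "a \<le> 1" using \<alpha> \<alpha>\<beta> by (auto simp: a_def)
lemma K_eq: "K = a * K'" by (simp add: K_def K'_def a_def)
lemma K_pos: "0 < K" using K_eq K'_pos a_bounds by simp
lemma m_bounds: "0 \<le> m" "m < 1" using \<alpha> \<alpha>\<beta> \<beta> by (auto simp: m_def)
lemma m_eq: "m = \<beta> * (1 - a)" using \<beta>_pos by (simp add: m_def a_def field_simps)

lemma affine_pos: "0 \<le> y \<Longrightarrow> 0 < 1 + A * y" "0 \<le> y \<Longrightarrow> 1 \<le> 1 + A * y"
  using A_pos by (auto intro: add_pos_nonneg)

lemma affine_powr_pos: "0 < 1 + A * x powr r"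
  by (rule affine_pos) simp

definition f :: "real \<Rightarrow> real" where
  "f x = K * x * (1 + A * x powr (1 / \<beta>)) powr (- m) - k * (1 + A * x powr (1 / \<beta>)) powr \<alpha>"

text \<open>The derivative of \<^term>\<open>f\<close> at \<open>x = y\<^sup>\<beta>\<close> as a function of \<open>y\<close>, the natural variable.\<close>
definition fy :: "real \<Rightarrow> real" where
  "fy y = K * (1 + a * A * y) * (1 + A * y) powr (- m - 1)
     - k * a * A * y powr (1 - \<beta>) * (1 + A * y) powr (\<alpha> - 1)"

definition fd :: "real \<Rightarrow> real" where
  "fd x = fy (x powr (1 / \<beta>))"

text \<open>The intercept at zero of the tangent to \<open>f\<close> at \<open>x\<close>.\<close>

definition I :: "real \<Rightarrow> real" where
  "I x = f x - x * fd x"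

lemma scaled_payoff_f_eq: "scaled_payoff_f \<alpha> \<beta> k c \<gamma> lam x = f x"
proof -
  let ?s = "1 + A * x powr (1 / \<beta>)"
  have s: "0 < ?s" by (rule affine_powr_pos)
  have "f x = (K * x - k * ?s powr \<beta>) * ?s powr (- m)"
    using s by (simp add: f_def left_diff_distrib m_def flip: powr_add)
  also have "\<dots> = (K * x - k * ?s powr \<beta>) / ?s powr (\<beta> - \<alpha>)"
    unfolding m_def powr_minus_divide by simp
  finally show ?thesis by (simp add: scaled_payoff_f_def K_def A_def add.commute)
qed

lemma f_0: "f 0 = - k" by (simp add: f_def)

lemma fd_0: "fd 0 = K" by (simp add: fd_def fy_def)

lemma f_continuous: "continuous_on {0..} f"
  unfolding f_def[abs_def]
  by (intro continuous_intros continuous_on_powr') (use affine_powr_pos \<beta>_pos in \<open>auto simp: less_imp_neq[symmetric] less_imp_le\<close>)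

lemma f_deriv:
  assumes x: "0 < x"
  shows "DERIV f x :> fd x"
proof -
  define y where "y = x powr (1 / \<beta>)"
  define s where "s = 1 + A * y"
  have y: "0 < y" using x by (simp add: y_def)
  have s: "0 < s" unfolding s_def using y by (intro affine_pos) simp
  have yx: "x powr (1 / \<beta> - 1) * x = y" using x by (simp add: y_def powr_diff)
  have yb: "x powr (1 / \<beta> - 1) = y powr (1 - \<beta>)"
    using \<beta>_pos by (simp add: y_def powr_powr field_simps)
  have dg: "((\<lambda>x. 1 + A * x powr (1 / \<beta>)) has_real_derivative A * (1 / \<beta> * x powr (1 / \<beta> - 1))) (at x)"
    using x by (auto intro!: derivative_eq_intros)
  have dp: "((\<lambda>x. (1 + A * x powr (1 / \<beta>)) powr r) has_real_derivative
      r * s powr (r - 1) * (A * (1 / \<beta> * x powr (1 / \<beta> - 1)))) (at x)" for r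
    using DERIV_chain2[OF has_real_derivative_powr dg, of r] s by (simp add: s_def y_def)
  have "DERIV f x :> (K * s powr (- m) + K * x * (- m * s powr (- m - 1) * (A * (1 / \<beta> * x powr (1 / \<beta> - 1)))))
      - k * (\<alpha> * s powr (\<alpha> - 1) * (A * (1 / \<beta> * x powr (1 / \<beta> - 1))))"
    unfolding f_def[abs_def]
    by (rule dp derivative_eq_intros refl)+ (simp add: s_def y_def mult_ac)
  also have "(K * s powr (- m) + K * x * (- m * s powr (- m - 1) * (A * (1 / \<beta> * x powr (1 / \<beta> - 1)))))
      - k * (\<alpha> * s powr (\<alpha> - 1) * (A * (1 / \<beta> * x powr (1 / \<beta> - 1)))) = fd x"
  proof -
    have "s powr (- m) = s * s powr (- m - 1)" using s by (simp add: powr_diff)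
    then have "K * s powr (- m) + K * x * (- m * s powr (- m - 1) * (A * (1 / \<beta> * x powr (1 / \<beta> - 1))))
      = K * s powr (- m - 1) * (s - m / \<beta> * A * (x powr (1 / \<beta> - 1) * x))"
      by (simp add: algebra_simps)
    also have "\<dots> = K * s powr (- m - 1) * (1 + a * A * y)"
    proof -
      have "m / \<beta> = 1 - a" using \<beta>_pos by (simp add: m_eq)
      then show ?thesis unfolding yx \<open>m / \<beta> = 1 - a\<close> s_def by (simp add: algebra_simps)
    qed
    finally show ?thesis
      unfolding fd_def fy_def y_def[symmetric] s_def[symmetric] yb a_def
      by (simp add: mult_ac)
  qed
  finally show ?thesis .
qed

lemma fy_deriv:
  assumes y: "0 < y"
  defines "q \<equiv> k * a * y powr (- \<beta>) * (1 + A * y) powr \<beta>"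
  shows "DERIV fy y :> A * (1 + A * y) powr (- m - 2) *
    (- K * ((1 - a) + m + a * m * (A * y)) - q * ((1 - \<beta>) - m * (A * y)))"
proof -
  define s where "s = 1 + A * y"
  have s: "0 < s" unfolding s_def using y by (intro affine_pos) simp
  have ds: "((\<lambda>y. 1 + A * y) has_real_derivative A) (at y)" by (auto intro!: derivative_eq_intros)
  have dp: "((\<lambda>y. (1 + A * y) powr r) has_real_derivative r * s powr (r - 1) * A) (at y)" for r
    using DERIV_chain2[OF has_real_derivative_powr ds, of r] s by (simp add: s_def)
  have dy: "((\<lambda>y. y powr (1 - \<beta>)) has_real_derivative (1 - \<beta>) * y powr (- \<beta>)) (at y)"
    using has_real_derivative_powr[OF y, of "1 - \<beta>"] by simp
  have D: "DERIV fy y :>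
      (K * (a * A) * s powr (- m - 1) + K * (1 + a * A * y) * ((- m - 1) * s powr (- m - 2) * A))
      - k * a * A * ((1 - \<beta>) * y powr (- \<beta>) * s powr (\<alpha> - 1) + y powr (1 - \<beta>) * ((\<alpha> - 1) * s powr (\<alpha> - 2) * A))"
    unfolding fy_def[abs_def]
    by (rule derivative_eq_intros dp dy refl)+ (simp add: s_def algebra_simps)
  have e1: "s powr (- m - 1) = s * s powr (- m - 2)" using s by (simp add: powr_diff power2_eq_square)
  have e2: "s powr (\<alpha> - 1) = s powr (- m - 2) * s powr \<beta> * s"
    using s by (simp add: m_def powr_diff power2_eq_square powr_add powr_minus field_simps)
  have e3: "s powr (\<alpha> - 2) = s powr (- m - 2) * s powr \<beta>"
    using s by (simp add: m_def powr_diff power2_eq_square powr_add powr_minus field_simps)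
  have e4: "y powr (1 - \<beta>) = y powr (- \<beta>) * y" using y by (simp add: powr_diff powr_minus field_simps)
  have "(K * (a * A) * s powr (- m - 1) + K * (1 + a * A * y) * ((- m - 1) * s powr (- m - 2) * A))
      - k * a * A * ((1 - \<beta>) * y powr (- \<beta>) * s powr (\<alpha> - 1) + y powr (1 - \<beta>) * ((\<alpha> - 1) * s powr (\<alpha> - 2) * A))
    = A * s powr (- m - 2) * (K * (a * s - (1 + a * A * y) * (m + 1))
        - q * ((1 - \<beta>) * s - (1 - \<alpha>) * (A * y)))"
    unfolding e1 e2 e3 e4 q_def s_def[symmetric] by (simp add: algebra_simps)
  also have "K * (a * s - (1 + a * A * y) * (m + 1)) = - K * ((1 - a) + m + a * m * (A * y))"
    unfolding s_def by (simp add: algebra_simps)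
  also have "(1 - \<beta>) * s - (1 - \<alpha>) * (A * y) = (1 - \<beta>) - m * (A * y)"
    unfolding s_def m_def by (simp add: algebra_simps)
  finally show ?thesis using D unfolding s_def by simp
qed

text \<open>Nonnegativity of \<open>fy\<close> bounds \<open>q * s\<close> by
  \<open>K * (1 + a * s)\<close>, where \<open>s = A * y\<close>. The derivative is in doubt only
  when \<open>m * s\<close> is at least \<open>1 - \<beta>\<close>; inserting the bound there
  cancels the terms in \<open>m\<close> and leaves a negative remainder.\<close>

lemma fy_decreasing_where_nonneg:
  assumes y: "0 < y" and nonneg: "0 \<le> fy y"
  shows "\<exists>D. DERIV fy y :> D \<and> D < 0"
proof -
  define q where "q = k * a * y powr (- \<beta>) * (1 + A * y) powr \<beta>"
  define s where "s = A * y"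
  have s: "0 < s" using y A_pos by (simp add: s_def)
  have pos: "0 < 1 + A * y" using y by (intro affine_pos) simp
  have q: "0 < q" using k a_bounds y pos by (simp add: q_def)
  have fy_eq: "fy y = (1 + A * y) powr (- m - 1) * (K * (1 + a * s) - q * s)"
  proof -
    have "(1 + A * y) powr (\<alpha> - 1) = (1 + A * y) powr (- m - 1) * (1 + A * y) powr \<beta>"
      by (simp add: m_def flip: powr_add)
    moreover have "y powr (1 - \<beta>) = y powr (- \<beta>) * y" using y by (simp add: powr_diff powr_minus field_simps)
    ultimately show ?thesis unfolding fy_def q_def s_def by (simp add: algebra_simps)
  qed
  have qs: "q * s \<le> K * (1 + a * s)"
  proof -
    have "0 < (1 + A * y) powr (- m - 1)" using pos by simp
    then have "0 \<le> K * (1 + a * s) - q * s" using nonneg unfolding fy_eq by (simp add: zero_le_mult_iff)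
    then show ?thesis by simp
  qed
  have r: "0 \<le> (1 - a) + m + a * m * s" using a_bounds m_bounds s by simp
  have neg: "- K * ((1 - a) + m + a * m * s) - q * ((1 - \<beta>) - m * s) < 0"
  proof (cases "0 < (1 - \<beta>) - m * s")
    case True
    have "0 \<le> K * ((1 - a) + m + a * m * s)" using K_pos r by simp
    moreover have "0 < q * ((1 - \<beta>) - m * s)" using q True by simp
    ultimately show ?thesis by simp
  next
    case False
    then have ms: "1 - \<beta> \<le> m * s" by simp
    have "(- K * ((1 - a) + m + a * m * s) - q * ((1 - \<beta>) - m * s)) * s
        = - K * ((1 - a) + m + a * m * s) * s + (q * s) * (m * s - (1 - \<beta>))"
      by (simp add: algebra_simps)
    also have "\<dots> \<le> - K * ((1 - a) + m + a * m * s) * s + (K * (1 + a * s)) * (m * s - (1 - \<beta>))"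
      using qs ms by (intro add_left_mono mult_right_mono) auto
    also have "\<dots> = - K * ((1 - a) * s + (1 - \<beta>) + a * (1 - \<beta>) * s)"
      by (simp add: algebra_simps)
    also have "\<dots> < 0"
    proof -
      have "0 < (1 - a) * s + (1 - \<beta>) + a * (1 - \<beta>) * s"
        using a_bounds s \<beta> by (intro add_pos_nonneg add_nonneg_pos) auto
      then show ?thesis using K_pos by simp
    qed
    finally show ?thesis using s by (simp add: mult_less_0_iff)
  qed
  have "0 < A * (1 + A * y) powr (- m - 2)" using A_pos pos by simp
  then have "A * (1 + A * y) powr (- m - 2) *
    (- K * ((1 - a) + m + a * m * (A * y)) - q * ((1 - \<beta>) - m * (A * y))) < 0"
    using neg unfolding s_def by (intro mult_pos_neg)
  then show ?thesis using fy_deriv[OF y] unfolding q_def by blast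
qed

text \<open>\<open>[0, b]\<close> lies in the region where \<^term>\<open>f\<close> increases; there it is strictly concave.\<close>
definition increasing_upto :: "real \<Rightarrow> bool" where
  "increasing_upto b \<longleftrightarrow> (\<forall>x. 0 < x \<longrightarrow> x \<le> b \<longrightarrow> 0 \<le> fd x)"

lemma fd_strict_antimono:
  assumes b: "increasing_upto b" and uv: "0 < u" "u < v" "v \<le> b"
  shows "fd v < fd u"
proof -
  have lt: "u powr (1 / \<beta>) < v powr (1 / \<beta>)"
    using uv \<beta>_pos by (intro powr_less_mono2) auto
  show ?thesis unfolding fd_def
  proof (rule DERIV_neg_imp_decreasing[OF lt])
    fix y assume y: "u powr (1 / \<beta>) \<le> y" "y \<le> v powr (1 / \<beta>)"
    have y0: "0 < y" using less_le_trans[OF _ y(1), of 0] uv(1) by simp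
    have "y powr \<beta> \<le> v"
      using powr_mono2[of \<beta> y "v powr (1 / \<beta>)"] y y0 uv \<beta>_pos by (simp add: powr_powr)
    then have "0 \<le> fd (y powr \<beta>)" using b y0 uv unfolding increasing_upto_def by simp
    then have "0 \<le> fy y" using y0 \<beta>_pos by (simp add: fd_def powr_powr)
    then show "\<exists>D. DERIV fy y :> D \<and> D < 0" by (rule fy_decreasing_where_nonneg[OF y0])
  qed
qed

lemma f_mvt:
  assumes "0 \<le> u" "u < v"
  obtains z where "u < z" "z < v" "f v - f u = (v - u) * fd z"
proof -
  have "continuous_on {u..v} f" by (rule continuous_on_subset[OF f_continuous]) (use assms in auto)
  from MVT[OF assms(2) this] obtain l z where z: "u < z" "z < v" "DERIV f z :> l" "f v - f u = (v - u) * l"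
    using f_deriv assms real_differentiable_def by (metis order.strict_trans1)
  moreover have "l = fd z" using DERIV_unique[OF z(3) f_deriv] z(1) assms by simp
  ultimately show ?thesis using that by blast
qed

lemma f_tangent:
  assumes b: "increasing_upto b" and x0: "0 < x0" "x0 \<le> b" and x: "0 \<le> x" "x \<le> b"
  shows "f x \<le> f x0 + fd x0 * (x - x0)"
proof -
  consider "x = x0" | "x < x0" | "x0 < x" by linarith
  then show ?thesis
  proof cases
    case 2
    obtain z where z: "x < z" "z < x0" "f x0 - f x = (x0 - x) * fd z" using f_mvt[OF x(1) 2] by blast
    have "fd x0 < fd z" by (rule fd_strict_antimono[OF b]) (use z x x0 in auto)
    then have "(x0 - x) * fd x0 \<le> (x0 - x) * fd z" using 2 by (intro mult_left_mono) auto
    then show ?thesis using z(3) by (simp add: algebra_simps)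
  next
    case 3
    obtain z where z: "x0 < z" "z < x" "f x - f x0 = (x - x0) * fd z" using f_mvt[OF _ 3] x0 by auto
    have "fd z < fd x0" by (rule fd_strict_antimono[OF b]) (use z x x0 in auto)
    then have "(x - x0) * fd z \<le> (x - x0) * fd x0" using 3 by (intro mult_left_mono) auto
    then show ?thesis using z(3) by (simp add: algebra_simps)
  qed simp
qed

text \<open>The tangent at zero is treated directly, the derivative having been computed for
  positive arguments: powers of a number that is at least one only lower the gain and raise the
  loss.\<close>

lemma f_tangent_0:
  assumes "0 \<le> x"
  shows "f x \<le> f 0 + fd 0 * x"
proof -
  have s: "1 \<le> 1 + A * x powr (1 / \<beta>)" by (rule affine_pos) simp
  have "(1 + A * x powr (1 / \<beta>)) powr (- m) \<le> 1" "1 \<le> (1 + A * x powr (1 / \<beta>)) powr \<alpha>"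
    using s m_bounds \<alpha> ge_one_powr_ge_zero[OF s, of m] ge_one_powr_ge_zero[OF s, of \<alpha>] by (auto simp: powr_minus_divide)
  then have "K * x * (1 + A * x powr (1 / \<beta>)) powr (- m) \<le> K * x * 1" "k * 1 \<le> k * (1 + A * x powr (1 / \<beta>)) powr \<alpha>"
    by (intro mult_left_mono; use K_pos assms k in simp)+
  then show ?thesis unfolding f_0 fd_0 f_def by simp
qed

lemma fd_le_fd_0:
  assumes "0 \<le> x"
  shows "fd x \<le> fd 0"
proof -
  let ?y = "x powr (1 / \<beta>)"
  have s: "1 \<le> 1 + A * ?y" by (rule affine_pos) simp
  have "1 + a * A * ?y \<le> 1 + A * ?y" using a_bounds A_pos by (simp add: mult_right_mono mult_left_le_one_le)
  also have "\<dots> \<le> (1 + A * ?y) powr (m + 1)"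
    using powr_mono[of 1 "m + 1" "1 + A * ?y"] m_bounds s by simp
  finally have "(1 + a * A * ?y) * (1 + A * ?y) powr (- m - 1) \<le> (1 + A * ?y) powr (m + 1) * (1 + A * ?y) powr (- m - 1)"
    by (intro mult_right_mono) auto
  also have "\<dots> = 1" using s by (simp flip: powr_add)
  finally have "K * (1 + a * A * ?y) * (1 + A * ?y) powr (- m - 1) \<le> K"
    using K_pos by (simp add: mult.assoc)
  moreover have "0 \<le> k * a * A * ?y powr (1 - \<beta>) * (1 + A * ?y) powr (\<alpha> - 1)"
    using k a_bounds A_pos by simp
  ultimately show ?thesis unfolding fd_0 unfolding fd_def fy_def by linarith
qed

section \<open>Tangent intercepts and the lower threshold\<close>

lemma I_0: "I 0 = - k" by (simp add: I_def f_0)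

text \<open>With \<open>z\<close> from the mean value theorem, \<open>I v - I u\<close> equals
  \<open>(v - u) * (fd z - fd v) + u * (fd u - fd v)\<close>, and \<open>fd\<close> decreases
  strictly.\<close>

lemma I_strict_mono:
  assumes b: "increasing_upto b" and uv: "0 \<le> u" "u < v" "v \<le> b"
  shows "I u < I v"
proof -
  obtain z where z: "u < z" "z < v" "f v - f u = (v - u) * fd z" using f_mvt[OF uv(1,2)] by blast
  have "fd v < fd z" by (rule fd_strict_antimono[OF b]) (use z uv in auto)
  then have "(v - u) * fd v < (v - u) * fd z" using uv by (intro mult_strict_left_mono) auto
  moreover have "u * fd v \<le> u * fd u"
  proof (cases "u = 0")
    case False
    then show ?thesis using uv fd_strict_antimono[OF b, of u v] by (intro mult_left_mono) auto
  qed simp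
  ultimately show ?thesis unfolding I_def using z(3) by (simp add: algebra_simps)
qed

text \<open>Gives the intercept the shape of the fraction in
  \<open>lower_threshold_eq\<close>.\<close>

lemma I_eq:
  assumes x: "0 \<le> x"
  defines "y \<equiv> x powr (1 / \<beta>)"
  shows "- I x = (k * (1 + A * y) powr \<beta> * (A * (1 - a) * y + 1) - K * A * (1 - a) * (x * y)) / (1 + A * y) powr (m + 1)"
proof (cases "x = 0")
  case True
  then show ?thesis by (simp add: I_0 y_def)
next
  case False
  define s where "s = 1 + A * y"
  have s: "0 < s" unfolding s_def y_def by (rule affine_powr_pos)
  have y: "0 < y" using x False by (simp add: y_def)
  have xy: "x * y powr (1 - \<beta>) = y"
  proof -
    have "x = y powr \<beta>" using x \<beta>_pos by (simp add: y_def powr_powr)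
    then show ?thesis using y by (simp flip: powr_add)
  qed
  have e1: "s powr (- m) = s * s powr (- m - 1)" using s by (simp add: powr_diff)
  have e2: "s powr \<alpha> = s powr \<beta> * s * s powr (- m - 1)"
    using s by (simp add: m_def powr_diff powr_add powr_minus field_simps)
  have e3: "s powr (\<alpha> - 1) = s powr \<beta> * s powr (- m - 1)"
    using s by (simp add: m_def powr_diff powr_add powr_minus field_simps)
  have "- I x = x * (K * (1 + a * A * y) * s powr (- m - 1)) - k * a * A * (x * y powr (1 - \<beta>)) * s powr (\<alpha> - 1)
     - K * x * s powr (- m) + k * s powr \<alpha>"
    unfolding I_def f_def fd_def fy_def y_def[symmetric] s_def[symmetric] by (simp add: algebra_simps)
  also have "\<dots> = (k * s powr \<beta> * (s - a * A * y) - K * x * (s - 1 - a * A * y)) * s powr (- m - 1)"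
    unfolding xy e1 e2 e3 by (simp add: algebra_simps)
  also have "s - a * A * y = A * (1 - a) * y + 1"
    unfolding s_def by (simp add: algebra_simps)
  also have "s - 1 - a * A * y = A * (1 - a) * y"
    unfolding s_def by (simp add: algebra_simps)
  also have "s powr (- m - 1) = 1 / s powr (m + 1)"
    using powr_minus_divide[of s "m + 1"] by simp
  finally show ?thesis unfolding s_def by (simp add: mult_ac)
qed

lemma lower_threshold_eq_iff:
  assumes x: "0 \<le> x" and \<rho>: "\<rho> = (1 + \<Psi> / R) powr \<alpha>" "0 < \<rho>"
  shows "lower_threshold_eq \<alpha> \<beta> k c \<gamma> lam \<Psi> R x \<longleftrightarrow> I x = - (k / \<rho>)"
proof -
  have "x powr (1 / \<beta> + 1) = x * x powr (1 / \<beta>)" using x by (cases "x = 0") (simp_all add: powr_add)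
  then have "K * A * (1 - a) * x powr (1 / \<beta> + 1) = K * A * (1 - a) * (x * x powr (1 / \<beta>))" by simp
  then have "lower_threshold_eq \<alpha> \<beta> k c \<gamma> lam \<Psi> R x \<longleftrightarrow> k = \<rho> * (- I x)"
    unfolding lower_threshold_eq_def I_eq[OF x] \<rho>(1) K_def[symmetric]
    unfolding A_def[symmetric] a_def[symmetric] m_def
    by (simp only: add.commute[of 1])
  also have "\<dots> \<longleftrightarrow> I x = - (k / \<rho>)" 
  proof
    assume "k = \<rho> * (- I x)"
    then have "k / \<rho> = - I x" using \<rho>(2) by (simp add: nonzero_divide_eq_eq mult.commute)
    then show "I x = - (k / \<rho>)" by simp
  qed (use \<rho>(2) in simp)
  finally show ?thesis .
qed

lemma I_continuous: "continuous_on {0..} I"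
proof -
  have ne: "1 + A * x powr r \<noteq> 0" and nn: "0 \<le> 1 + A * x powr r" for x r
    using affine_powr_pos[of x r] by simp_all
  have cy: "continuous_on {0..} (\<lambda>x. x powr (1 / \<beta>))"
    by (rule continuous_on_powr'[OF continuous_on_id continuous_on_const]) (use \<beta>_pos in simp)
  have cz: "continuous_on {0..} (\<lambda>x. (x powr (1 / \<beta>)) powr (1 - \<beta>))"
    by (rule continuous_on_powr'[OF cy continuous_on_const]) (use \<beta> in simp)
  have cl: "continuous_on {0..} (\<lambda>x. 1 + r * x powr (1 / \<beta>))" for r
    by (intro continuous_on_add continuous_on_mult continuous_on_const cy)
  have cs: "continuous_on {0..} (\<lambda>x. (1 + A * x powr (1 / \<beta>)) powr r)" for r
    by (rule continuous_on_powr'[OF cl continuous_on_const]) (simp add: ne nn)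
  have "continuous_on {0..} fd"
    unfolding fd_def[abs_def] fy_def
    by (intro continuous_on_diff continuous_on_mult continuous_on_const cs cz cl)
  then show ?thesis unfolding I_def[abs_def] by (intro continuous_intros f_continuous)
qed

text \<open>At \<open>z = x powr (- 1 / \<beta>)\<close> this is the left side of the upper
  threshold equation; its convexity comes from \<open>\<beta> < 1\<close> in the subtracted
  power.\<close>

definition \<phi> :: "real \<Rightarrow> real" where
  "\<phi> z = K' * (z + a * A) - k * A * (A + z) powr \<beta>"

lemma fy_eq_\<phi>:
  assumes y: "0 < y"
  shows "fy y = (1 + A * y) powr (- m - 1) * (a * y) * \<phi> (1 / y)"
proof -
  have 1: "(1 + A * y) powr (\<alpha> - 1) = (1 + A * y) powr (- m - 1) * (1 + A * y) powr \<beta>"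
    by (simp add: m_def flip: powr_add)
  have "1 + A * y = y * (A + 1 / y)" using y by (simp add: field_simps)
  then have 2: "(1 + A * y) powr \<beta> = y powr \<beta> * (A + 1 / y) powr \<beta>"
    by (simp add: powr_mult)
  have 3: "y powr (1 - \<beta>) * y powr \<beta> = y" using y by (simp flip: powr_add)
  have "fy y = (1 + A * y) powr (- m - 1) * (K * (1 + a * A * y) - k * a * A * (y powr (1 - \<beta>) * y powr \<beta>) * (A + 1 / y) powr \<beta>)"
    unfolding fy_def 1 2 by (simp add: algebra_simps)
  also have "K * (1 + a * A * y) - k * a * A * (y powr (1 - \<beta>) * y powr \<beta>) * (A + 1 / y) powr \<beta> = (a * y) * \<phi> (1 / y)"
    unfolding 3 \<phi>_def K_eq using y by (simp add: field_simps)
  finally show ?thesis by (simp add: mult.assoc)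
qed

lemma fd_eq_\<phi>:
  assumes x: "0 < x"
  shows "\<exists>C>0. fd x = C * \<phi> (x powr (- 1 / \<beta>))"
proof -
  define y where "y = x powr (1 / \<beta>)"
  have y: "0 < y" using x by (simp add: y_def)
  have z: "1 / y = x powr (- 1 / \<beta>)" by (simp add: y_def powr_minus_divide)
  have "0 < (1 + A * y) powr (- m - 1) * (a * y)" using affine_pos(1)[of y] y a_bounds by simp
  then show ?thesis unfolding fd_def y_def[symmetric] fy_eq_\<phi>[OF y] z by blast
qed

lemma upper_threshold_eq_iff:
  "upper_threshold_eq \<alpha> \<beta> k c \<gamma> lam x \<longleftrightarrow> \<phi> (x powr (- 1 / \<beta>)) = 0"
proof -
  have "lam * \<alpha> / (\<gamma> * \<beta>) = a * A" "k * lam / \<gamma> = k * A" by (simp_all add: a_def A_def mult.commute)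
  then show ?thesis unfolding upper_threshold_eq_def \<phi>_def K'_def A_def[symmetric]
    by (simp only: add.commute[of A])
qed

lemma \<phi>_tangent:
  assumes "0 \<le> z" "0 \<le> w"
  shows "\<phi> w + (K' - k * A * \<beta> * (A + w) powr (\<beta> - 1)) * (z - w) \<le> \<phi> z"
proof -
  have "(A + z) powr \<beta> \<le> (A + w) powr \<beta> + \<beta> * (A + w) powr (\<beta> - 1) * (z - w)"
    using powr_tangent[of "A + w" "A + z" \<beta>] A_pos \<beta>_pos \<beta> assms by simp
  then have "k * A * (A + z) powr \<beta> \<le> k * A * ((A + w) powr \<beta> + \<beta> * (A + w) powr (\<beta> - 1) * (z - w))"
    using k A_pos by (intro mult_left_mono) auto
  then show ?thesis unfolding \<phi>_def by (simp add: algebra_simps)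
qed

section \<open>The two regimes of the cost ratio \<open>lam / \<gamma>\<close>\<close>

lemma cheap_iff:
  "lam / \<gamma> \<le> (\<alpha> / (\<beta> * k) * c powr (1 - \<beta>) * (c - 1) powr (\<alpha> - 1)) powr (1 / \<beta>) \<longleftrightarrow> k * A powr \<beta> \<le> K"
proof -
  have e: "\<alpha> / (\<beta> * k) * c powr (1 - \<beta>) * (c - 1) powr (\<alpha> - 1) = K / k" by (simp add: K_def)
  have pos: "0 < K / k" using K_pos k by simp
  have "A \<le> (K / k) powr (1 / \<beta>) \<longleftrightarrow> A powr \<beta> \<le> K / k"
  proof
    assume "A \<le> (K / k) powr (1 / \<beta>)"
    from powr_mono2[OF _ _ this, of \<beta>] show "A powr \<beta> \<le> K / k"
      using A_pos \<beta>_pos pos by (simp add: powr_powr)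
  next
    assume "A powr \<beta> \<le> K / k"
    from powr_mono2[OF _ _ this, of "1 / \<beta>"] show "A \<le> (K / k) powr (1 / \<beta>)"
      using A_pos \<beta>_pos by (simp add: powr_powr)
  qed
  also have "\<dots> \<longleftrightarrow> k * A powr \<beta> \<le> K" using k by (simp add: field_simps)
  finally show ?thesis unfolding e A_def .
qed

text \<open>The value \<open>\<phi> 0 = A * (K - k * A powr \<beta>)\<close> is nonnegative, and so
  is the slope at zero because \<open>\<beta> * K = \<alpha> * K' \<le> K'\<close>; the tangent at
  zero then keeps the convex function nonnegative.\<close>

lemma cheap_increasing:
  assumes cheap: "k * A powr \<beta> \<le> K"
  shows "increasing_upto b"
  unfolding increasing_upto_def
proof (intro allI impI)
  fix x :: real assume x: "0 < x"
  define z where "z = x powr (- 1 / \<beta>)"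
  have z: "0 < z" using x by (simp add: z_def)
  have "k * A * \<beta> * A powr (\<beta> - 1) = \<beta> * (k * A powr \<beta>)" using A_pos by (simp add: powr_diff)
  also have "\<dots> \<le> \<beta> * K" using cheap \<beta>_pos by simp
  also have "\<dots> = \<alpha> * K'" using \<beta>_pos by (simp add: K_eq a_def)
  also have "\<dots> \<le> K'" using \<alpha> K'_pos by simp
  finally have "0 \<le> (K' - k * A * \<beta> * A powr (\<beta> - 1)) * z" using z by simp
  moreover have "0 \<le> \<phi> 0"
  proof -
    have "\<phi> 0 = A * (K - k * A powr \<beta>)" by (simp add: \<phi>_def K_eq algebra_simps)
    then show ?thesis using cheap A_pos by simp
  qed
  moreover have "\<phi> 0 + (K' - k * A * \<beta> * A powr (\<beta> - 1)) * z \<le> \<phi> z" using \<phi>_tangent[of z 0] z by simp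
  ultimately have "0 \<le> \<phi> z" by linarith
  then show "0 \<le> fd x" using fd_eq_\<phi>[OF x] unfolding z_def by auto
qed

text \<open>The tangent intercept tends to zero from below or becomes positive.\<close>
lemma cheap_I_lower:
  assumes cheap: "k * A powr \<beta> \<le> K" and x: "0 \<le> x"
  shows "- I x \<le> 2 * k * (1 + A * x powr (1 / \<beta>)) powr (\<alpha> - 1)"
proof (cases "x = 0")
  case True
  then show ?thesis using k by (simp add: I_0)
next
  case False
  define y where "y = x powr (1 / \<beta>)"
  define s where "s = A * y"
  have y: "0 < y" using False x by (simp add: y_def)
  have s: "0 < s" using y A_pos by (simp add: s_def)
  have xb: "A powr \<beta> * x = s powr \<beta>"
    using x \<beta>_pos by (simp add: s_def y_def powr_mult powr_powr)
  \<comment> \<open>The assumption on \<open>K\<close> compares the terms that dominate for large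
    \<open>x\<close>, so that the negative term of the numerator cancels the leading growth of the
    positive one.\<close>
  have "k * s powr \<beta> \<le> K * x" using mult_right_mono[OF cheap x] xb by (simp add: mult.assoc)
  then have "(1 - a) * s * (k * s powr \<beta>) \<le> (1 - a) * s * (K * x)"
    using a_bounds s by (intro mult_left_mono) auto
  then have "k * (1 + s) powr \<beta> * ((1 - a) * s + 1) - K * (1 - a) * (x * s)
      \<le> k * ((1 + s) powr \<beta> + (1 - a) * s * ((1 + s) powr \<beta> - s powr \<beta>))"
    by (simp add: algebra_simps)
  also have "(1 - a) * s * ((1 + s) powr \<beta> - s powr \<beta>) \<le> 1 * (s * ((1 + s) powr \<beta> - s powr \<beta>))"
    unfolding mult.assoc using a_bounds s \<beta>_pos by (intro mult_right_mono mult_nonneg_nonneg) (auto intro: powr_mono2)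
  also have "s * ((1 + s) powr \<beta> - s powr \<beta>) \<le> (1 + s) powr \<beta>"
  proof -
    have "(1 + s) powr \<beta> \<le> s powr \<beta> + \<beta> * s powr (\<beta> - 1) * 1"
      using powr_tangent[of s "1 + s" \<beta>] s \<beta>_pos \<beta> by simp
    then have "s * ((1 + s) powr \<beta> - s powr \<beta>) \<le> s * (\<beta> * s powr (\<beta> - 1))"
      using s by (intro mult_left_mono) auto
    also have "\<dots> = \<beta> * s powr \<beta>" using s by (simp add: powr_diff)
    also have "\<dots> \<le> 1 * (1 + s) powr \<beta>" using \<beta> \<beta>_pos s by (intro mult_mono powr_mono2) auto
    finally show ?thesis by simp
  qed
  finally have num: "k * (1 + s) powr \<beta> * ((1 - a) * s + 1) - K * (1 - a) * (x * s) \<le> 2 * k * (1 + s) powr \<beta>"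
    using k by (simp add: mult_left_mono)
  have "- I x = (k * (1 + s) powr \<beta> * ((1 - a) * s + 1) - K * (1 - a) * (x * s)) / (1 + s) powr (m + 1)"
    unfolding I_eq[OF x] y_def[symmetric] s_def by (simp add: mult_ac)
  also have "\<dots> \<le> 2 * k * (1 + s) powr \<beta> / (1 + s) powr (m + 1)"
    using num by (intro divide_right_mono) auto
  also have "\<dots> = 2 * k * (1 + s) powr (\<alpha> - 1)"
    by (simp only: times_divide_eq_right[symmetric] powr_diff[symmetric]) (simp add: m_def)
  finally show ?thesis by (simp add: s_def y_def)
qed

text \<open>The intercept starts at \<open>- k\<close> and, because \<alpha> is below one, its lower
  bound rises to zero; the value \<open>- q\<close> is taken in between.\<close>

lemma cheap_lower_threshold:
  assumes cheap: "k * A powr \<beta> \<le> K" and q: "0 < q" "q \<le> k"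
  obtains x1 where "0 \<le> x1" "I x1 = - q"
proof -
  have pos: "0 < 1 / \<beta>" using \<beta>_pos by simp
  then have "filterlim (\<lambda>x. 1 + A * x powr (1 / \<beta>)) at_top at_top"
    using A_pos by real_asymp
  then have "((\<lambda>x. (1 + A * x powr (1 / \<beta>)) powr (\<alpha> - 1)) \<longlongrightarrow> 0) at_top"
    using \<alpha> by (intro tendsto_neg_powr) auto
  from tendsto_mult_right_zero[OF this, of "2 * k"]
  have "((\<lambda>x. 2 * k * (1 + A * x powr (1 / \<beta>)) powr (\<alpha> - 1)) \<longlongrightarrow> 0) at_top" .
  then have "\<forall>\<^sub>F x in at_top. 2 * k * (1 + A * x powr (1 / \<beta>)) powr (\<alpha> - 1) < q"
    using q(1) by (rule order_tendstoD(2))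
  then obtain X where X: "0 \<le> X" "2 * k * (1 + A * X powr (1 / \<beta>)) powr (\<alpha> - 1) < q"
    using eventually_conj[OF _ eventually_ge_at_top[of 0]] eventually_happens'[OF trivial_limit_at_top_linorder] by fastforce
  have "- q \<le> I X" using cheap_I_lower[OF cheap X(1)] X(2) by simp
  moreover have "I 0 \<le> - q" using q by (simp add: I_0)
  ultimately obtain x1 where "0 \<le> x1" "x1 \<le> X" "I x1 = - q"
    using IVT'[of I 0 "- q" X] X(1) continuous_on_subset[OF I_continuous, of "{0..X}"] by auto
  then show ?thesis using that by blast
qed

text \<open>Wherever \<open>\<phi>\<close> is nonnegative its tangent has positive slope, since at
  zero the tangent lies at or below \<open>\<phi> 0 < 0\<close>. Hence \<open>\<phi>\<close> stays
  positive after its first zero, which exists because \<open>\<phi>\<close> tends to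
  infinity.\<close>

lemma costly_\<phi>:
  assumes costly: "K < k * A powr \<beta>"
  obtains z where "0 < z" "\<phi> z = 0" "\<And>w. 0 \<le> w \<Longrightarrow> w < z \<Longrightarrow> \<phi> w < 0" "\<And>w. z < w \<Longrightarrow> 0 < \<phi> w"
proof -
  have \<phi>0: "\<phi> 0 < 0"
  proof -
    have "\<phi> 0 = A * (K - k * A powr \<beta>)" by (simp add: \<phi>_def K_eq algebra_simps)
    then show ?thesis using costly A_pos by (simp add: mult_pos_neg)
  qed
  have "filterlim \<phi> at_top at_top"
    unfolding \<phi>_def[abs_def] using A_pos \<beta>_pos \<beta> K'_pos by real_asymp
  then have "\<forall>\<^sub>F z in at_top. 0 < \<phi> z" by (simp add: filterlim_at_top_dense)
  then obtain Z where Z: "0 \<le> Z" "0 < \<phi> Z"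
    using eventually_conj[OF _ eventually_ge_at_top[of 0]] eventually_happens'[OF trivial_limit_at_top_linorder] by fastforce
  have "continuous_on {0..Z} \<phi>" unfolding \<phi>_def[abs_def]
    by (intro continuous_intros continuous_on_powr') (use A_pos in auto)
  then obtain z where z: "0 \<le> z" "\<phi> z = 0"
    using IVT'[of \<phi> 0 0 Z] Z \<phi>0 by auto
  have z0: "0 < z" using z \<phi>0 by (cases "z = 0") auto
  let ?d = "\<lambda>w. K' - k * A * \<beta> * (A + w) powr (\<beta> - 1)"
  have slope: "0 < ?d w" if "0 \<le> w" "0 \<le> \<phi> w" for w
  proof -
    have "\<phi> w + ?d w * (0 - w) \<le> \<phi> 0" using \<phi>_tangent[of 0 w] that by simp
    then have "0 < ?d w * w" using \<phi>0 that by simp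
    then show ?thesis using that(1) by (simp add: zero_less_mult_iff)
  qed
  show ?thesis
  proof (rule that[OF z0 z(2)])
    fix w assume w: "0 \<le> w" "w < z"
    show "\<phi> w < 0"
    proof (rule ccontr)
      assume "\<not> \<phi> w < 0"
      then have "0 < ?d w * (z - w)" "0 \<le> \<phi> w" using slope[OF w(1)] w by auto
      then show False using \<phi>_tangent[of z w] w z by linarith
    qed
  next
    fix w assume w: "z < w"
    have "0 < ?d z * (w - z)" using slope[OF z(1)] z w by simp
    then show "0 < \<phi> w" using \<phi>_tangent[of w z] w z by linarith
  qed
qed

text \<open>Since \<open>x powr (- 1 / \<beta>)\<close> decreases in \<open>x\<close>, the change of
  sign of \<open>\<phi>\<close> at \<open>z\<close> from negative to positive becomes one of
  \<open>fd\<close> from positive to negative at \<open>x2 = z powr (- \<beta>)\<close>.\<close>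

lemma costly_upper_threshold:
  assumes costly: "K < k * A powr \<beta>"
  obtains x2 where "0 < x2" "fd x2 = 0" "increasing_upto x2" "\<And>x. x2 \<le> x \<Longrightarrow> f x \<le> f x2"
    "\<And>x. 0 < x \<Longrightarrow> upper_threshold_eq \<alpha> \<beta> k c \<gamma> lam x \<longleftrightarrow> x = x2"
proof -
  obtain z where z: "0 < z" "\<phi> z = 0" "\<And>w. 0 \<le> w \<Longrightarrow> w < z \<Longrightarrow> \<phi> w < 0" "\<And>w. z < w \<Longrightarrow> 0 < \<phi> w"
    using costly_\<phi>[OF costly] by blast
  define x2 where "x2 = z powr (- \<beta>)"
  have x2: "0 < x2" using z by (simp add: x2_def)
  have zx: "x2 powr (- 1 / \<beta>) = z" using z \<beta>_pos by (simp add: x2_def powr_powr)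
  have mono: "x powr (- 1 / \<beta>) < y powr (- 1 / \<beta>)" if "0 < y" "y < x" for x y
    using powr_less_mono2_neg[of "- 1 / \<beta>" y x] that \<beta>_pos by simp
  have neg: "fd x < 0" if "x2 < x" for x
  proof -
    have x0: "0 < x" using that x2 by simp
    have "\<phi> (x powr (- 1 / \<beta>)) < 0" using z(3) mono[OF x2 that] zx by simp
    then show ?thesis using fd_eq_\<phi>[OF x0] by (auto simp: mult_pos_neg)
  qed
  show ?thesis
  proof (rule that[OF x2])
    show "fd x2 = 0" using fd_eq_\<phi>[OF x2] zx z(2) by auto
    show "increasing_upto x2" unfolding increasing_upto_def
    proof (intro allI impI)
      fix x assume x: "0 < x" "x \<le> x2"
      have "0 \<le> \<phi> (x powr (- 1 / \<beta>))"
        using z(4) mono[OF x(1), of x2] x zx z(2) by (cases "x = x2") (auto simp: less_imp_le)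
      then show "0 \<le> fd x" using fd_eq_\<phi>[OF x(1)] by auto
    qed
    show "f x \<le> f x2" if "x2 \<le> x" for x
    proof (cases "x = x2")
      case False
      then have lt: "x2 < x" using that by simp
      obtain w where "x2 < w" "f x - f x2 = (x - x2) * fd w" using f_mvt[OF _ lt] x2 by auto
      then show ?thesis using mult_pos_neg[of "x - x2" "fd w"] neg[of w] lt by simp
    qed simp
    show "upper_threshold_eq \<alpha> \<beta> k c \<gamma> lam x \<longleftrightarrow> x = x2" if x: "0 < x" for x
      unfolding upper_threshold_eq_iff
      using z(2) zx z(4)[of "x powr (- 1 / \<beta>)"] z(3)[of "x powr (- 1 / \<beta>)"] mono[OF x, of x2] mono[OF x2, of x]
      by (cases x x2 rule: linorder_cases) auto
  qed
qed

text \<open>The assumption on \<open>K\<close> bounds the gain \<open>K * x\<close> by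
  \<open>k * (A * y) powr \<beta>\<close>, with \<open>y = x powr (1 / \<beta>)\<close>, and adding
  one inside the power makes this strict. A negative maximum of \<open>f\<close> is what makes the
  critical ratio of the entry costs finite.\<close>

lemma costly_f_negative:
  assumes costly: "K < k * A powr \<beta>" and x: "0 \<le> x"
  shows "f x < 0"
proof -
  let ?y = "x powr (1 / \<beta>)"
  have s: "0 < 1 + A * ?y" by (rule affine_powr_pos)
  have f_eq: "f x = (K * x - k * (1 + A * ?y) powr \<beta>) * (1 + A * ?y) powr (- m)"
    using s by (simp add: f_def left_diff_distrib m_def flip: powr_add)
  have "K * x \<le> k * A powr \<beta> * x" using costly x by (intro mult_right_mono) auto
  also have "\<dots> = k * (A * ?y) powr \<beta>" using x \<beta>_pos by (simp add: powr_mult powr_powr)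
  also have "\<dots> < k * (1 + A * ?y) powr \<beta>"
    using k A_pos \<beta>_pos by (intro mult_strict_left_mono powr_less_mono2) auto
  finally show ?thesis unfolding f_eq using s by (intro mult_neg_pos) auto
qed

lemma f_increasing:
  assumes b: "increasing_upto b" and uv: "0 \<le> u" "u < v" "v \<le> b"
  shows "f u < f v"
proof -
  obtain z where z: "u < z" "z < v" "f v - f u = (v - u) * fd z" using f_mvt[OF uv(1,2)] by blast
  have "fd v < fd z" by (rule fd_strict_antimono[OF b]) (use z uv in auto)
  moreover have "0 \<le> fd v" using b uv unfolding increasing_upto_def by simp
  ultimately have "0 < (v - u) * fd z" using uv by simp
  then show ?thesis using z(3) by simp
qed

end


section \<open>Concave majorants and the exit payoff\<close>

lemma concave_on_nonneg_if_supergradient: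
  fixes h :: "real \<Rightarrow> real"
  assumes "\<And>x0. 0 \<le> x0 \<Longrightarrow> \<exists>d. \<forall>x\<ge>0. h x \<le> h x0 + d * (x - x0)"
  shows "concave_on {0..} h"
  unfolding concave_on_iff
proof (intro conjI ballI allI impI)
  fix x y u v :: real
  assume xy: "x \<in> {0..}" "y \<in> {0..}" and uv: "0 \<le> u" "0 \<le> v" "u + v = 1"
  let ?z = "u * x + v * y"
  have "0 \<le> ?z" using xy uv by simp
  then obtain d where d: "\<And>x. 0 \<le> x \<Longrightarrow> h x \<le> h ?z + d * (x - ?z)" using assms by blast
  have "u * h x + v * h y \<le> u * (h ?z + d * (x - ?z)) + v * (h ?z + d * (y - ?z))"
    using d xy uv by (intro add_mono mult_left_mono) auto
  also have "\<dots> = (u + v) * h ?z + d * (?z - (u + v) * ?z)" by (simp add: algebra_simps)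
  also have "\<dots> = h ?z" using uv by simp
  finally show "u * h x + v * h y \<le> h (u *\<^sub>R x + v *\<^sub>R y)" by simp
qed simp

lemma concave_chord:
  fixes h :: "real \<Rightarrow> real"
  assumes h: "concave_on {0..} h" and x: "0 \<le> x" "x \<le> b" "0 < b"
  shows "h 0 + (h b - h 0) / b * x \<le> h x"
proof -
  have "(1 - x / b) * h 0 + x / b * h b \<le> h ((1 - x / b) *\<^sub>R 0 + (x / b) *\<^sub>R b)"
    by (rule concave_onD[OF h]) (use x in auto)
  then show ?thesis using x by (simp add: field_simps)
qed

text \<open>A concave function that decreases once keeps falling at least at that rate, and so below
  any bound.\<close>

lemma concave_bounded_below_mono:
  fixes h :: "real \<Rightarrow> real"
  assumes h: "concave_on {0..} h" and low: "\<And>x. 0 \<le> x \<Longrightarrow> L \<le> h x" and uv: "0 \<le> u" "u \<le> v"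
  shows "h u \<le> h v"
proof (rule ccontr)
  assume neg: "\<not> h u \<le> h v"
  then have lt: "u < v" using uv by (cases "u = v") auto
  define s where "s = (h u - h v) / (v - u)"
  have s: "0 < s" using neg lt by (simp add: s_def)
  \<comment> \<open>At this point the line through the values at \<open>u\<close> and
    \<open>v\<close> has dropped to \<open>L - 1\<close>.\<close>
  define w where "w = v + (h v - L + 1) / s"
  have hL: "L \<le> h v" using low uv by simp
  have vw: "v < w" using s hL by (simp add: w_def add_nonneg_pos)
  define t where "t = (v - u) / (w - u)"
  have t: "0 \<le> t" "t \<le> 1" using lt vw by (auto simp: t_def)
  have "(1 - t) * h u + t * h w \<le> h ((1 - t) *\<^sub>R u + t *\<^sub>R w)"
    by (rule concave_onD[OF h]) (use t uv vw in auto)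
  moreover have "(1 - t) *\<^sub>R u + t *\<^sub>R w = v"
  proof -
    have "t * (w - u) = v - u" using lt vw by (simp add: t_def)
    then show ?thesis by (simp add: algebra_simps)
  qed
  ultimately have "t * (h w - h u) \<le> h v - h u" by (simp add: algebra_simps)
  then have "(v - u) * (h w - h u) \<le> (h v - h u) * (w - u)"
    using lt vw by (simp add: t_def field_simps)
  then have "(v - u) * (h w - h u) \<le> - s * (v - u) * (w - u)"
    using lt by (simp add: s_def)
  then have "(v - u) * (h w - h u) \<le> (v - u) * (- s * (w - u))" by (simp add: mult_ac)
  then have "h w - h u \<le> - s * (w - u)" by (rule mult_left_le_imp_le) (use lt in simp)
  then have "h w \<le> h u - s * (w - u)" by simp
  also have "\<dots> = h v - s * (w - v)"
  proof -
    have "s * (v - u) = h u - h v" using lt by (simp add: s_def)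
    then show ?thesis by (simp add: algebra_simps)
  qed
  also have "\<dots> = L - 1" using s by (simp add: w_def)
  finally show False using low[of w] uv vw by simp
qed

text \<open>The region \<open>S\<close> where the majorant touches \<open>f\<close> starts at the point \<open>x1\<close> whose tangent has
  intercept \<open>- q\<close>; \<open>cl\<close> is the nearest-point projection onto \<open>S\<close>, and the majorant is the tangent at
  the projected point.\<close>
locale tangent_majorant =
  fixes f fd cl :: "real \<Rightarrow> real" and S :: "real set" and x1 q :: real
  assumes S: "S \<subseteq> {0..}" "x1 \<in> S" "\<And>x. x \<in> S \<Longrightarrow> x1 \<le> x"
    and tangent: "\<And>u x. u \<in> S \<Longrightarrow> x \<in> S \<Longrightarrow> f x \<le> f u + fd u * (x - u)"
    and fd_anti: "\<And>u v. u \<in> S \<Longrightarrow> v \<in> S \<Longrightarrow> u \<le> v \<Longrightarrow> fd v \<le> fd u"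
    and fd_nonneg: "\<And>u. u \<in> S \<Longrightarrow> 0 \<le> fd u"
    and cl_mem: "\<And>x. x \<in> S \<Longrightarrow> cl x = x"
    and cl_low: "\<And>x. 0 \<le> x \<Longrightarrow> x < x1 \<Longrightarrow> cl x = x1"
    and cl_high: "\<And>x. x1 \<le> x \<Longrightarrow> x \<notin> S \<Longrightarrow> cl x \<in> S \<and> fd (cl x) = 0 \<and> cl x \<le> x \<and> (\<forall>u\<in>S. u \<le> cl x) \<and> f x \<le> f (cl x)"
    and low: "\<And>x. 0 \<le> x \<Longrightarrow> x < x1 \<Longrightarrow> f x \<le> f x1 + fd x1 * (x - x1)"
    and intercept: "f x1 - x1 * fd x1 = - q"
begin

definition majorant :: "real \<Rightarrow> real" where
  "majorant x = f (cl x) + fd (cl x) * (x - cl x)"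

lemma cl_in: "0 \<le> x \<Longrightarrow> cl x \<in> S"
  using S(2) cl_mem cl_low cl_high by (metis linorder_not_less)

text \<open>The projection \<open>cl x\<close> lies between \<open>x\<close> and every point of
  \<open>S\<close>, or equals \<open>x\<close>, so \<open>fd (cl x0) - fd (cl x)\<close> and
  \<open>x - cl x\<close> never have opposite signs. What remains is the tangent inequality at
  \<open>cl x0\<close>.\<close>

lemma majorant_supergradient:
  assumes "0 \<le> x0" "0 \<le> x"
  shows "majorant x \<le> majorant x0 + fd (cl x0) * (x - x0)"
proof -
  let ?u = "cl x0" and ?v = "cl x"
  have uv: "?u \<in> S" "?v \<in> S" using cl_in assms by auto
  have "0 \<le> (fd ?u - fd ?v) * (x - ?v)"
  proof -
    consider "x \<in> S" | "x < x1" | "x1 \<le> x" "x \<notin> S" by linarith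
    then show ?thesis
    proof cases
      case 1 then show ?thesis using cl_mem by simp
    next
      case 2
      then have "?v = x1" using cl_low assms by simp
      then show ?thesis using 2 fd_anti[OF S(2) uv(1)] S(3)[OF uv(1)] by (simp add: mult_nonpos_nonpos)
    next
      case 3
      then show ?thesis using cl_high[OF 3] fd_anti[OF uv] uv(1) by simp
    qed
  qed
  moreover have "f ?v \<le> f ?u + fd ?u * (?v - ?u)" by (rule tangent[OF uv])
  ultimately show ?thesis unfolding majorant_def by (simp add: algebra_simps)
qed

text \<open>Tangents further to the right are flatter and still dominate \<open>f\<close> at
  \<open>x1\<close>, so their intercepts are no lower.\<close>

lemma tangent_intercept: "u \<in> S \<Longrightarrow> - q \<le> f u - u * fd u"
proof -
  assume u: "u \<in> S"
  have "0 \<le> x1" using S by auto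
  then have "x1 * fd u \<le> x1 * fd x1" using fd_anti[OF S(2) u S(3)[OF u]] by (intro mult_left_mono)
  moreover have "f x1 \<le> f u + fd u * (x1 - u)" by (rule tangent[OF u S(2)])
  ultimately show ?thesis using intercept by (simp add: algebra_simps)
qed

lemma majorant_ge:
  assumes x: "0 \<le> x"
  shows "max (f x) (- q) \<le> majorant x"
proof -
  have "majorant x = (f (cl x) - cl x * fd (cl x)) + fd (cl x) * x" by (simp add: majorant_def algebra_simps)
  moreover have "0 \<le> fd (cl x) * x" using fd_nonneg[OF cl_in[OF x]] x by simp
  ultimately have "- q \<le> majorant x" using tangent_intercept[OF cl_in[OF x]] by linarith
  moreover have "f x \<le> majorant x"
  proof -
    consider "x \<in> S" | "x < x1" | "x1 \<le> x" "x \<notin> S" by linarith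
    then show ?thesis
    proof cases
      case 1 then show ?thesis using cl_mem by (simp add: majorant_def)
    next
      case 2 then show ?thesis using low[OF x 2] cl_low[OF x 2] by (simp add: majorant_def)
    next
      case 3 then show ?thesis using cl_high[OF 3] by (simp add: majorant_def)
    qed
  qed
  ultimately show ?thesis by simp
qed

lemma f_ge_on: "u \<in> S \<Longrightarrow> - q \<le> f u"
proof -
  assume u: "u \<in> S"
  have "0 \<le> u * fd u" using u S fd_nonneg by (intro mult_nonneg_nonneg) auto
  then show ?thesis using tangent_intercept[OF u] by linarith
qed

text \<open>Left of \<open>x1\<close> the majorant is the chord from the value \<open>- q\<close> at
  zero to the value of \<open>f\<close> at \<open>x1\<close>, which lies below every concave
  competitor. Right of \<open>S\<close> it is constant, and a competitor, being bounded below by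
  \<open>- q\<close>, cannot decrease.\<close>

lemma smallest_majorant:
  "smallest_concave_majorant_on {0..} (\<lambda>x. max (f x) (- q)) majorant"
  unfolding smallest_concave_majorant_on_def
proof (intro conjI allI impI ballI)
  show "concave_on {0..} majorant"
    by (rule concave_on_nonneg_if_supergradient) (use majorant_supergradient in blast)
  show "max (f x) (- q) \<le> majorant x" if "x \<in> {0..}" for x using majorant_ge that by simp
  fix h :: "real \<Rightarrow> real" and x :: real
  assume h: "concave_on {0..} h \<and> (\<forall>x\<in>{0..}. max (f x) (- q) \<le> h x)" and "x \<in> {0..}"
  then have x: "0 \<le> x" and hc: "concave_on {0..} h" and hf: "\<And>x. 0 \<le> x \<Longrightarrow> f x \<le> h x" and hq: "\<And>x. 0 \<le> x \<Longrightarrow> - q \<le> h x"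
    by auto
  consider "x \<in> S" | "x < x1" | "x1 \<le> x" "x \<notin> S" by linarith
  then show "majorant x \<le> h x"
  proof cases
    case 1 then show ?thesis using cl_mem hf x by (simp add: majorant_def)
  next
    case 2
    have x1: "0 < x1" using 2 x by simp
    have "majorant x = - q + fd x1 * x"
      using cl_low[OF x 2] intercept by (simp add: majorant_def algebra_simps)
    also have "fd x1 = (f x1 + q) / x1" using intercept x1 by (simp add: field_simps)
    also have "- q + (f x1 + q) / x1 * x = (1 - x / x1) * (- q) + x / x1 * f x1"
      using x1 by (simp add: field_simps)
    also have "\<dots> \<le> (1 - x / x1) * h 0 + x / x1 * h x1"
      using hq[of 0] hf[of x1] x 2 x1 by (intro add_mono mult_left_mono) auto
    also have "\<dots> = h 0 + (h x1 - h 0) / x1 * x" using x1 by (simp add: field_simps)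
    also have "\<dots> \<le> h x" by (rule concave_chord[OF hc]) (use x 2 x1 in auto)
    finally show ?thesis .
  next
    case 3
    note c = cl_high[OF 3]
    have "majorant x = f (cl x)" using c by (simp add: majorant_def)
    also have "\<dots> \<le> h (cl x)" using hf c S by auto
    also have "\<dots> \<le> h x" using c S by (intro concave_bounded_below_mono[OF hc hq]) auto
    finally show ?thesis .
  qed
qed

end

lemma smallest_concave_majorant_const:
  fixes g :: "real \<Rightarrow> real"
  assumes "\<And>x. 0 \<le> x \<Longrightarrow> g x = C"
  shows "smallest_concave_majorant_on {0..} g (\<lambda>_. C)"
  unfolding smallest_concave_majorant_on_def
proof (intro conjI allI impI ballI)
  show "concave_on {0..} (\<lambda>_::real. C)"
    by (rule concave_on_nonneg_if_supergradient) (rule exI[of _ 0], simp)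
qed (use assms in auto)

lemma concave_on_rescale:
  fixes h :: "real \<Rightarrow> real"
  assumes h: "concave_on {0..} h" and D: "0 \<le> D" and r: "0 \<le> r"
  shows "concave_on {0..} (\<lambda>x. D * h (r * x))"
  unfolding concave_on_iff
proof (intro conjI ballI allI impI)
  fix x y u v :: real
  assume xy: "x \<in> {0..}" "y \<in> {0..}" and uv: "0 \<le> u" "0 \<le> v" "u + v = 1"
  have "u * h (r * x) + v * h (r * y) \<le> h (u *\<^sub>R (r * x) + v *\<^sub>R (r * y))"
    using h xy uv r unfolding concave_on_iff by auto
  then have "D * (u * h (r * x) + v * h (r * y)) \<le> D * h (u *\<^sub>R (r * x) + v *\<^sub>R (r * y))"
    using D by (rule mult_left_mono)
  then show "u * (D * h (r * x)) + v * (D * h (r * y)) \<le> D * h (r * (u *\<^sub>R x + v *\<^sub>R y))"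
    by (simp add: algebra_simps)
qed simp

lemma smallest_concave_majorant_rescale:
  fixes g h :: "real \<Rightarrow> real"
  assumes s: "smallest_concave_majorant_on {0..} g h" and D: "0 < D" and r: "0 < r"
  shows "smallest_concave_majorant_on {0..} (\<lambda>x. D * g (r * x)) (\<lambda>x. D * h (r * x))"
  unfolding smallest_concave_majorant_on_def
proof (intro conjI allI impI ballI)
  show "concave_on {0..} (\<lambda>x. D * h (r * x))"
    using s D r by (intro concave_on_rescale) (auto simp: smallest_concave_majorant_on_def)
  show "D * g (r * x) \<le> D * h (r * x)" if "x \<in> {0..}" for x
    using s D r that by (auto simp: smallest_concave_majorant_on_def)
  fix h' :: "real \<Rightarrow> real" and x :: real
  assume h': "concave_on {0..} h' \<and> (\<forall>x\<in>{0..}. D * g (r * x) \<le> h' x)" and x: "x \<in> {0..}"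
  let ?h = "\<lambda>x. 1 / D * h' (1 / r * x)"
  have "concave_on {0..} ?h" using h' D r by (intro concave_on_rescale) auto
  moreover have "g y \<le> ?h y" if "y \<in> {0..}" for y
  proof -
    have "D * g (r * (1 / r * y)) \<le> h' (1 / r * y)"
      by (rule bspec[OF conjunct2[OF h']]) (use that r in simp)
    then show ?thesis using D r by (simp add: field_simps)
  qed
  ultimately have "\<forall>y\<in>{0..}. h y \<le> ?h y"
    using s unfolding smallest_concave_majorant_on_def by blast
  then have "h (r * x) \<le> ?h (r * x)" by (rule bspec) (use x r in simp)
  then show "D * h (r * x) \<le> h' x" using D r by (simp add: field_simps)
qed

section \<open>Majorants of the rescaled entry payoff, and bounds on the exit payoff\<close>

context entry_params begin

lemma cheap_tangent_majorant:
  assumes cheap: "k * A powr \<beta> \<le> K" and x1: "0 \<le> x1" "I x1 = - q"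
  shows "tangent_majorant f fd (\<lambda>x. max x1 x) {x1..} x1 q"
proof
  note inc = cheap_increasing[OF cheap]
  have tan: "f x \<le> f u + fd u * (x - u)" if "0 \<le> u" "0 \<le> x" for u x
    using f_tangent[OF inc, of u "max u x" x] f_tangent_0[of x] that by (cases "u = 0") auto
  show "f x \<le> f u + fd u * (x - u)" if "u \<in> {x1..}" "x \<in> {x1..}" for u x
    using tan that x1 by simp
  show "f x \<le> f x1 + fd x1 * (x - x1)" if "0 \<le> x" "x < x1" for x using tan that x1 by simp
  show "fd v \<le> fd u" if "u \<in> {x1..}" "v \<in> {x1..}" "u \<le> v" for u v
    using fd_strict_antimono[OF inc, of u v v] fd_le_fd_0[of v] that x1
    by (cases "u = v"; cases "u = 0") auto
  show "0 \<le> fd u" if "u \<in> {x1..}" for u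
    using inc[of u] that x1 fd_0 K_pos unfolding increasing_upto_def by (cases "u = 0") auto
  show "f x1 - x1 * fd x1 = - q" using x1(2) by (simp add: I_def)
qed (use x1 in auto)

text \<open>The upper end of the region is the maximiser of \<open>f\<close>: the tangent there is
  horizontal and dominates \<open>f\<close> to the right.\<close>

lemma costly_tangent_majorant:
  assumes x2: "0 < x2" "fd x2 = 0" "increasing_upto x2" "\<And>x. x2 \<le> x \<Longrightarrow> f x \<le> f x2"
    and x1: "0 \<le> x1" "x1 \<le> x2" "I x1 = - q"
  shows "tangent_majorant f fd (\<lambda>x. max x1 (min x2 x)) {x1..x2} x1 q"
proof
  note inc = x2(3)
  have tan: "f x \<le> f u + fd u * (x - u)" if "0 \<le> u" "u \<le> x2" "0 \<le> x" "x \<le> x2" for u x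
    using f_tangent[OF inc, of u x] f_tangent_0[of x] that by (cases "u = 0") auto
  show "f x \<le> f u + fd u * (x - u)" if "u \<in> {x1..x2}" "x \<in> {x1..x2}" for u x
    using tan that x1 by simp
  show "f x \<le> f x1 + fd x1 * (x - x1)" if "0 \<le> x" "x < x1" for x using tan that x1 by simp
  show "fd v \<le> fd u" if "u \<in> {x1..x2}" "v \<in> {x1..x2}" "u \<le> v" for u v
    using fd_strict_antimono[OF inc, of u v] fd_le_fd_0[of v] that x1
    by (cases "u = v"; cases "u = 0") auto
  show "0 \<le> fd u" if "u \<in> {x1..x2}" for u
    using inc that x1 fd_0 K_pos unfolding increasing_upto_def by (cases "u = 0") auto
  show "f x1 - x1 * fd x1 = - q" using x1(3) by (simp add: I_def)
  show "max x1 (min x2 x) \<in> {x1..x2} \<and> fd (max x1 (min x2 x)) = 0 \<and> max x1 (min x2 x) \<le> x \<and>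
      (\<forall>u\<in>{x1..x2}. u \<le> max x1 (min x2 x)) \<and> f x \<le> f (max x1 (min x2 x))"
    if "x1 \<le> x" "x \<notin> {x1..x2}" for x
    using that x1 x2 by (auto simp: max_def min_def)
qed (use x1 in auto)

text \<open>In units of the reference point, the line through the exit payoffs at \<open>0\<close> and at \<open>c\<close> has slope
  \<^term>\<open>K\<close> in the variable \<open>x\<^sup>\<beta>\<close>.\<close>
lemma K_c_eq: "K * c powr \<beta> = (c - 1) powr \<alpha> + k"
proof -
  have "K * c powr \<beta> = \<alpha> / \<beta> * (c powr (1 - \<beta>) * c powr \<beta>) * (c - 1) powr (\<alpha> - 1)"
    by (simp add: K_def)
  also have "c powr (1 - \<beta>) * c powr \<beta> = c" using c by (simp flip: powr_add)
  finally show ?thesis using c_eq by simp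
qed

text \<open>The difference \<open>r\<close> of the two sides vanishes at \<open>c\<close>. Its
  derivative has the sign of \<open>w y - w c\<close>, where \<open>w\<close> is nondecreasing
  because \<open>\<alpha> \<le> \<beta> < 1\<close>, so \<open>c\<close> minimises
  \<open>r\<close>.\<close>

lemma exit_gain_bound:
  assumes x: "1 \<le> x"
  shows "(x - 1) powr \<alpha> + k \<le> K * x powr \<beta>"
proof -
  define r where "r = (\<lambda>x. K * x powr \<beta> - k - (x - 1) powr \<alpha>)"
  define w where "w = (\<lambda>x. x powr (\<beta> - 1) * (x - 1) powr (1 - \<alpha>))"
  \<comment> \<open>This is the stationarity of \<open>r\<close> at \<open>c\<close>, built into the
    definition of \<open>K\<close>.\<close>
  have wc: "\<alpha> / K / \<beta> = w c"
    using c \<alpha> \<beta>_pos by (simp add: w_def K_def powr_diff powr_minus field_simps)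
  have shift: "((\<lambda>x. x - 1) has_real_derivative 1) (at y)" for y :: real
    by (auto intro!: derivative_eq_intros)
  have dr: "DERIV r y :> (y - 1) powr (\<alpha> - 1) * (K * \<beta> * (w y - w c))" if y: "1 < y" for y
  proof -
    have d1: "((\<lambda>x. (x - 1) powr \<alpha>) has_real_derivative \<alpha> * (y - 1) powr (\<alpha> - 1)) (at y)"
      using DERIV_chain2[where f="\<lambda>z. z powr (\<alpha>)" and g="\<lambda>x. x - 1", OF has_real_derivative_powr shift] y by simp
    have "DERIV r y :> K * (\<beta> * y powr (\<beta> - 1)) - \<alpha> * (y - 1) powr (\<alpha> - 1)"
      unfolding r_def by (rule d1 derivative_eq_intros has_real_derivative_powr refl | use y in simp)+
    moreover have "(y - 1) powr (\<alpha> - 1) * (K * \<beta> * w y) = K * (\<beta> * y powr (\<beta> - 1))"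
    proof -
      have "(y - 1) powr (\<alpha> - 1) * (y - 1) powr (1 - \<alpha>) = 1" using y by (simp flip: powr_add)
      then show ?thesis by (simp add: w_def)
    qed
    moreover have "K * \<beta> * w c = \<alpha>" using wc K_pos \<beta>_pos by (simp add: field_simps)
    moreover have "(y - 1) powr (\<alpha> - 1) * (K * \<beta> * (w y - w c))
        = (y - 1) powr (\<alpha> - 1) * (K * \<beta> * w y) - (K * \<beta> * w c) * (y - 1) powr (\<alpha> - 1)"
      by (simp add: algebra_simps)
    ultimately show ?thesis by (simp only:)
  qed
  have w_mono: "w u \<le> w v" if uv: "1 < u" "u \<le> v" for u v
  proof (rule DERIV_nonneg_imp_nondecreasing[OF uv(2)])
    fix y assume "u \<le> y" "y \<le> v"
    then have y: "1 < y" using uv by simp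
    have d1: "((\<lambda>x. (x - 1) powr (1 - \<alpha>)) has_real_derivative (1 - \<alpha>) * (y - 1) powr (- \<alpha>)) (at y)"
      using DERIV_chain2[where f="\<lambda>z. z powr (1 - \<alpha>)" and g="\<lambda>x. x - 1", OF has_real_derivative_powr shift] y by simp
    have d2: "((\<lambda>x. x powr (\<beta> - 1)) has_real_derivative (\<beta> - 1) * y powr (\<beta> - 2)) (at y)"
      using has_real_derivative_powr[of y "\<beta> - 1"] y by simp
    have D: "DERIV w y :> (\<beta> - 1) * y powr (\<beta> - 2) * (y - 1) powr (1 - \<alpha>) + (1 - \<alpha>) * (y - 1) powr (- \<alpha>) * y powr (\<beta> - 1)"
      unfolding w_def by (rule DERIV_mult[OF d2 d1])
    have e1: "(y - 1) powr (1 - \<alpha>) = (y - 1) powr (- \<alpha>) * (y - 1)" using y by (simp add: powr_diff powr_minus field_simps)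
    have e2: "y powr (\<beta> - 1) = y powr (\<beta> - 2) * y" using y by (simp add: powr_diff power2_eq_square)
    have "(\<beta> - 1) * y powr (\<beta> - 2) * (y - 1) powr (1 - \<alpha>) + (1 - \<alpha>) * (y - 1) powr (- \<alpha>) * y powr (\<beta> - 1)
       = y powr (\<beta> - 2) * (y - 1) powr (- \<alpha>) * ((\<beta> - \<alpha>) * y + (1 - \<beta>))"
      unfolding e1 e2 by (simp add: algebra_simps)
    moreover have "0 \<le> y powr (\<beta> - 2) * (y - 1) powr (- \<alpha>) * ((\<beta> - \<alpha>) * y + (1 - \<beta>))"
      using \<alpha>\<beta> \<beta> y by (intro mult_nonneg_nonneg add_nonneg_nonneg) auto
    ultimately show "\<exists>D. DERIV w y :> D \<and> 0 \<le> D" using D by auto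
  qed
  have r_cont: "continuous_on {1..} r"
    unfolding r_def by (intro continuous_intros continuous_on_powr') (use \<alpha> \<beta>_pos in auto)
  have rc: "r c = 0" using K_c_eq by (simp add: r_def)
  have "r c \<le> r x"
  proof (cases "x \<le> c")
    case True
    show ?thesis
    proof (cases "x = c")
      case False
      then have lt: "x < c" using True by simp
      have "continuous_on {x..c} r" using continuous_on_subset[OF r_cont] x by auto
      from MVT[OF lt this] obtain l z where z: "x < z" "z < c" "DERIV r z :> l" "r c - r x = (c - x) * l"
        using dr x by (meson le_less_trans real_differentiable_def)
      have "l = (z - 1) powr (\<alpha> - 1) * (K * \<beta> * (w z - w c))" using DERIV_unique[OF z(3) dr] z x by simp
      moreover have "K * \<beta> * (w z - w c) \<le> 0"
        using w_mono[of z c] z x K_pos \<beta>_pos by (simp add: mult_nonneg_nonpos)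
      ultimately have "(c - x) * l \<le> 0" using lt by (simp add: mult_nonneg_nonpos)
      then show ?thesis using z(4) by simp
    qed simp
  next
    case False
    then have lt: "c < x" by simp
    have "continuous_on {c..x} r" using continuous_on_subset[OF r_cont] c by auto
    from MVT[OF lt this] obtain l z where z: "c < z" "z < x" "DERIV r z :> l" "r x - r c = (x - c) * l"
      using dr c by (meson less_trans real_differentiable_def)
    have "l = (z - 1) powr (\<alpha> - 1) * (K * \<beta> * (w z - w c))" using DERIV_unique[OF z(3) dr] z c by simp
    moreover have "0 \<le> K * \<beta> * (w z - w c)"
      using w_mono[of c z] z c K_pos \<beta>_pos by simp
    ultimately have "0 \<le> (x - c) * l" using lt by simp
    then show ?thesis using z(4) by simp
  qed
  then show ?thesis using rc by (simp add: r_def)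
qed

text \<open>On the loss branch, powers with exponent below one exceed their arguments on the unit
  interval, and \<open>k \<le> K\<close> is the gain bound at \<open>1\<close>.\<close>

lemma utility_bound:
  assumes x: "0 \<le> x"
  shows "utility \<alpha> k (x - 1) \<le> K * x powr \<beta> - k"
proof (cases "1 \<le> x")
  case True
  then show ?thesis using exit_gain_bound[OF True] k by (cases "x = 1") (auto simp: utility_def)
next
  case False
  have kK: "k \<le> K" using exit_gain_bound[of 1] by simp
  have "1 - x \<le> (1 - x) powr \<alpha>"
    using powr_mono'[of \<alpha> 1 "1 - x"] \<alpha> False x by simp
  then have "k * (1 - (1 - x) powr \<alpha>) \<le> k * x" using k by (intro mult_left_mono) auto
  also have "\<dots> \<le> K * x powr \<beta>"
    using powr_mono'[of \<beta> 1 x] \<beta> False x kK k by (intro mult_mono) auto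
  finally show ?thesis using False by (simp add: utility_def algebra_simps)
qed

lemma utility_scale:
  assumes H: "0 < H"
  shows "utility \<alpha> k (H * x) = H powr \<alpha> * utility \<alpha> k x"
proof -
  have "\<bar>H * x\<bar> powr \<alpha> = H powr \<alpha> * \<bar>x\<bar> powr \<alpha>"
    by (simp only: abs_mult abs_of_pos[OF H] powr_mult)
  then show ?thesis using H by (simp add: utility_def powr_mult zero_less_mult_iff del: abs_mult)
qed

lemma utility_measurable [measurable]: "utility \<alpha> k \<in> borel_measurable borel"
  unfolding utility_def[abs_def] by measurable

lemma utility_lower:
  assumes H: "0 < H" and x: "0 \<le> x"
  shows "- k * H powr \<alpha> \<le> utility \<alpha> k (x - H)"
proof (cases "0 < x - H")
  case True
  then show ?thesis using k by (simp add: utility_def order_trans[of _ 0])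
next
  case False
  then have "\<bar>x - H\<bar> powr \<alpha> \<le> H powr \<alpha>" using x \<alpha> by (intro powr_mono2) auto
  then show ?thesis using False k by (simp add: utility_def)
qed

text \<open>In units of \<open>H\<close> the tangent line has slope \<open>K\<close>; this is its
  slope in \<open>x powr \<beta>\<close> for the price \<open>x\<close> itself.\<close>

definition exit_slope :: "real \<Rightarrow> real" where
  "exit_slope H = K * H powr (\<alpha> - \<beta>) * \<gamma> powr \<beta>"

lemma exit_slope_nonneg: "0 \<le> exit_slope H" using K_pos by (simp add: exit_slope_def)

lemma exit_payoff_bound:
  assumes H: "0 < H" and x: "0 \<le> x"
  shows "utility \<alpha> k (\<gamma> * x - H) \<le> exit_slope H * x powr \<beta> - k * H powr \<alpha>"
proof -
  have "utility \<alpha> k (\<gamma> * x - H) = utility \<alpha> k (H * (\<gamma> * x / H - 1))"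
    using H by (simp add: right_diff_distrib)
  also have "\<dots> \<le> H powr \<alpha> * (K * (\<gamma> * x / H) powr \<beta> - k)"
    unfolding utility_scale[OF H] using x \<gamma> H by (intro mult_left_mono utility_bound) auto
  also have "\<dots> = exit_slope H * x powr \<beta> - k * H powr \<alpha>"
    using x \<gamma> H by (simp add: exit_slope_def powr_divide powr_mult powr_diff field_simps)
  finally show ?thesis .
qed

lemma exit_payoff_at_target:
  assumes H: "0 < H"
  shows "utility \<alpha> k (\<gamma> * (c * H / \<gamma>) - H) = exit_slope H * (c * H / \<gamma>) powr \<beta> - k * H powr \<alpha>"
proof -
  have "utility \<alpha> k (\<gamma> * (c * H / \<gamma>) - H) = utility \<alpha> k (H * (c - 1))"
    using \<gamma> by (simp add: field_simps)
  also have "\<dots> = H powr \<alpha> * (c - 1) powr \<alpha>" unfolding utility_scale[OF H] using c by (simp add: utility_def)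
  also have "\<dots> = H powr \<alpha> * (K * c powr \<beta> - k)" using K_c_eq by simp
  also have "\<dots> = exit_slope H * (c * H / \<gamma>) powr \<beta> - k * H powr \<alpha>"
    using c \<gamma> H by (simp add: exit_slope_def powr_divide powr_mult powr_diff field_simps)
  finally show ?thesis .
qed

lemma entry_curve_W_eq_exit:
  assumes "0 \<le> p"
  shows "entry_curve_W \<alpha> \<beta> k c \<gamma> lam \<Psi> R p =
    exit_slope (lam * p + \<Psi> + R) * p powr \<beta> - k * (lam * p + \<Psi> + R) powr \<alpha>"
  using assms \<gamma> by (simp add: entry_curve_W_def exit_slope_def K_def powr_mult)

text \<open>In units of \<open>Z = R + \<Psi>\<close> the reference point becomes
  \<open>Z * (1 + A * y)\<close> with \<open>y = \<gamma> / Z * p\<close>, which is the origin of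
  the shape of \<open>f\<close>.\<close>

lemma entry_curve_W_eq_f:
  assumes p: "0 \<le> p" and R: "0 < R" "0 \<le> \<Psi>"
  shows "entry_curve_W \<alpha> \<beta> k c \<gamma> lam \<Psi> R p = (R + \<Psi>) powr \<alpha> * f ((\<gamma> / (R + \<Psi>)) powr \<beta> * p powr \<beta>)"
proof -
  define Z where "Z = R + \<Psi>"
  have Z: "0 < Z" using R by (simp add: Z_def)
  define y where "y = \<gamma> / Z * p"
  have y: "0 \<le> y" using p \<gamma> Z by (simp add: y_def)
  have x: "(\<gamma> / Z) powr \<beta> * p powr \<beta> = y powr \<beta>" unfolding y_def powr_mult ..
  have root: "(y powr \<beta>) powr (1 / \<beta>) = y" using y \<beta>_pos by (simp add: powr_powr)
  have H: "lam * p + \<Psi> + R = Z * (1 + A * y)"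
    using Z \<gamma> by (simp add: y_def A_def Z_def field_simps)
  have gp: "\<gamma> * p = Z * y" using Z by (simp add: y_def)
  have Zpow: "Z powr (\<alpha> - \<beta>) * Z powr \<beta> = Z powr \<alpha>" by (simp flip: powr_add)
  have "entry_curve_W \<alpha> \<beta> k c \<gamma> lam \<Psi> R p =
      K * (Z powr (\<alpha> - \<beta>) * Z powr \<beta>) * (1 + A * y) powr (- m) * y powr \<beta> - k * Z powr \<alpha> * (1 + A * y) powr \<alpha>"
    unfolding entry_curve_W_def H gp K_def m_def by (simp add: powr_mult)
  also have "\<dots> = Z powr \<alpha> * f (y powr \<beta>)"
    unfolding Zpow f_def root by (simp add: algebra_simps)
  finally show ?thesis unfolding x Z_def[symmetric] .
qed

end


section \<open>The exit and entry problems\<close>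

context gbm_power begin

text \<open>A nonnegative slope \<open>d\<close> turns the bound on the moment of order \<beta> into
  the bound by \<open>V\<close>. The lower bound \<open>L\<close> secures integrability, so that the
  expectation is not a default value.\<close>

lemma stopped_payoff_upper:
  assumes \<tau>: "stopping_time F \<tau>" and G: "G \<in> borel_measurable borel" and d: "0 \<le> d"
    and upper: "\<And>x. 0 \<le> x \<Longrightarrow> G x \<le> V + d * (x powr \<beta> - p powr \<beta>)"
    and lower: "\<And>x. 0 \<le> x \<Longrightarrow> L \<le> G x"
  shows "expectation (\<lambda>\<omega>. G (price_at X \<tau> \<omega>)) \<le> V"
proof -
  note pm = price_at_moment[OF \<tau>]
  have m: "(\<lambda>\<omega>. G (price_at X \<tau> \<omega>)) \<in> borel_measurable M"
    by (rule measurable_compose[OF pm(1) G])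
  let ?U = "\<lambda>\<omega>. V + d * (price_at X \<tau> \<omega> powr \<beta> - p powr \<beta>)"
  have iU: "integrable M ?U" using pm(2) by simp
  have int: "integrable M (\<lambda>\<omega>. G (price_at X \<tau> \<omega>))"
  proof (rule Bochner_Integration.integrable_bound)
    show "integrable M (\<lambda>\<omega>. \<bar>?U \<omega>\<bar> + \<bar>L\<bar>)" using iU by simp
    show "AE \<omega> in M. norm (G (price_at X \<tau> \<omega>)) \<le> norm (\<bar>?U \<omega>\<bar> + \<bar>L\<bar>)"
      using AE_nice
    proof eventually_elim
      case (elim \<omega>)
      from upper[OF price_at_nonneg[OF elim, of \<tau>]] lower[OF price_at_nonneg[OF elim, of \<tau>]]
      show ?case by (simp add: abs_le_iff) linarith
    qed
  qed (rule m)
  have "expectation (\<lambda>\<omega>. G (price_at X \<tau> \<omega>)) \<le> expectation ?U"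
  proof (rule integral_mono_AE[OF int iU])
    show "AE \<omega> in M. G (price_at X \<tau> \<omega>) \<le> ?U \<omega>"
      using AE_nice by eventually_elim (rule upper[OF price_at_nonneg])
  qed
  also have "\<dots> = V + d * (expectation (\<lambda>\<omega>. price_at X \<tau> \<omega> powr \<beta>) - p powr \<beta>)"
    using pm(2) by (simp add: prob_space)
  also have "\<dots> \<le> V" using mult_nonneg_nonpos[OF d, of "expectation (\<lambda>\<omega>. price_at X \<tau> \<omega> powr \<beta>) - p powr \<beta>"] pm(3) by simp
  finally show ?thesis .
qed

lemma stopped_payoff_const:
  assumes \<tau>: "stopping_time F \<tau>" and G: "G \<in> borel_measurable borel"
    and eq: "AE \<omega> in M. price_at X \<tau> \<omega> = a"
  shows "expectation (\<lambda>\<omega>. G (price_at X \<tau> \<omega>)) = (G a :: real)"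
proof -
  have "expectation (\<lambda>\<omega>. G (price_at X \<tau> \<omega>)) = expectation (\<lambda>_. G a)"
    using eq by (intro integral_cong_AE measurable_compose[OF price_at_moment(1)[OF \<tau>] G]) (auto elim!: eventually_mono)
  then show ?thesis by (simp add: prob_space)
qed

text \<open>The stopped payoff is \<open>G a\<close> on the hitting event and \<open>G 0\<close> off
  it; \<open>G 0 \<le> G a\<close> lets the lower bound on the hitting probability be
  inserted.\<close>

lemma stopped_payoff_from_below:
  fixes G :: "real \<Rightarrow> real"
  assumes A: "closed A" "a \<in> A" "A \<subseteq> {a..}" and pa: "p < a"
    and G: "G \<in> borel_measurable borel" "G 0 \<le> G a"
  shows "G 0 + (G a - G 0) * (p / a) powr \<beta> \<le> expectation (\<lambda>\<omega>. G (price_at X (first_time X A) \<omega>))"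
proof -
  let ?\<tau> = "first_time X A"
  have \<tau>: "stopping_time F ?\<tau>" using A by (intro first_time_stopping_time) auto
  have [measurable]: "?\<tau> \<in> borel_measurable M" by (rule stopping_time_measurable[OF \<tau>])
  let ?E = "{\<omega> \<in> space M. ?\<tau> \<omega> < \<top>}"
  note hit = first_time_from_below[OF A pa]
  have iE: "integrable M (indicat_real ?E)"
    by (intro integrable_real_indicator) (auto simp: less_top[symmetric])
  have "expectation (\<lambda>\<omega>. G (price_at X ?\<tau> \<omega>)) = expectation (\<lambda>\<omega>. G 0 + (G a - G 0) * indicat_real ?E \<omega>)"
  proof (rule integral_cong_AE)
    show "(\<lambda>\<omega>. G (price_at X ?\<tau> \<omega>)) \<in> borel_measurable M"
      by (rule measurable_compose[OF price_at_moment(1)[OF \<tau>] G(1)])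
    show "AE \<omega> in M. G (price_at X ?\<tau> \<omega>) = G 0 + (G a - G 0) * indicat_real ?E \<omega>"
      using hit(1) AE_space by eventually_elim (simp add: indicator_def)
  qed measurable
  also have "\<dots> = G 0 + (G a - G 0) * prob ?E"
    using iE by (subst Bochner_Integration.integral_add) (auto simp: prob_space)
  finally show ?thesis using mult_left_mono[OF hit(2), of "G a - G 0"] G(2) by simp
qed

end

locale entry_model = brownian M F B + entry_params \<alpha> \<beta> k c \<gamma> lam
  for M :: "'a measure" and F B and \<alpha> \<beta> k c \<gamma> lam +
  fixes \<mu> \<sigma> :: real and P :: "real \<Rightarrow> real \<Rightarrow> 'a \<Rightarrow> real"
  assumes \<sigma>_positive: "0 < \<sigma>" and exponent: "\<beta> = 1 - 2 * \<mu> / \<sigma>\<^sup>2"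
    and price: "\<And>p. p > 0 \<Longrightarrow> geometric_brownian_motion M F B \<mu> \<sigma> p (P p)"
begin

lemma price_process: "0 < p \<Longrightarrow> gbm_power M F B \<mu> \<sigma> p (P p) \<beta>"
  by unfold_locales (use \<sigma>_positive exponent price \<beta>_pos in auto)

text \<open>A start below break-even is also below the target \<open>b = c * H / \<gamma>\<close>.
  Waiting for \<open>b\<close> is optimal because the linear bound on the payoff is exact at the
  only two final prices, zero and \<open>b\<close>.\<close>

lemma exit_value_eq:
  assumes p: "0 < p" and H: "0 < H" "\<gamma> * p < H"
  shows "exit_value M F P \<alpha> k \<gamma> p H = exit_slope H * p powr \<beta> - k * H powr \<alpha>"
proof -
  interpret X: gbm_power M F B \<mu> \<sigma> p "P p" \<beta> by (rule price_process[OF p])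
  let ?V = "exit_slope H * p powr \<beta> - k * H powr \<alpha>"
  let ?G = "\<lambda>x. utility \<alpha> k (\<gamma> * x - H)"
  define b where "b = c * H / \<gamma>"
  have "p < H / \<gamma>" using H(2) \<gamma> by (simp add: field_simps)
  also have "\<dots> < b" using c H \<gamma> by (simp add: b_def divide_strict_right_mono)
  finally have pb: "p < b" .
  have b: "0 < b" using p pb by simp
  have Gm: "?G \<in> borel_measurable borel" by measurable
  have upper: "expectation (\<lambda>\<omega>. ?G (price_at (P p) \<tau> \<omega>)) \<le> ?V" if "stopping_time F \<tau>" for \<tau>
  proof (rule X.stopped_payoff_upper[OF that Gm exit_slope_nonneg[of H]])
    fix x :: real assume x: "0 \<le> x"
    show "?G x \<le> ?V + exit_slope H * (x powr \<beta> - p powr \<beta>)"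
      using exit_payoff_bound[OF H(1) x] by (simp add: algebra_simps)
    show "- k * H powr \<alpha> \<le> ?G x" using utility_lower[OF H(1), of "\<gamma> * x"] x \<gamma> by simp
  qed
  let ?\<tau> = "first_time (P p) {b..}"
  have \<tau>: "stopping_time F ?\<tau>" by (rule X.first_time_stopping_time) auto
  have G0: "?G 0 = - k * H powr \<alpha>" using H by (simp add: utility_def)
  have Gb: "?G b = exit_slope H * b powr \<beta> - k * H powr \<alpha>"
    unfolding b_def by (rule exit_payoff_at_target[OF H(1)])
  have "?G 0 + (?G b - ?G 0) * (p / b) powr \<beta> \<le> expectation (\<lambda>\<omega>. ?G (price_at (P p) ?\<tau> \<omega>))"
    by (rule X.stopped_payoff_from_below[OF _ _ _ pb Gm]) (use exit_slope_nonneg[of H] in \<open>auto simp only: G0 Gb intro!: mult_nonneg_nonneg, auto\<close>)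
  moreover have "?G 0 + (?G b - ?G 0) * (p / b) powr \<beta> = ?V"
    unfolding G0 Gb using b p by (simp add: powr_divide)
  ultimately have lower: "?V \<le> expectation (\<lambda>\<omega>. ?G (price_at (P p) ?\<tau> \<omega>))" by simp
  have "(SUP \<nu>\<in>{\<nu>. stopping_time F \<nu>}. expectation (\<lambda>\<omega>. ?G (price_at (P p) \<nu> \<omega>))) = ?V"
    by (rule cSup_eq_maximum) (use upper lower \<tau> in \<open>auto intro!: image_eqI[of _ _ ?\<tau>] antisym\<close>)
  then show ?thesis using p by (simp add: exit_value_def)
qed

text \<open>With the reference point \<open>lam * p + \<Psi> + R\<close> the start is always below
  break-even, as \<open>\<gamma> \<le> lam\<close> and \<open>R > 0\<close>. The price zero falls
  under the separate convention of \<open>exit_value\<close>, which agrees with the formula.\<close>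

lemma entry_payoff_eq:
  assumes p: "0 \<le> p" and R: "0 < R" "0 \<le> \<Psi>"
  shows "entry_payoff M F P \<alpha> k \<gamma> lam \<Psi> R p =
    max ((R + \<Psi>) powr \<alpha> * f ((\<gamma> / (R + \<Psi>)) powr \<beta> * p powr \<beta>)) (- k * R powr \<alpha>)"
proof -
  have uR: "utility \<alpha> k (- R) = - k * R powr \<alpha>" using R by (simp add: utility_def)
  have "exit_value M F P \<alpha> k \<gamma> p (lam * p + \<Psi> + R) = entry_curve_W \<alpha> \<beta> k c \<gamma> lam \<Psi> R p"
  proof (cases "p = 0")
    case True
    have "0 < \<Psi> + R" using R by simp
    then show ?thesis using True R by (simp add: exit_value_def utility_def entry_curve_W_def add.commute)
  next
    case False
    then have p0: "0 < p" using p by simp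
    have "\<gamma> * p \<le> lam * p" using \<gamma> lam p0 by (intro mult_right_mono) auto
    then have "\<gamma> * p < lam * p + \<Psi> + R" using R by simp
    moreover have "0 < lam * p + \<Psi> + R" using lam p0 R by (intro add_nonneg_pos add_nonneg_nonneg) auto
    ultimately show ?thesis
      using exit_value_eq[OF p0] entry_curve_W_eq_exit[OF p] by simp
  qed
  then show ?thesis unfolding entry_payoff_def uR entry_curve_W_eq_f[OF p R] by simp
qed

lemma f_measurable [measurable]: "f \<in> borel_measurable borel"
  unfolding f_def[abs_def] by measurable

text \<open>Measurability concerns the whole line, so the convention for negative prices has to be
  written out as well.\<close>

lemma entry_payoff_measurable:
  assumes R: "0 < R" "0 \<le> \<Psi>"
  shows "entry_payoff M F P \<alpha> k \<gamma> lam \<Psi> R \<in> borel_measurable borel"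
proof -
  have "entry_payoff M F P \<alpha> k \<gamma> lam \<Psi> R = (\<lambda>p. if 0 \<le> p
      then max ((R + \<Psi>) powr \<alpha> * f ((\<gamma> / (R + \<Psi>)) powr \<beta> * p powr \<beta>)) (- k * R powr \<alpha>)
      else max (utility \<alpha> k (- (lam * p + \<Psi> + R))) (utility \<alpha> k (- R)))"
    using entry_payoff_eq[OF _ R] by (auto simp: entry_payoff_def exit_value_def)
  also have "\<dots> \<in> borel_measurable borel" by measurable
  finally show ?thesis .
qed

lemma optimal_entryI:
  assumes p: "0 < p" and R: "0 < R" "0 \<le> \<Psi>" and \<tau>: "stopping_time F \<tau>" and d: "0 \<le> d"
    and upper: "\<And>x. 0 \<le> x \<Longrightarrow> entry_payoff M F P \<alpha> k \<gamma> lam \<Psi> R x \<le> V + d * (x powr \<beta> - p powr \<beta>)"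
    and attained: "V \<le> entry_objective M F P \<alpha> k \<gamma> lam \<Psi> R p \<tau>"
  shows "optimal_entry M F P \<alpha> k \<gamma> lam \<Psi> R p \<tau>" "entry_value M F P \<alpha> k \<gamma> lam \<Psi> R p = V"
proof -
  interpret X: gbm_power M F B \<mu> \<sigma> p "P p" \<beta> by (rule price_process[OF p])
  have le: "entry_objective M F P \<alpha> k \<gamma> lam \<Psi> R p \<nu> \<le> V" if "stopping_time F \<nu>" for \<nu>
    unfolding entry_objective_def
    by (rule X.stopped_payoff_upper[OF that entry_payoff_measurable[OF R] d upper, of "- k * R powr \<alpha>"])
      (use entry_payoff_eq[OF _ R] in auto)
  have eq: "entry_objective M F P \<alpha> k \<gamma> lam \<Psi> R p \<tau> = V" using le[OF \<tau>] attained by simp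
  show val: "entry_value M F P \<alpha> k \<gamma> lam \<Psi> R p = V"
    unfolding entry_value_def
    by (rule cSup_eq_maximum) (use le eq \<tau> in \<open>auto intro!: image_eqI[of _ _ \<tau>]\<close>)
  show "optimal_entry M F P \<alpha> k \<gamma> lam \<Psi> R p \<tau>"
    unfolding optimal_entry_def val using \<tau> eq by simp
qed

end

text \<open>Entry costs \<open>\<Psi>\<close>, \<open>R\<close>; prices are rescaled by \<open>x = ratio * p\<^sup>\<beta>\<close>, payoffs by \<open>amount\<close>, and \<open>q\<close> is the
  rescaled loss from never entering.\<close>
locale entry_problem = entry_model +
  fixes \<Psi> R :: real
  assumes R: "0 < R" and \<Psi>: "0 \<le> \<Psi>"
begin

definition "amount = (R + \<Psi>) powr \<alpha>"
definition "ratio = (\<gamma> / (R + \<Psi>)) powr \<beta>"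
definition "\<rho> = (1 + \<Psi> / R) powr \<alpha>"
definition "q = k / \<rho>"

lemma \<rho>_ge_1: "1 \<le> \<rho>" using R \<Psi> \<alpha> by (simp add: \<rho>_def ge_one_powr_ge_zero)
lemma q_bounds: "0 < q" "q \<le> k" using \<rho>_ge_1 k by (auto simp: q_def field_simps)
lemma amount_pos: "0 < amount" using R \<Psi> by (simp add: amount_def)
lemma ratio_pos: "0 < ratio" using R \<Psi> \<gamma> by (simp add: ratio_def)

lemma amount_q: "amount * q = k * R powr \<alpha>"
proof -
  have "R + \<Psi> = R * (1 + \<Psi> / R)" using R by (simp add: field_simps)
  then have "amount = R powr \<alpha> * \<rho>" by (simp add: amount_def \<rho>_def powr_mult)
  then show ?thesis using \<rho>_ge_1 by (simp add: q_def)
qed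

abbreviation "G \<equiv> entry_payoff M F P \<alpha> k \<gamma> lam \<Psi> R"
abbreviation "W \<equiv> entry_curve_W \<alpha> \<beta> k c \<gamma> lam \<Psi> R"
abbreviation "V \<equiv> entry_value M F P \<alpha> k \<gamma> lam \<Psi> R"

lemma max_amount: "max (amount * x) (- k * R powr \<alpha>) = amount * max x (- q)"
proof -
  have "- k * R powr \<alpha> = amount * (- q)" using amount_q by simp
  then show ?thesis using amount_pos by (simp only: max_mult_distrib_left) simp
qed

lemma G_eq: "0 \<le> p \<Longrightarrow> G p = amount * max (f (ratio * p powr \<beta>)) (- q)"
  using entry_payoff_eq[OF _ R \<Psi>] max_amount by (simp add: amount_def ratio_def)

lemma W_eq: "0 \<le> p \<Longrightarrow> W p = amount * f (ratio * p powr \<beta>)"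
  using entry_curve_W_eq_f[OF _ R \<Psi>] by (simp add: amount_def ratio_def)

lemma scaled_payoff_g2_eq:
  "scaled_payoff_g2 \<alpha> \<beta> k c \<gamma> lam \<Psi> R = (\<lambda>\<theta>. amount * max (f (ratio * \<theta>)) (- q))"
  unfolding scaled_payoff_g2_def scaled_payoff_f_eq max_amount[symmetric]
  unfolding amount_def ratio_def ..

definition price_of :: "real \<Rightarrow> real" where
  "price_of x = (R + \<Psi>) / \<gamma> * x powr (1 / \<beta>)"

lemma price_of_nonneg: "0 \<le> price_of x" using R \<Psi> \<gamma> by (simp add: price_of_def)

lemma price_of_pos: "0 < x \<Longrightarrow> 0 < price_of x" using R \<Psi> \<gamma> by (simp add: price_of_def)

lemma ratio_price_of: "0 \<le> x \<Longrightarrow> ratio * price_of x powr \<beta> = x"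
proof -
  assume x: "0 \<le> x"
  have "ratio * price_of x powr \<beta> = ((\<gamma> / (R + \<Psi>)) * ((R + \<Psi>) / \<gamma>)) powr \<beta> * (x powr (1 / \<beta>)) powr \<beta>"
    unfolding ratio_def price_of_def powr_mult by simp
  also have "(\<gamma> / (R + \<Psi>)) * ((R + \<Psi>) / \<gamma>) = 1" using R \<Psi> \<gamma> by simp
  finally show ?thesis using x \<beta>_pos by (simp add: powr_powr)
qed

lemma le_price_of_iff: "0 \<le> x \<Longrightarrow> 0 \<le> p \<Longrightarrow> p \<le> price_of x \<longleftrightarrow> ratio * p powr \<beta> \<le> x"
proof -
  assume x: "0 \<le> x" and p: "0 \<le> p"
  have "p \<le> price_of x \<longleftrightarrow> p powr \<beta> \<le> price_of x powr \<beta>"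
    using p price_of_nonneg[of x] \<beta>_pos
    by (metis linorder_not_less powr_less_mono2 powr_mono2 less_imp_le)
  also have "\<dots> \<longleftrightarrow> ratio * p powr \<beta> \<le> ratio * price_of x powr \<beta>" using ratio_pos by simp
  finally show ?thesis unfolding ratio_price_of[OF x] .
qed

lemma price_of_le_iff: "0 \<le> x \<Longrightarrow> 0 \<le> p \<Longrightarrow> price_of x \<le> p \<longleftrightarrow> x \<le> ratio * p powr \<beta>"
proof -
  assume x: "0 \<le> x" and p: "0 \<le> p"
  have "price_of x \<le> p \<longleftrightarrow> price_of x powr \<beta> \<le> p powr \<beta>"
    using p price_of_nonneg[of x] \<beta>_pos
    by (metis linorder_not_less powr_less_mono2 powr_mono2 less_imp_le)
  also have "\<dots> \<longleftrightarrow> ratio * price_of x powr \<beta> \<le> ratio * p powr \<beta>" using ratio_pos by simp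
  finally show ?thesis unfolding ratio_price_of[OF x] .
qed

text \<open>Minimality: \<open>I\<close> is strictly increasing up to \<open>x1\<close>, so no
  smaller solution exists.\<close>

lemma is_lower_thresholdI:
  assumes x1: "0 \<le> x1" "I x1 = - q" and inc: "increasing_upto x1"
  shows "is_lower_threshold \<alpha> \<beta> k c \<gamma> lam \<Psi> R (price_of x1)"
  unfolding is_lower_threshold_def
proof (intro exI[of _ x1] conjI allI impI)
  have \<rho>0: "0 < \<rho>" using \<rho>_ge_1 by simp
  show "lower_threshold_eq \<alpha> \<beta> k c \<gamma> lam \<Psi> R x1"
    using lower_threshold_eq_iff[OF x1(1) \<rho>_def \<rho>0] x1(2) by (simp add: q_def)
  fix y assume y: "0 \<le> y" "lower_threshold_eq \<alpha> \<beta> k c \<gamma> lam \<Psi> R y"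
  then have "I y = - q" using lower_threshold_eq_iff[OF y(1) \<rho>_def \<rho>0] by (simp add: q_def)
  then show "x1 \<le> y" using I_strict_mono[OF inc y(1), of x1] x1(2) by (cases "x1 \<le> y") auto
qed (use x1 in \<open>auto simp: price_of_def\<close>)

text \<open>\<open>T\<close> is the trading region in prices and \<open>S\<close> its image in the
  rescaled variable. The supergradient of the majorant at the start gives the upper bound. It is
  attained inside the region at once, from below because the line is exact at the final prices zero
  and \<open>price_of x1\<close>, and from above because the price falls to
  \<open>price_of x2\<close> almost surely.\<close>

lemma trading_region_solution:
  assumes tm: "tangent_majorant f fd cl S x1 q"
    and T: "closed T" "price_of x1 \<in> T" "T \<subseteq> {price_of x1..}" "\<And>p. 0 \<le> p \<Longrightarrow> p \<in> T \<longleftrightarrow> ratio * p powr \<beta> \<in> S"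
    and above: "\<And>p. price_of x1 \<le> p \<Longrightarrow> p \<notin> T \<Longrightarrow>
      cl (ratio * p powr \<beta>) = x2 \<and> price_of x2 \<in> T \<and> T \<subseteq> {..price_of x2} \<and> 0 < x2 \<and> price_of x2 < p"
    and p: "0 < p"
  defines "h \<equiv> tangent_majorant.majorant f fd cl"
  shows "optimal_entry M F P \<alpha> k \<gamma> lam \<Psi> R p (first_time (P p) T)"
    "V p = amount * h (ratio * p powr \<beta>)"
    "V p = (if p \<in> T then W p else if p < price_of x1
      then (W (price_of x1) + k * R powr \<alpha>) * (p powr \<beta> / price_of x1 powr \<beta>) - k * R powr \<alpha>
      else W (price_of x2))"
proof -
  interpret X: gbm_power M F B \<mu> \<sigma> p "P p" \<beta> by (rule price_process[OF p])
  interpret tm: tangent_majorant f fd cl S x1 q by (rule tm)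
  let ?x = "ratio * p powr \<beta>" and ?p1 = "price_of x1"
  \<comment> \<open>The slope of the majorant at the start, converted from the rescaled variable to
    \<open>p powr \<beta>\<close>.\<close>
  let ?d = "amount * fd (cl ?x) * ratio"
  let ?\<tau> = "first_time (P p) T"
  have x: "0 \<le> ?x" using ratio_pos by simp
  have x1: "0 \<le> x1" using tm.S by auto
  have \<tau>: "stopping_time F ?\<tau>" using T by (intro X.first_time_stopping_time) auto
  have d: "0 \<le> ?d" using amount_pos ratio_pos tm.fd_nonneg[OF tm.cl_in[OF x]] by simp
  have upper: "G y \<le> amount * h ?x + ?d * (y powr \<beta> - p powr \<beta>)" if y: "0 \<le> y" for y
  proof -
    have y': "0 \<le> ratio * y powr \<beta>" using ratio_pos by simp
    have "max (f (ratio * y powr \<beta>)) (- q) \<le> h (ratio * y powr \<beta>)"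
      unfolding h_def by (rule tm.majorant_ge[OF y'])
    also have "\<dots> \<le> h ?x + fd (cl ?x) * (ratio * y powr \<beta> - ?x)"
      unfolding h_def by (rule tm.majorant_supergradient[OF x y'])
    finally have "G y \<le> amount * (h ?x + fd (cl ?x) * (ratio * y powr \<beta> - ?x))"
      unfolding G_eq[OF y] using amount_pos by (intro mult_left_mono) auto
    then show ?thesis by (simp add: algebra_simps)
  qed
  have Gm: "G \<in> borel_measurable borel" by (rule entry_payoff_measurable[OF R \<Psi>])
  have G_on: "G y = amount * f (ratio * y powr \<beta>)" if "0 \<le> y" "y \<in> T" for y
    using G_eq[OF that(1)] tm.f_ge_on T(4)[OF that(1)] that(2) by (simp add: max_absorb1)
  have "amount * h ?x \<le> entry_objective M F P \<alpha> k \<gamma> lam \<Psi> R p ?\<tau> \<and>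
    amount * h ?x = (if p \<in> T then W p else if p < ?p1
      then (W ?p1 + k * R powr \<alpha>) * (p powr \<beta> / ?p1 powr \<beta>) - k * R powr \<alpha> else W (price_of x2))"
  proof -
    consider "p \<in> T" | "p \<notin> T" "p < ?p1" | "p \<notin> T" "?p1 \<le> p" by linarith
    then show ?thesis
    proof cases
      case 1
      have "h ?x = f ?x" unfolding h_def using tm.cl_mem T(4) 1 p by (simp add: tm.majorant_def)
      moreover have "entry_objective M F P \<alpha> k \<gamma> lam \<Psi> R p ?\<tau> = G p"
        unfolding entry_objective_def
        by (rule X.stopped_payoff_const[OF \<tau> Gm X.AE_first_time_immediate[OF 1]])
      ultimately show ?thesis using G_on[of p] W_eq[of p] 1 p by simp
    next
      case 2
      have p1: "0 < ?p1" using 2 p by simp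
      have x1p: "x1 \<noteq> 0" using p1 by (auto simp: price_of_def)
      have sx1: "ratio * ?p1 powr \<beta> = x1" by (rule ratio_price_of[OF x1])
      have "?x < x1" using price_of_le_iff[OF x1, of p] 2 p by simp
      then have cl: "cl ?x = x1" using tm.cl_low[OF x] by simp
      \<comment> \<open>At price zero the rescaled payoff of entering is
        \<open>- k \<le> - q\<close>, so staying out decides the maximum.\<close>
      have G0: "G 0 = - (k * R powr \<alpha>)"
        using G_eq[of 0] q_bounds(2) amount_q by (simp add: f_0 max_absorb2)
      have Gp1: "G ?p1 = amount * f x1" using G_on[OF _ T(2)] p1 sx1 by simp
      have hx: "amount * h ?x = - (k * R powr \<alpha>) + (amount * f x1 + k * R powr \<alpha>) * (?x / x1)"
      proof -
        have "h ?x = - q + fd x1 * ?x"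
          unfolding h_def tm.majorant_def cl using tm.intercept by (simp add: algebra_simps)
        also have "fd x1 = (f x1 + q) / x1" using tm.intercept x1p by (simp add: field_simps)
        finally have hx': "h ?x = - q + (f x1 + q) / x1 * ?x" .
        show ?thesis unfolding hx' amount_q[symmetric] by (simp add: algebra_simps add_divide_distrib)
      qed
      have share: "?x / x1 = p powr \<beta> / ?p1 powr \<beta>"
      proof -
        have "?x / (ratio * ?p1 powr \<beta>) = p powr \<beta> / ?p1 powr \<beta>" using ratio_pos by simp
        then show ?thesis unfolding sx1 .
      qed
      have "- q \<le> f x1" by (rule tm.f_ge_on[OF tm.S(2)])
      then have "G 0 \<le> G ?p1"
        unfolding G0 Gp1 amount_q[symmetric] using mult_left_mono[of "- q" "f x1" amount] amount_pos by simp
      from X.stopped_payoff_from_below[OF T(1-3) 2(2) Gm this]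
      have "amount * h ?x \<le> entry_objective M F P \<alpha> k \<gamma> lam \<Psi> R p ?\<tau>"
        unfolding entry_objective_def hx share G0 Gp1 using p p1 by (simp add: powr_divide)
      moreover have "amount * h ?x = (W ?p1 + k * R powr \<alpha>) * (p powr \<beta> / ?p1 powr \<beta>) - k * R powr \<alpha>"
        unfolding hx share using W_eq[of ?p1] p1 sx1 by simp
      ultimately show ?thesis using 2 by simp
    next
      case 3
      note ab = above[OF 3(2,1)]
      have p2: "0 < price_of x2" using ab by (intro price_of_pos) auto
      have x1x: "x1 \<le> ?x" using price_of_le_iff[OF x1, of p] 3 p by simp
      have "?x \<notin> S" using T(4)[of p] 3 p by simp
      then have "h ?x = f x2"
        unfolding h_def tm.majorant_def using tm.cl_high[OF x1x] ab by simp
      moreover have sx2: "ratio * price_of x2 powr \<beta> = x2" using ab by (intro ratio_price_of) auto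
      moreover have "entry_objective M F P \<alpha> k \<gamma> lam \<Psi> R p ?\<tau> = G (price_of x2)"
        unfolding entry_objective_def
        by (rule X.stopped_payoff_const[OF \<tau> Gm X.first_time_from_above[OF T(1)]]) (use ab p2 in auto)
      moreover have "G (price_of x2) = amount * f (ratio * price_of x2 powr \<beta>)" using ab p2 by (intro G_on) auto
      ultimately show ?thesis using 3 p2 W_eq[of "price_of x2"] by simp
    qed
  qed
  then show "optimal_entry M F P \<alpha> k \<gamma> lam \<Psi> R p ?\<tau>" "V p = amount * h ?x"
    "V p = (if p \<in> T then W p else if p < ?p1
      then (W ?p1 + k * R powr \<alpha>) * (p powr \<beta> / ?p1 powr \<beta>) - k * R powr \<alpha> else W (price_of x2))"
    using optimal_entryI[OF p R \<Psi> \<tau> d upper] by auto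
qed

lemma value_is_majorant:
  assumes tm: "tangent_majorant f fd cl S x1 q"
    and V: "\<And>p. 0 < p \<Longrightarrow> V p = amount * tangent_majorant.majorant f fd cl (ratio * p powr \<beta>)"
  shows "\<exists>g2bar. smallest_concave_majorant_on {0..} (scaled_payoff_g2 \<alpha> \<beta> k c \<gamma> lam \<Psi> R) g2bar \<and>
    (\<forall>p>0. V p = g2bar (p powr \<beta>))"
  using smallest_concave_majorant_rescale[OF tangent_majorant.smallest_majorant[OF tm] amount_pos ratio_pos] V
  unfolding scaled_payoff_g2_eq by blast

lemma cheap_solution:
  assumes cheap: "k * A powr \<beta> \<le> K"
  shows "\<exists>g2bar. smallest_concave_majorant_on {0..} (scaled_payoff_g2 \<alpha> \<beta> k c \<gamma> lam \<Psi> R) g2bar \<and>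
      (\<forall>p>0. V p = g2bar (p powr \<beta>))"
    "\<exists>p1\<ge>0. is_lower_threshold \<alpha> \<beta> k c \<gamma> lam \<Psi> R p1 \<and>
      (\<forall>p>0. optimal_entry M F P \<alpha> k \<gamma> lam \<Psi> R p (first_time (P p) {p1..}) \<and>
        V p = (if p \<ge> p1 then W p else (W p1 + k * R powr \<alpha>) * (p powr \<beta> / p1 powr \<beta>) - k * R powr \<alpha>))"
proof -
  obtain x1 where x1: "0 \<le> x1" "I x1 = - q" using cheap_lower_threshold[OF cheap q_bounds] by blast
  note tm = cheap_tangent_majorant[OF cheap x1]
  \<comment> \<open>The region has no upper end, so no price lies above it and \<open>x2\<close>
    stays a free placeholder.\<close>
  note sol = trading_region_solution[OF tm, of "{price_of x1..}"]
  have mem: "p \<in> {price_of x1..} \<longleftrightarrow> ratio * p powr \<beta> \<in> {x1..}" if "0 \<le> p" for p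
    using price_of_le_iff[OF x1(1) that] by simp
  show "\<exists>g2bar. smallest_concave_majorant_on {0..} (scaled_payoff_g2 \<alpha> \<beta> k c \<gamma> lam \<Psi> R) g2bar \<and>
      (\<forall>p>0. V p = g2bar (p powr \<beta>))"
    by (rule value_is_majorant[OF tm sol(2)]) (use mem in auto)
  have "optimal_entry M F P \<alpha> k \<gamma> lam \<Psi> R p (first_time (P p) {price_of x1..}) \<and>
      V p = (if p \<ge> price_of x1 then W p else (W (price_of x1) + k * R powr \<alpha>) * (p powr \<beta> / price_of x1 powr \<beta>) - k * R powr \<alpha>)"
    if p: "0 < p" for p
    using sol(1)[OF _ _ _ mem _ p] sol(3)[OF _ _ _ mem _ p] by auto
  then show "\<exists>p1\<ge>0. is_lower_threshold \<alpha> \<beta> k c \<gamma> lam \<Psi> R p1 \<and>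
      (\<forall>p>0. optimal_entry M F P \<alpha> k \<gamma> lam \<Psi> R p (first_time (P p) {p1..}) \<and>
        V p = (if p \<ge> p1 then W p else (W p1 + k * R powr \<alpha>) * (p powr \<beta> / p1 powr \<beta>) - k * R powr \<alpha>))"
    using price_of_nonneg is_lower_thresholdI[OF x1 cheap_increasing[OF cheap]] by blast
qed

text \<open>At the maximiser the tangent is horizontal and its intercept is
  \<open>f x2 > - q\<close>, while at zero the intercept is \<open>- k \<le> - q\<close>; continuity
  yields the lower end of the region, strictly left of \<open>x2\<close>.\<close>

lemma costly_entering_solution:
  assumes x2: "0 < x2" "fd x2 = 0" "increasing_upto x2" "\<And>x. x2 \<le> x \<Longrightarrow> f x \<le> f x2"
    "\<And>x. 0 < x \<Longrightarrow> upper_threshold_eq \<alpha> \<beta> k c \<gamma> lam x \<longleftrightarrow> x = x2"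
    and enter: "- q < f x2"
  shows "\<exists>g2bar. smallest_concave_majorant_on {0..} (scaled_payoff_g2 \<alpha> \<beta> k c \<gamma> lam \<Psi> R) g2bar \<and>
      (\<forall>p>0. V p = g2bar (p powr \<beta>))"
    "\<exists>p1 p2. 0 \<le> p1 \<and> p1 < p2 \<and> is_lower_threshold \<alpha> \<beta> k c \<gamma> lam \<Psi> R p1 \<and>
      is_upper_threshold \<alpha> \<beta> k c \<gamma> lam \<Psi> R p2 \<and>
      (\<forall>p>0. optimal_entry M F P \<alpha> k \<gamma> lam \<Psi> R p (first_time (P p) {p1..p2}) \<and>
        V p = (if p > p2 then W p2 else if p \<ge> p1 then W p
          else (W p1 + k * R powr \<alpha>) * (p powr \<beta> / p1 powr \<beta>) - k * R powr \<alpha>))"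
proof -
  have Ix2: "I x2 = f x2" using x2(2) by (simp add: I_def)
  obtain x1 where x1: "0 \<le> x1" "x1 \<le> x2" "I x1 = - q"
    using IVT'[of I 0 "- q" x2] I_0 Ix2 q_bounds enter x2(1) continuous_on_subset[OF I_continuous, of "{0..x2}"] by auto
  have lt: "x1 < x2" using x1 Ix2 enter by (cases "x1 = x2") auto
  have tm: "tangent_majorant f fd (\<lambda>x. max x1 (min x2 x)) {x1..x2} x1 q"
    by (rule costly_tangent_majorant[OF x2(1-4) x1])
  let ?p1 = "price_of x1" and ?p2 = "price_of x2"
  have p12: "?p1 < ?p2"
    using R \<Psi> \<gamma> lt x1(1) \<beta>_pos by (simp add: price_of_def divide_strict_right_mono powr_less_mono2)
  have mem: "p \<in> {?p1..?p2} \<longleftrightarrow> ratio * p powr \<beta> \<in> {x1..x2}" if "0 \<le> p" for p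
    using price_of_le_iff[OF x1(1) that] le_price_of_iff[OF _ that, of x2] x2(1) by simp
  have above: "max x1 (min x2 (ratio * p powr \<beta>)) = x2 \<and> ?p2 \<in> {?p1..?p2} \<and> {?p1..?p2} \<subseteq> {..?p2} \<and> 0 < x2 \<and> ?p2 < p"
    if "?p1 \<le> p" "p \<notin> {?p1..?p2}" for p
  proof -
    have p: "?p2 < p" using that by simp
    moreover have "x2 \<le> ratio * p powr \<beta>"
      using price_of_le_iff[of x2 p] p x2(1) price_of_nonneg[of x2] by simp
    ultimately show ?thesis using p12 lt x2(1) by simp
  qed
  note sol = trading_region_solution[OF tm, of "{?p1..?p2}" x2]
  show "\<exists>g2bar. smallest_concave_majorant_on {0..} (scaled_payoff_g2 \<alpha> \<beta> k c \<gamma> lam \<Psi> R) g2bar \<and>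
      (\<forall>p>0. V p = g2bar (p powr \<beta>))"
    by (rule value_is_majorant[OF tm sol(2)[OF _ _ _ mem above]]) (use p12 in auto)
  have "optimal_entry M F P \<alpha> k \<gamma> lam \<Psi> R p (first_time (P p) {?p1..?p2}) \<and>
      V p = (if p > ?p2 then W ?p2 else if p \<ge> ?p1 then W p
          else (W ?p1 + k * R powr \<alpha>) * (p powr \<beta> / ?p1 powr \<beta>) - k * R powr \<alpha>)" if p: "0 < p" for p
    using sol(1)[OF _ _ _ mem above p] sol(3)[OF _ _ _ mem above p] p12 by auto
  moreover have "is_upper_threshold \<alpha> \<beta> k c \<gamma> lam \<Psi> R ?p2"
    unfolding is_upper_threshold_def price_of_def using x2(1,5) by blast
  moreover have "increasing_upto x1" using x2(3) x1(2) unfolding increasing_upto_def by auto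
  ultimately show "\<exists>p1 p2. 0 \<le> p1 \<and> p1 < p2 \<and> is_lower_threshold \<alpha> \<beta> k c \<gamma> lam \<Psi> R p1 \<and>
      is_upper_threshold \<alpha> \<beta> k c \<gamma> lam \<Psi> R p2 \<and>
      (\<forall>p>0. optimal_entry M F P \<alpha> k \<gamma> lam \<Psi> R p (first_time (P p) {p1..p2}) \<and>
        V p = (if p > p2 then W p2 else if p \<ge> p1 then W p
          else (W p1 + k * R powr \<alpha>) * (p powr \<beta> / p1 powr \<beta>) - k * R powr \<alpha>))"
    using price_of_nonneg p12 is_lower_thresholdI[OF x1(1,3)] by blast
qed

lemma never_entering_solution:
  assumes le: "\<And>x. 0 \<le> x \<Longrightarrow> f x \<le> - q"
  shows "\<exists>g2bar. smallest_concave_majorant_on {0..} (scaled_payoff_g2 \<alpha> \<beta> k c \<gamma> lam \<Psi> R) g2bar \<and>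
      (\<forall>p>0. V p = g2bar (p powr \<beta>))"
    "\<forall>p>0. optimal_entry M F P \<alpha> k \<gamma> lam \<Psi> R p (\<lambda>_. \<top>) \<and> V p = - k * R powr \<alpha>"
proof -
  have loss: "amount * max (f x) (- q) = - k * R powr \<alpha>" if "0 \<le> x" for x
    unfolding max_absorb2[OF le[OF that]] using amount_q by simp
  have G_const: "G x = - k * R powr \<alpha>" if "0 \<le> x" for x
    unfolding G_eq[OF that] by (rule loss) (use ratio_pos in simp)
  show never: "\<forall>p>0. optimal_entry M F P \<alpha> k \<gamma> lam \<Psi> R p (\<lambda>_. \<top>) \<and> V p = - k * R powr \<alpha>"
  proof (intro allI impI)
    fix p :: real assume p: "0 < p"
    have "entry_objective M F P \<alpha> k \<gamma> lam \<Psi> R p (\<lambda>_. \<top>) = expectation (\<lambda>_. G 0)"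
      by (simp add: entry_objective_def price_at_def)
    also have "\<dots> = - k * R powr \<alpha>" unfolding G_const[OF order_refl] by (simp add: prob_space)
    finally have obj: "- k * R powr \<alpha> \<le> entry_objective M F P \<alpha> k \<gamma> lam \<Psi> R p (\<lambda>_. \<top>)" by simp
    have "G x \<le> - k * R powr \<alpha> + 0 * (x powr \<beta> - p powr \<beta>)" if "0 \<le> x" for x
      unfolding G_const[OF that] by simp
    note opt = optimal_entryI[OF p R \<Psi> stopping_time_const order_refl this obj]
    show "optimal_entry M F P \<alpha> k \<gamma> lam \<Psi> R p (\<lambda>_. \<top>) \<and> V p = - k * R powr \<alpha>"
      by (rule conjI[OF opt])
  qed
  have "scaled_payoff_g2 \<alpha> \<beta> k c \<gamma> lam \<Psi> R \<theta> = - k * R powr \<alpha>" if "0 \<le> \<theta>" for \<theta>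
    unfolding scaled_payoff_g2_eq by (rule loss) (use that ratio_pos in simp)
  note const = smallest_concave_majorant_const[OF this]
  show "\<exists>g2bar. smallest_concave_majorant_on {0..} (scaled_payoff_g2 \<alpha> \<beta> k c \<gamma> lam \<Psi> R) g2bar \<and>
      (\<forall>p>0. V p = g2bar (p powr \<beta>))"
  proof (intro exI[of _ "\<lambda>_. - k * R powr \<alpha>"] conjI const allI impI)
    show "V p = - k * R powr \<alpha>" if "0 < p" for p using never that by blast
  qed
qed

end

section \<open>The critical ratio of the entry costs\<close>

context entry_model begin

lemma entry_problemI: "0 \<le> \<Psi> \<Longrightarrow> 0 < R \<Longrightarrow> entry_problem M F B \<alpha> \<beta> k c \<gamma> lam \<mu> \<sigma> P \<Psi> R"
  by unfold_locales

text \<open>Entering pays for some price exactly when the smallest loss \<open>v = - f x2\<close> in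
  rescaled units is below the loss \<open>k / (1 + \<Psi> / R) powr \<alpha>\<close> from staying
  out, and \<open>C\<close> is the ratio \<open>\<Psi> / R\<close> at which the two agree. It
  depends on \<open>f\<close> only, which involves neither \<open>\<Psi>\<close> nor
  \<open>R\<close>; \<open>v > 0\<close> keeps it finite and \<open>v < k\<close> makes it
  positive.\<close>

lemma costly_cases:
  assumes costly: "K < k * A powr \<beta>"
  obtains C x2 where "0 < C" "0 < x2" "fd x2 = 0" "increasing_upto x2" "\<And>x. x2 \<le> x \<Longrightarrow> f x \<le> f x2"
    "\<And>x. 0 < x \<Longrightarrow> upper_threshold_eq \<alpha> \<beta> k c \<gamma> lam x \<longleftrightarrow> x = x2"
    "\<And>\<Psi> R. 0 \<le> \<Psi> \<Longrightarrow> 0 < R \<Longrightarrow> \<Psi> < C * R \<longleftrightarrow> - (k / (1 + \<Psi> / R) powr \<alpha>) < f x2"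
proof -
  obtain x2 where x2: "0 < x2" "fd x2 = 0" "increasing_upto x2" "\<And>x. x2 \<le> x \<Longrightarrow> f x \<le> f x2"
    "\<And>x. 0 < x \<Longrightarrow> upper_threshold_eq \<alpha> \<beta> k c \<gamma> lam x \<longleftrightarrow> x = x2"
    using costly_upper_threshold[OF costly] by blast
  define v where "v = - f x2"
  have v: "0 < v" "v < k"
    using costly_f_negative[OF costly, of x2] f_increasing[OF x2(3), of 0 x2] x2(1) f_0 by (auto simp: v_def)
  define C where "C = (k / v) powr (1 / \<alpha>) - 1"
  have kv: "1 < k / v" using v by simp
  have C: "0 < C" using powr_less_mono2[of "1 / \<alpha>" 1 "k / v"] kv \<alpha> by (simp add: C_def)
  have "\<Psi> < C * R \<longleftrightarrow> - (k / (1 + \<Psi> / R) powr \<alpha>) < f x2" if \<Psi>: "0 \<le> \<Psi>" and R: "0 < R" for \<Psi> R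
  proof -
    let ?s = "1 + \<Psi> / R"
    have s: "0 < ?s" using \<Psi> R by (simp add: add_pos_nonneg)
    have "\<Psi> < C * R \<longleftrightarrow> ?s < (k / v) powr (1 / \<alpha>)" using R by (simp add: C_def field_simps)
    also have "\<dots> \<longleftrightarrow> ?s powr \<alpha> < k / v"
    proof
      assume "?s < (k / v) powr (1 / \<alpha>)"
      from powr_less_mono2[OF _ _ this, of \<alpha>] show "?s powr \<alpha> < k / v" using s \<alpha> kv by (simp add: powr_powr)
    next
      assume "?s powr \<alpha> < k / v"
      from powr_less_mono2[OF _ _ this, of "1 / \<alpha>"] show "?s < (k / v) powr (1 / \<alpha>)" using s \<alpha> by (simp add: powr_powr)
    qed
    also have "\<dots> \<longleftrightarrow> v < k / ?s powr \<alpha>"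
    proof -
      have "0 < ?s powr \<alpha>" using s by simp
      then show ?thesis using v by (simp add: less_divide_eq mult.commute)
    qed
    also have "\<dots> \<longleftrightarrow> - (k / ?s powr \<alpha>) < f x2" by (auto simp: v_def)
    finally show ?thesis .
  qed
  then show ?thesis using that[OF C x2] by blast
qed

end

theorem proposition4p7:
  fixes M :: "'a measure" and F :: "ennreal \<Rightarrow> 'a measure"
    and B :: "real \<Rightarrow> 'a \<Rightarrow> real" and P :: "real \<Rightarrow> real \<Rightarrow> 'a \<Rightarrow> real"
    and \<mu> \<sigma> \<alpha> \<beta> k c \<gamma> lam :: real
  assumes "prob_space M" and "usual_conditions M F" and "brownian_motion M F B"
    and "\<mu> \<ge> 0" and "\<sigma> > 0" and "\<beta> = 1 - 2 * \<mu> / \<sigma>\<^sup>2"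
    and "\<And>p. p > 0 \<Longrightarrow> geometric_brownian_motion M F B \<mu> \<sigma> p (P p)"
    and "lam \<ge> 1" and "0 < \<gamma>" and "\<gamma> \<le> 1" and "0 < \<alpha>" and "\<alpha> < 1" and "k > 1"
    and "c > 1" and "\<alpha> / \<beta> * c * (c - 1) powr (\<alpha> - 1) - (c - 1) powr \<alpha> - k = 0"
    and "\<alpha> \<le> \<beta>" and "\<beta> < 1"
  shows
    "(\<forall>\<Psi>\<ge>0. \<forall>R>0. \<exists>g2bar.
        smallest_concave_majorant_on {0..} (scaled_payoff_g2 \<alpha> \<beta> k c \<gamma> lam \<Psi> R) g2bar \<and>
        (\<forall>p>0. entry_value M F P \<alpha> k \<gamma> lam \<Psi> R p = g2bar (p powr \<beta>)))
     \<and>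
     (lam / \<gamma> \<le> (\<alpha> / (\<beta> * k) * c powr (1 - \<beta>) * (c - 1) powr (\<alpha> - 1)) powr (1 / \<beta>) \<longrightarrow>
       (\<forall>\<Psi>\<ge>0. \<forall>R>0. \<exists>p\<^sub>1\<ge>0.
          is_lower_threshold \<alpha> \<beta> k c \<gamma> lam \<Psi> R p\<^sub>1 \<and>
          (\<forall>p>0.
             optimal_entry M F P \<alpha> k \<gamma> lam \<Psi> R p (first_time (P p) {p\<^sub>1..}) \<and>
             entry_value M F P \<alpha> k \<gamma> lam \<Psi> R p =
               (if p \<ge> p\<^sub>1 then entry_curve_W \<alpha> \<beta> k c \<gamma> lam \<Psi> R p
                else (entry_curve_W \<alpha> \<beta> k c \<gamma> lam \<Psi> R p\<^sub>1 + k * R powr \<alpha>)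
                       * (p powr \<beta> / p\<^sub>1 powr \<beta>) - k * R powr \<alpha>))))
     \<and>
     (lam / \<gamma> > (\<alpha> / (\<beta> * k) * c powr (1 - \<beta>) * (c - 1) powr (\<alpha> - 1)) powr (1 / \<beta>) \<longrightarrow>
       (\<exists>C>0. \<forall>\<Psi>\<ge>0. \<forall>R>0.
          (\<Psi> < C * R \<longrightarrow>
            (\<exists>p\<^sub>1 p\<^sub>2. 0 \<le> p\<^sub>1 \<and> p\<^sub>1 < p\<^sub>2 \<and>
               is_lower_threshold \<alpha> \<beta> k c \<gamma> lam \<Psi> R p\<^sub>1 \<and>
               is_upper_threshold \<alpha> \<beta> k c \<gamma> lam \<Psi> R p\<^sub>2 \<and>
               (\<forall>p>0.
                  optimal_entry M F P \<alpha> k \<gamma> lam \<Psi> R p (first_time (P p) {p\<^sub>1..p\<^sub>2}) \<and>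
                  entry_value M F P \<alpha> k \<gamma> lam \<Psi> R p =
                    (if p > p\<^sub>2 then entry_curve_W \<alpha> \<beta> k c \<gamma> lam \<Psi> R p\<^sub>2
                     else if p \<ge> p\<^sub>1 then entry_curve_W \<alpha> \<beta> k c \<gamma> lam \<Psi> R p
                     else (entry_curve_W \<alpha> \<beta> k c \<gamma> lam \<Psi> R p\<^sub>1 + k * R powr \<alpha>)
                            * (p powr \<beta> / p\<^sub>1 powr \<beta>) - k * R powr \<alpha>)))) \<and>
          (\<Psi> \<ge> C * R \<longrightarrow>
            (\<forall>p>0.
               optimal_entry M F P \<alpha> k \<gamma> lam \<Psi> R p (\<lambda>_. \<top>) \<and>
               entry_value M F P \<alpha> k \<gamma> lam \<Psi> R p = - k * R powr \<alpha>))))"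
proof -
  interpret prob_space M by fact
  interpret entry_model M F B \<alpha> \<beta> k c \<gamma> lam \<mu> \<sigma> P
    by unfold_locales (use assms in auto)
  show ?thesis
  proof (cases "k * A powr \<beta> \<le> K")
    case True
    have "\<exists>g2bar. smallest_concave_majorant_on {0..} (scaled_payoff_g2 \<alpha> \<beta> k c \<gamma> lam \<Psi> R) g2bar \<and>
        (\<forall>p>0. entry_value M F P \<alpha> k \<gamma> lam \<Psi> R p = g2bar (p powr \<beta>))" if "0 \<le> \<Psi>" "0 < R" for \<Psi> R
      by (rule entry_problem.cheap_solution(1)[OF entry_problemI[OF that] True])
    then show ?thesis
      using entry_problem.cheap_solution(2)[OF entry_problemI True] True cheap_iff
      by (intro conjI impI allI) auto
  next
    case False
    then have costly: "K < k * A powr \<beta>" by simp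
    obtain C x2 where C: "0 < C" and x2: "0 < x2" "fd x2 = 0" "increasing_upto x2" "\<And>x. x2 \<le> x \<Longrightarrow> f x \<le> f x2"
      "\<And>x. 0 < x \<Longrightarrow> upper_threshold_eq \<alpha> \<beta> k c \<gamma> lam x \<longleftrightarrow> x = x2"
      and C_iff: "\<And>\<Psi> R. 0 \<le> \<Psi> \<Longrightarrow> 0 < R \<Longrightarrow> \<Psi> < C * R \<longleftrightarrow> - (k / (1 + \<Psi> / R) powr \<alpha>) < f x2"
      using costly_cases[OF costly] by blast
    \<comment> \<open>Thus \<open>x2\<close> maximises \<open>f\<close> on the whole half-line, and
      the comparison of \<open>f x2\<close> with \<open>- q\<close> decides between entering and
      staying out.\<close>
    have f_le: "f x \<le> f x2" if "0 \<le> x" for x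
      using x2(4)[of x] f_increasing[OF x2(3) that, of x2] by (cases "x2 \<le> x") auto
    have q_iff: "\<Psi> < C * R \<longleftrightarrow> - entry_problem.q \<alpha> k \<Psi> R < f x2" if "0 \<le> \<Psi>" "0 < R" for \<Psi> R
      using C_iff[OF that] entry_problemI[OF that]
      by (simp add: entry_problem.q_def entry_problem.\<rho>_def)
    note enter = entry_problem.costly_entering_solution[OF entry_problemI x2]
    note never = entry_problem.never_entering_solution[OF entry_problemI]
    have never_le: "f x \<le> - entry_problem.q \<alpha> k \<Psi> R" if "0 \<le> \<Psi>" "0 < R" "\<not> \<Psi> < C * R" "0 \<le> x" for \<Psi> R x
      using f_le[OF that(4)] q_iff[OF that(1,2)] that(3) by simp
    have "\<exists>g2bar. smallest_concave_majorant_on {0..} (scaled_payoff_g2 \<alpha> \<beta> k c \<gamma> lam \<Psi> R) g2bar \<and>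
        (\<forall>p>0. entry_value M F P \<alpha> k \<gamma> lam \<Psi> R p = g2bar (p powr \<beta>))" if "0 \<le> \<Psi>" "0 < R" for \<Psi> R
    proof (cases "\<Psi> < C * R")
      case True
      then show ?thesis by (intro enter(1)[OF that]) (use q_iff[OF that] in auto)
    next
      case False
      then show ?thesis by (intro never(1)[OF that] never_le[OF that])
    qed
    moreover have "\<not> lam / \<gamma> \<le> (\<alpha> / (\<beta> * k) * c powr (1 - \<beta>) * (c - 1) powr (\<alpha> - 1)) powr (1 / \<beta>)"
      using costly cheap_iff by simp
    ultimately show ?thesis
    proof (intro conjI, goal_cases)
      case 1
      then show ?case by blast
    next
      case 2
      then show ?case by blast
    next
      case 3
      show ?case
      proof (rule impI, rule exI[of _ C], rule conjI[OF C], intro allI impI, goal_cases)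
        case (1 \<Psi> R)
        show ?case
        proof (rule conjI; rule impI)
          assume "\<Psi> < C * R"
          then have "- entry_problem.q \<alpha> k \<Psi> R < f x2" using q_iff[OF 1(2,3)] by simp
          then show "\<exists>p\<^sub>1 p\<^sub>2. 0 \<le> p\<^sub>1 \<and> p\<^sub>1 < p\<^sub>2 \<and>
               is_lower_threshold \<alpha> \<beta> k c \<gamma> lam \<Psi> R p\<^sub>1 \<and>
               is_upper_threshold \<alpha> \<beta> k c \<gamma> lam \<Psi> R p\<^sub>2 \<and>
               (\<forall>p>0.
                  optimal_entry M F P \<alpha> k \<gamma> lam \<Psi> R p (first_time (P p) {p\<^sub>1..p\<^sub>2}) \<and>
                  entry_value M F P \<alpha> k \<gamma> lam \<Psi> R p =
                    (if p > p\<^sub>2 then entry_curve_W \<alpha> \<beta> k c \<gamma> lam \<Psi> R p\<^sub>2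
                     else if p \<ge> p\<^sub>1 then entry_curve_W \<alpha> \<beta> k c \<gamma> lam \<Psi> R p
                     else (entry_curve_W \<alpha> \<beta> k c \<gamma> lam \<Psi> R p\<^sub>1 + k * R powr \<alpha>)
                            * (p powr \<beta> / p\<^sub>1 powr \<beta>) - k * R powr \<alpha>))"
            by (intro enter(2)[OF 1(2,3)])
        next
          assume "C * R \<le> \<Psi>"
          then show "\<forall>p>0. optimal_entry M F P \<alpha> k \<gamma> lam \<Psi> R p (\<lambda>_. \<top>) \<and>
               entry_value M F P \<alpha> k \<gamma> lam \<Psi> R p = - k * R powr \<alpha>"
            by (intro never(2)[OF 1(2,3)] never_le[OF 1(2,3)]) auto
        qed
      qed
    qed
  qed
qed

end
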